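(* Let $R>0$, $\lambda\in\mathbb{R}$, $\alpha<-1$, $Q\geq p$ and $p-1<q\leq p-1+\frac{p}{Q}$. If $\frac{2Q}{Q+1}\leq p<2$ and $c>\left(\frac{|\alpha+1|}{p}\right)^{p}$, then the problem $$\begin{cases}\frac{\partial u}{\partial t}=\nabla_\gamma\cdot\left(\left(\log\frac{R}{\rho}\right)^{\alpha+p}|\nabla_\gamma u|^{p-2}\nabla_\gamma u\right)+c\left(\log\frac{R}{\rho}\right)^{\alpha}\frac{|x|^{\gamma p}}{\rho^{\gamma p+p}}u^{p-1}+\lambda u^q&\text{in }B_{R}\times(0,T),\\ u(z,0)=u_0(z)\geq0&\text{in }B_{R},\\ u(z,t)=0&\text{on }\partial B_{R}\times(0,T)\end{cases}$$ has no general positive local solution off of $\{(0,0)\}$.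
   Context: Baouendi–Grushin setting: $m,k\ge 1$ are integers, $\gamma\geq0$ is a real number, points are $z=(x,y)\in\mathbb{R}^{m}\times\mathbb{R}^{k}=\mathbb{R}^{m+k}$, $|\cdot|$ is the Euclidean norm. Vector fields: $X_i=\partial/\partial x_i$ ($1\le i\le m$), $Y_j=|x|^{\gamma}\,\partial/\partial y_j$ ($1\le j\le k$); $\nabla_{\gamma}=(X_1,\ldots,X_m,Y_1,\ldots,Y_k)=(\nabla_x,|x|^{\gamma}\nabla_y)$; for $F=(F_1,\ldots,F_{m+k})$, $\nabla_\gamma\cdot F=\sum_{i=1}^m X_iF_i+\sum_{j=1}^k Y_jF_{m+j}$. The homogeneous dimension is $Q=m+(1+\gamma)k$, $$\rho=\rho(z)=\left(|x|^{2(1+\gamma)}+(1+\gamma)^2|y|^2\right)^{\frac{1}{2(1+\gamma)}},$$ and $B_R=\{z\in\mathbb{R}^{m+k}:\rho(z)<R\}$. With $\Omega=B_R$ and $\mathcal{K}=\{(0,0)\}$, a function $u$ is a general (also called generalized) positive local solution off of $\mathcal{K}$ of the problem if: (i) $\mathcal{K}$ is a closed Lebesgue null subset of $\Omega$; (ii) $u:[0,T)\to L^{1}(\Omega)$ is continuous for some $T>0$; (iii$'$) $u(z,t)$ is positive and locally bounded on $(\Omega\setminus\mathcal{K})\times(0,T)$; (iv$'$) $1/u(z,t)$ is locally bounded on $(\Omega\setminus\mathcal{K})\times(0,T)$; (v) $\lim_{t\to0}u(\cdot,t)=u_{0}$ in the sense of distributions; (vi) $\nabla_{\gamma}u\in L^{p}_{\mathrm{loc}}(\Omega)$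 and $u$ is a solution of the PDE in the sense of distributions. *)

theory Defs
  imports "HOL-Analysis.Analysis"
begin

type_synonym ('m, 'k) pt = "(real ^ 'm) \<times> (real ^ 'k)"

text \<open>\<open>r\<^sup>s\<close> for \<open>r \<ge> 0\<close>, with \<open>0\<^sup>0 = 1\<close> (whereas \<open>0 powr 0 = 0\<close>), so that the fields
  \<open>Y\<^sub>j\<close> are the Euclidean ones when \<open>\<gamma> = 0\<close>.\<close>

definition rpow :: "real \<Rightarrow> real \<Rightarrow> real" where
  "rpow r s = (if s = 0 then 1 else r powr s)"

definition X_field :: "'m \<Rightarrow> (('m::finite, 'k::finite) pt \<Rightarrow> real) \<Rightarrow> ('m, 'k) pt \<Rightarrow> real" where
  "X_field i f z = frechet_derivative f (at z) (axis i 1, 0)"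

definition Y_field :: "real \<Rightarrow> 'k \<Rightarrow> (('m::finite, 'k::finite) pt \<Rightarrow> real) \<Rightarrow> ('m, 'k) pt \<Rightarrow> real" where
  "Y_field \<gamma> j f z = rpow (norm (fst z)) \<gamma> * frechet_derivative f (at z) (0, axis j 1)"

definition grushin_grad ::
  "real \<Rightarrow> (('m::finite, 'k::finite) pt \<Rightarrow> real) \<Rightarrow> ('m, 'k) pt \<Rightarrow> ('m, 'k) pt" where
  "grushin_grad \<gamma> f z = ((\<chi> i. X_field i f z), (\<chi> j. Y_field \<gamma> j f z))"

definition grushin_rho :: "real \<Rightarrow> ('m::finite, 'k::finite) pt \<Rightarrow> real" where
  "grushin_rho \<gamma> z =
     (norm (fst z) powr (2 * (1 + \<gamma>)) + (1 + \<gamma>)\<^sup>2 * (norm (snd z))\<^sup>2) powr (1 / (2 * (1 + \<gamma>)))"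

definition grushin_ball :: "real \<Rightarrow> real \<Rightarrow> ('m::finite, 'k::finite) pt set" where
  "grushin_ball \<gamma> R = {z. grushin_rho \<gamma> z < R}"


primrec C_k :: "nat \<Rightarrow> ('a::euclidean_space \<Rightarrow> real) \<Rightarrow> bool" where
  "C_k 0 f \<longleftrightarrow> continuous_on UNIV f"
| "C_k (Suc n) f \<longleftrightarrow>
     (\<forall>x. f differentiable (at x)) \<and> (\<forall>b\<in>Basis. C_k n (\<lambda>x. frechet_derivative f (at x) b))"

definition test_function :: "'a::euclidean_space set \<Rightarrow> ('a \<Rightarrow> real) \<Rightarrow> bool" where
  "test_function S f \<longleftrightarrow>
     (\<forall>n. C_k n f) \<and> compact (closure {x. f x \<noteq> 0}) \<and> closure {x. f x \<noteq> 0} \<subseteq> S"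

definition locally_integrable_on ::
  "('a::euclidean_space \<Rightarrow> 'b::euclidean_space) \<Rightarrow> 'a set \<Rightarrow> bool" where
  "locally_integrable_on f S \<longleftrightarrow> (\<forall>C. compact C \<and> C \<subseteq> S \<longrightarrow> f absolutely_integrable_on C)"

definition locally_Lp_on ::
  "real \<Rightarrow> ('a::euclidean_space \<Rightarrow> 'b::euclidean_space) \<Rightarrow> 'a set \<Rightarrow> bool" where
  "locally_Lp_on p f S \<longleftrightarrow>
     f \<in> borel_measurable (lebesgue_on S) \<and> locally_integrable_on (\<lambda>x. norm (f x) powr p) S"

definition locally_bounded_on :: "('a::topological_space \<Rightarrow> real) \<Rightarrow> 'a set \<Rightarrow> bool" where
  "locally_bounded_on f S \<longleftrightarrow> (\<forall>x\<in>S. \<exists>U. open U \<and> x \<in> U \<and> bounded (f ` (U \<inter> S)))"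

definition continuous_into_L1 :: "real set \<Rightarrow> 'a::euclidean_space set \<Rightarrow> (real \<Rightarrow> 'a \<Rightarrow> real) \<Rightarrow> bool" where
  "continuous_into_L1 I \<Omega> u \<longleftrightarrow>
     (\<forall>t\<in>I. integrable (lebesgue_on \<Omega>) (u t)) \<and>
     (\<forall>t\<in>I. ((\<lambda>s. LINT z|lebesgue_on \<Omega>. \<bar>u s z - u t z\<bar>) \<longlongrightarrow> 0) (at t within I))"


text \<open>\<open>G\<close> is the distributional \<open>\<nabla>\<^sub>\<gamma> u\<close> on \<open>\<Omega> \<times> (0,T)\<close>. There is no extra term on the right because
  the formal adjoints of \<open>X\<^sub>i\<close> and \<open>Y\<^sub>j\<close> are \<open>- X\<^sub>i\<close> and \<open>- Y\<^sub>j\<close> (\<open>|x|\<^sup>\<gamma>\<close> does not depend on \<open>y\<close>).\<close>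

definition weak_grushin_grad ::
  "real \<Rightarrow> ('m::finite, 'k::finite) pt set \<Rightarrow> real \<Rightarrow>
   (real \<Rightarrow> ('m, 'k) pt \<Rightarrow> real) \<Rightarrow> (('m, 'k) pt \<times> real \<Rightarrow> ('m, 'k) pt) \<Rightarrow> bool" where
  "weak_grushin_grad \<gamma> \<Omega> T u G \<longleftrightarrow>
     locally_integrable_on (\<lambda>(z, t). u t z) (\<Omega> \<times> {0<..<T}) \<and>
     locally_integrable_on G (\<Omega> \<times> {0<..<T}) \<and>
     (\<forall>\<phi>. test_function (\<Omega> \<times> {0<..<T}) \<phi> \<longrightarrow>
       (LINT (z, t)|lebesgue_on (\<Omega> \<times> {0<..<T}). u t z *\<^sub>R grushin_grad \<gamma> (\<lambda>z'. \<phi> (z', t)) z) =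
       - (LINT (z, t)|lebesgue_on (\<Omega> \<times> {0<..<T}). \<phi> (z, t) *\<^sub>R G (z, t)))"

text \<open>\<open>u\<^sub>t = \<nabla>\<^sub>\<gamma> \<cdot> F + g\<close> in the sense of distributions on \<open>\<Omega> \<times> (0,T)\<close>.\<close>

definition distributional_evolution ::
  "real \<Rightarrow> ('m::finite, 'k::finite) pt set \<Rightarrow> real \<Rightarrow> (real \<Rightarrow> ('m, 'k) pt \<Rightarrow> real) \<Rightarrow>
   (('m, 'k) pt \<times> real \<Rightarrow> ('m, 'k) pt) \<Rightarrow> (('m, 'k) pt \<times> real \<Rightarrow> real) \<Rightarrow> bool" where
  "distributional_evolution \<gamma> \<Omega> T u F g \<longleftrightarrow>
     locally_integrable_on (\<lambda>(z, t). u t z) (\<Omega> \<times> {0<..<T}) \<and>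
     locally_integrable_on F (\<Omega> \<times> {0<..<T}) \<and>
     locally_integrable_on g (\<Omega> \<times> {0<..<T}) \<and>
     (\<forall>\<phi>. test_function (\<Omega> \<times> {0<..<T}) \<phi> \<longrightarrow>
       - (LINT (z, t)|lebesgue_on (\<Omega> \<times> {0<..<T}). u t z * deriv (\<lambda>s. \<phi> (z, s)) t) =
       - (LINT (z, t)|lebesgue_on (\<Omega> \<times> {0<..<T}). F (z, t) \<bullet> grushin_grad \<gamma> (\<lambda>z'. \<phi> (z', t)) z)
       + (LINT (z, t)|lebesgue_on (\<Omega> \<times> {0<..<T}). g (z, t) * \<phi> (z, t)))"

definition initial_value_distr ::
  "'a::euclidean_space set \<Rightarrow> (real \<Rightarrow> 'a \<Rightarrow> real) \<Rightarrow> ('a \<Rightarrow> real) \<Rightarrow> bool" where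
  "initial_value_distr \<Omega> u u0 \<longleftrightarrow>
     locally_integrable_on u0 \<Omega> \<and>
     (\<forall>\<psi>. test_function \<Omega> \<psi> \<longrightarrow>
       ((\<lambda>t. LINT z|lebesgue_on \<Omega>. u t z * \<psi> z) \<longlongrightarrow> (LINT z|lebesgue_on \<Omega>. u0 z * \<psi> z)) (at_right 0))"

text \<open>General positive local solutions off of \<open>K\<close> of the problem
    \<open>u\<^sub>t = \<nabla>\<^sub>\<gamma> \<cdot> (w |\<nabla>\<^sub>\<gamma> u|\<^bsup>p-2\<^esup> \<nabla>\<^sub>\<gamma> u) + V u\<^bsup>p-1\<^esup> + lam u\<^bsup>q\<^esup>\<close> in \<open>\<Omega> \<times> (0,T)\<close>,
    \<open>u(\<cdot>,0) = u\<^sub>0\<close> in \<open>\<Omega>\<close>, \<open>u = 0\<close> on \<open>\<partial>\<Omega> \<times> (0,T)\<close>.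

  Two points need care. Since \<open>u\<close> is a function of space and time, \<open>\<nabla>\<^sub>\<gamma> u \<in> L\<^sup>p\<^sub>l\<^sub>o\<^sub>c\<close> is local \<open>p\<close>-integrability
  over compact subsets of \<open>\<Omega> \<times> (0,T)\<close>. As an element of \<open>L\<^sup>1(\<Omega>)\<close>, \<open>u(\<cdot>,t)\<close> does not see
  \<open>\<partial>\<Omega>\<close>; the boundary values are those of the representative \<open>u\<close>, and no trace or decay towards
  \<open>\<partial>\<Omega>\<close> is required. So the boundary condition excludes no \<open>L\<^sup>1(\<Omega>)\<close>-valued \<open>u\<close>, and
  non-existence in the present sense entails it for every trace reading.\<close>

definition general_positive_local_solution ::
  "real \<Rightarrow> real \<Rightarrow> real \<Rightarrow> real \<Rightarrow>
   (('m::finite, 'k::finite) pt \<Rightarrow> real) \<Rightarrow> (('m, 'k) pt \<Rightarrow> real) \<Rightarrow>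
   ('m, 'k) pt set \<Rightarrow> ('m, 'k) pt set \<Rightarrow> (('m, 'k) pt \<Rightarrow> real) \<Rightarrow>
   real \<Rightarrow> (real \<Rightarrow> ('m, 'k) pt \<Rightarrow> real) \<Rightarrow> bool" where
  "general_positive_local_solution \<gamma> p q lam w V \<Omega> K u0 T u \<longleftrightarrow>
     closedin (top_of_set \<Omega>) K \<and> negligible K \<and>
     T > 0 \<and> continuous_into_L1 {0..<T} \<Omega> u \<and>
     (\<forall>z\<in>\<Omega> - K. \<forall>t\<in>{0<..<T}. u t z > 0) \<and>
     locally_bounded_on (\<lambda>(z, t). u t z) ((\<Omega> - K) \<times> {0<..<T}) \<and>
     locally_bounded_on (\<lambda>(z, t). 1 / u t z) ((\<Omega> - K) \<times> {0<..<T}) \<and>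
     initial_value_distr \<Omega> u u0 \<and>
     (\<exists>G. weak_grushin_grad \<gamma> \<Omega> T u G \<and>
          locally_Lp_on p G (\<Omega> \<times> {0<..<T}) \<and>
          distributional_evolution \<gamma> \<Omega> T u
            (\<lambda>(z, t). (w z * norm (G (z, t)) powr (p - 2)) *\<^sub>R G (z, t))
            (\<lambda>(z, t). V z * u t z powr (p - 1) + lam * u t z powr q)) \<and>
     (\<forall>z\<in>frontier \<Omega>. \<forall>t\<in>{0<..<T}. u t z = 0)"

end

theory Submission
  imports Defs
begin

text \<open>The contradiction comes from the boundary \<open>\<rho> = R\<close>, where \<open>L = ln (R / \<rho>)\<close> behaves like the distance to it. In the variable
  \<open>L\<close> the weights of the diffusion and of the potential are \<open>L\<close> to the powers \<open>\<alpha> + p\<close> and \<open>\<alpha>\<close>, times the \<open>p\<close>-th power of \<open>|\<nabla>\<^sub>\<gamma> L|\<close>. For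
  \<open>\<alpha> < -1\<close> the Hardy inequality for these weights has the best constant \<open>s\<^sup>p\<close> with \<open>s = |\<alpha> + 1| / p\<close>, and its virtual extremal
  \<open>L\<^sup>s\<close> makes both sides diverge like the integral of \<open>1/L\<close>. If \<open>c > s\<^sup>p\<close>, then \<open>\<phi> = L\<^sup>s\<close>, cut off slowly over \<open>N\<close> powers of \<open>e\<close>,
  remains uniformly bounded while the integral of \<open>V \<phi>\<^sup>p - w |\<nabla>\<^sub>\<gamma> \<phi>|\<^sup>p\<close>, with \<open>V\<close> the potential and \<open>w\<close> the
  weight of the diffusion, grows linearly in \<open>N\<close>
  (\<open>energy_lower_bound\<close>; it rests on the volumes of the shells on which \<open>L\<close> lies between consecutive powers of \<open>e\<close>).

  On the other hand, testing the equation with \<open>\<phi>\<^sup>p u\<^sup>1\<^sup>-\<^sup>p\<close> and a time cutoff, and using Picone's inequality, bounds the same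
  integral by a constant times the integral of \<open>(u\<^sup>q\<^sup>+\<^sup>1\<^sup>-\<^sup>p + u\<^sup>2\<^sup>-\<^sup>p) \<phi>\<^sup>p\<close> over a compact time interval. The assumptions on \<open>p\<close>, \<open>q\<close> and
  \<open>Q\<close> place both exponents between \<open>0\<close> and \<open>1\<close>, and \<open>u\<close> is continuous with values in \<open>L\<^sup>1\<close>; so this bound is independent of \<open>N\<close>
  (\<open>solution_energy_inequality\<close>), and a large \<open>N\<close> gives the contradiction.

  The work lies in justifying the test function \<open>\<phi>\<^sup>p u\<^sup>1\<^sup>-\<^sup>p\<close>, because the equation holds for smooth test functions only and
  \<open>u\<^sub>t\<close> is just a distribution. Since \<open>\<phi>\<close> may be supported off \<open>x = 0\<close>, where the Grushin fields are smooth and nondegenerate, the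
  problem can be rewritten with a Euclidean flux and gradient (\<open>weak_gradient_euclidean\<close>, \<open>evolution_euclidean\<close>). After
  mollification in space and time the equation holds pointwise and can be multiplied by any function of the mollified solution;
  \<open>renormalized_identity\<close> passes to the limit by dominated convergence, with a majorant provided by
  \<open>mollify_dominated_sequence\<close> and, for the product of flux and gradient, by \<open>mollify_product_bound\<close>.\<close>

section \<open>Smooth functions and mollifier kernels\<close>

lemma C_k_continuous: "C_k n f \<Longrightarrow> continuous_on UNIV f"
  by (cases n) (auto simp: differentiable_imp_continuous_on differentiable_on_def
      differentiable_at_withinI)

lemma C_k_pred: "C_k (Suc n) f \<Longrightarrow> C_k n f"
proof (induction n arbitrary: f)
  case 0
  then show ?case using C_k_continuous[of "Suc 0" f] by simp
next
  case (Suc n)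
  have "\<forall>b\<in>Basis. C_k (Suc n) (\<lambda>x. frechet_derivative f (at x) b)" "\<forall>x. f differentiable (at x)"
    using Suc.prems unfolding C_k.simps(2)[of "Suc n"] by auto
  then show ?case using Suc.IH unfolding C_k.simps(2) by blast
qed

lemma C_k_SucI:
  assumes "\<And>x. (f has_derivative f' x) (at x)" "\<And>b. b \<in> Basis \<Longrightarrow> C_k n (\<lambda>x. f' x b)"
  shows "C_k (Suc n) f"
proof -
  have "frechet_derivative f (at x) = f' x" for x
    using assms(1) frechet_derivative_at by metis
  moreover have "f differentiable (at x)" for x using assms(1) differentiable_def by blast
  ultimately show ?thesis using assms(2) by simp
qed

lemma C_k_has_derivative:
  "C_k (Suc n) f \<Longrightarrow> (f has_derivative frechet_derivative f (at x)) (at x)"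
  by (simp add: frechet_derivative_works)

lemma C_k_const: "C_k n (\<lambda>x. c)"
proof (induction n arbitrary: c)
  case (Suc n)
  show ?case by (rule C_k_SucI[where f'="\<lambda>x h. 0"]) (use Suc in auto)
qed simp

lemma C_k_add: "C_k n f \<Longrightarrow> C_k n g \<Longrightarrow> C_k n (\<lambda>x. f x + g x)"
proof (induction n arbitrary: f g)
  case 0 then show ?case by (simp add: continuous_on_add)
next
  case (Suc n)
  show ?case
    by (rule C_k_SucI[OF has_derivative_add[OF C_k_has_derivative[OF Suc.prems(1)]
          C_k_has_derivative[OF Suc.prems(2)]]])
       (use Suc in simp)
qed

lemma C_k_mult: "C_k n f \<Longrightarrow> C_k n g \<Longrightarrow> C_k n (\<lambda>x. f x * g x)"
proof (induction n arbitrary: f g)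
  case 0 then show ?case by (simp add: continuous_on_mult)
next
  case (Suc n)
  show ?case
    by (rule C_k_SucI[OF has_derivative_mult[OF C_k_has_derivative[OF Suc.prems(1)]
          C_k_has_derivative[OF Suc.prems(2)]]], intro C_k_add Suc.IH)
       (use Suc.prems C_k_pred in auto)
qed

lemma C_k_bounded_linear:
  fixes f :: "'a::euclidean_space \<Rightarrow> real"
  assumes "bounded_linear f" shows "C_k n f"
proof (cases n)
  case 0 then show ?thesis using assms by (simp add: linear_continuous_on)
next
  case (Suc m)
  show ?thesis
    unfolding Suc by (rule C_k_SucI[OF bounded_linear_imp_has_derivative[OF assms]]) (rule C_k_const)
qed

lemma C_k_affine:
  fixes f :: "'a::euclidean_space \<Rightarrow> real"
  shows "C_k n f \<Longrightarrow> C_k n (\<lambda>x. f (a + c *\<^sub>R x))"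
proof (induction n arbitrary: f)
  case 0
  then show ?case
    by (auto intro!: continuous_intros continuous_on_compose2[of UNIV f UNIV "\<lambda>x. a + c *\<^sub>R x"])
next
  case (Suc n)
  have "((\<lambda>x. f (a + c *\<^sub>R x)) has_derivative (\<lambda>h. frechet_derivative f (at (a + c *\<^sub>R x)) (c *\<^sub>R h))) (at x)" for x
    by (rule has_derivative_compose[OF _ C_k_has_derivative[OF Suc.prems], of "\<lambda>x. a + c *\<^sub>R x"])
       (auto intro!: derivative_eq_intros)
  moreover have "frechet_derivative f (at y) (c *\<^sub>R b) = c * frechet_derivative f (at y) b" for y b
    using has_derivative_linear[OF C_k_has_derivative[OF Suc.prems, of y]] by (simp add: linear_cmul)
  ultimately show ?case
    using Suc.prems by (intro C_k_SucI[where f'="\<lambda>x h. c * frechet_derivative f (at (a + c *\<^sub>R x)) h"])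
       (auto intro!: C_k_mult C_k_const Suc.IH[of "\<lambda>x. frechet_derivative f (at x) b" for b])
qed

text \<open>The family of the function \<open>exp (-1/t)\<close>, glued to \<open>0\<close> at the origin, divided by the powers of \<open>t\<close>:
  it is closed under differentiation up to linear combinations, which is what an induction on the order of
  differentiability needs.\<close>

definition flat :: "nat \<Rightarrow> real \<Rightarrow> real" where
  "flat j t = (if t > 0 then exp (- (1 / t)) / t ^ j else 0)"

text \<open>At \<open>t = 0\<close> the exponential beats every power of \<open>1/t\<close>, so all one-sided difference quotients vanish.\<close>

lemma flat_has_derivative:
  "(flat j has_real_derivative flat (j + 2) t - real j * flat (j + 1) t) (at t)"
proof (cases t "0::real" rule: linorder_cases)
  case greater
  have "((\<lambda>t. exp (- (1 / t)) / t ^ j) has_real_derivative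
          exp (- (1 / t)) / t ^ (j + 2) - real j * (exp (- (1 / t)) / t ^ (j + 1))) (at t)"
  proof -
    have "((\<lambda>t. exp (- (1 / t)) / t ^ j) has_real_derivative
          ((1/t^2) * exp (- (1 / t)) * t ^ j - exp (- (1 / t)) * (real j * t ^ (j - 1))) / (t ^ j * t ^ j)) (at t)"
      using greater by (auto intro!: derivative_eq_intros simp: power2_eq_square)
    moreover have "((1/t^2) * exp (- (1 / t)) * t ^ j - exp (- (1 / t)) * (real j * t ^ (j - 1))) / (t ^ j * t ^ j)
        = exp (- (1 / t)) / t ^ (j + 2) - real j * (exp (- (1 / t)) / t ^ (j + 1))"
      using greater by (cases j) (auto simp: field_simps power2_eq_square)
    ultimately show ?thesis by simp
  qed
  then have "((\<lambda>t. exp (- (1 / t)) / t ^ j) has_real_derivative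
          flat (j + 2) t - real j * flat (j + 1) t) (at t)"
    using greater by (simp add: flat_def)
  then show ?thesis
    by (rule has_field_derivative_transform_within_open[of _ _ _ "{0<..}"])
       (use greater in \<open>auto simp: flat_def\<close>)
next
  case less
  have "((\<lambda>t. 0) has_real_derivative 0) (at t)" by simp
  then have "(flat j has_real_derivative 0) (at t)"
    by (rule has_field_derivative_transform_within_open[of _ _ _ "{..<0}"])
       (use less in \<open>auto simp: flat_def\<close>)
  then show ?thesis using less by (simp add: flat_def)
next
  case equal
  have "((\<lambda>h. flat j h / h) \<longlongrightarrow> 0) (at 0)"
  proof -
    have "((\<lambda>h::real. exp (- (1 / h)) / h ^ j / h) \<longlongrightarrow> 0) (at_right 0)"
    proof -
      have "((\<lambda>x::real. x ^ (j + 1) / exp x) \<longlongrightarrow> 0) at_top"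
        by (rule tendsto_power_div_exp_0)
      then have "((\<lambda>h::real. inverse h ^ (j + 1) / exp (inverse h)) \<longlongrightarrow> 0) (at_right 0)"
        by (rule filterlim_compose[OF _ filterlim_inverse_at_top_right])
      moreover have "\<forall>\<^sub>F h::real in at_right 0. inverse h ^ (j + 1) / exp (inverse h) = exp (- (1 / h)) / h ^ j / h"
        by (rule eventually_at_rightI[of 0 1]) (auto simp: exp_minus field_simps)
      ultimately show ?thesis by (rule Lim_transform_eventually)
    qed
    moreover have "\<forall>\<^sub>F h::real in at_right 0. exp (- (1 / h)) / h ^ j / h = flat j h / h"
      by (rule eventually_at_rightI[of 0 1]) (auto simp: flat_def)
    ultimately have "((\<lambda>h. flat j h / h) \<longlongrightarrow> 0) (at_right 0)" by (rule Lim_transform_eventually)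
    moreover have "\<forall>\<^sub>F h::real in at_left 0. 0 = flat j h / h"
      by (rule eventually_at_leftI[of "-1" 0]) (auto simp: flat_def)
    then have "((\<lambda>h. flat j h / h) \<longlongrightarrow> 0) (at_left 0)"
      by (rule Lim_transform_eventually[OF tendsto_const])
    ultimately show ?thesis by (simp add: filterlim_split_at)
  qed
  then show ?thesis using equal by (simp add: flat_def has_field_derivative_iff)
qed

lemma flat_pos: "t > 0 \<Longrightarrow> flat j t > 0" and flat_nonneg: "flat j t \<ge> 0"
  by (auto simp: flat_def)

text \<open>Each derivative of \<open>flat j\<close> along the quadratic \<open>e - x \<bullet> x\<close> is a combination of two other members of the family
  with polynomial coefficients; hence the induction runs over all \<open>j\<close> at once.\<close>

lemma C_k_flat_ball:
  fixes e :: real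
  shows "C_k n (\<lambda>x::'a::euclidean_space. flat j (e - x \<bullet> x))"
proof (induction n arbitrary: j)
  case 0
  have "continuous_on UNIV (flat j)"
    using flat_has_derivative DERIV_isCont continuous_at_imp_continuous_on by blast
  then show ?case
    by (auto intro!: continuous_intros continuous_on_compose2[of UNIV "flat j" UNIV])
next
  case (Suc n)
  have d: "((\<lambda>x::'a. flat j (e - x \<bullet> x)) has_derivative
      (\<lambda>h. (flat (j + 2) (e - x \<bullet> x) + (- real j) * flat (j + 1) (e - x \<bullet> x)) * ((-2) * (x \<bullet> h)))) (at x)" for x
  proof -
    have "((\<lambda>x::'a. e - x \<bullet> x) has_derivative (\<lambda>h. - 2 * (x \<bullet> h))) (at x)"
      by (auto intro!: derivative_eq_intros simp: inner_commute)
    from has_derivative_compose[OF this flat_has_derivative[unfolded has_field_derivative_def]]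
    show ?thesis by simp
  qed
  show ?case
    by (rule C_k_SucI[OF d], intro C_k_mult C_k_add C_k_const Suc.IH C_k_bounded_linear)
       (rule bounded_linear_inner_left)
qed

definition mollifier_kernel :: "real \<Rightarrow> ('a::euclidean_space \<Rightarrow> real) \<Rightarrow> bool" where
  "mollifier_kernel e k \<longleftrightarrow> (\<forall>n. C_k n k) \<and> (\<forall>x. k x \<ge> 0) \<and> (\<forall>x. norm x > e \<longrightarrow> k x = 0) \<and>
     integrable lborel k \<and> (LINT x|lborel. k x) = 1"

lemma integrable_continuous_compact_support:
  fixes f :: "'a::euclidean_space \<Rightarrow> 'b::{banach, second_countable_topology}"
  assumes "continuous_on UNIV f" "\<And>x. norm x > e \<Longrightarrow> f x = 0"
  shows "integrable lborel f"
proof -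
  have "integrable lborel (\<lambda>x. indicator (cball 0 e) x *\<^sub>R f x)"
    by (rule borel_integrable_compact) (use assms(1) continuous_on_subset in auto)
  also have "(\<lambda>x. indicator (cball 0 e) x *\<^sub>R f x) = f"
    using assms(2) by (auto simp: indicator_def fun_eq_iff not_le)
  finally show ?thesis .
qed

text \<open>Normalise \<open>flat 0\<close> composed with \<open>e\<^sup>2 - |x|\<^sup>2\<close>; its integral is positive because it is positive on an open ball.\<close>

lemma mollifier_kernel_exists:
  assumes "e > 0" shows "\<exists>k::'a::euclidean_space \<Rightarrow> real. mollifier_kernel e k"
proof -
  define f where "f = (\<lambda>x::'a. flat 0 (e\<^sup>2 - x \<bullet> x))"
  have C: "C_k n f" for n unfolding f_def by (rule C_k_flat_ball)
  have supp: "f x = 0" if "norm x > e" for x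
  proof -
    have "x \<bullet> x > e\<^sup>2" using that assms by (simp add: dot_square_norm power_strict_mono)
    then show ?thesis by (simp add: f_def flat_def)
  qed
  have int: "integrable lborel f"
    by (rule integrable_continuous_compact_support[of _ e]) (use C[of 0] supp in auto)
  have nn: "f x \<ge> 0" for x by (simp add: f_def flat_nonneg)
  have "(LINT x|lborel. f x) \<noteq> 0"
  proof
    assume "(LINT x|lborel. f x) = 0"
    then have "AE x in lborel. f x = 0" using integral_nonneg_eq_0_iff_AE[OF int] nn by auto
    moreover have "x \<notin> ball 0 e" if "f x = 0" for x
    proof
      assume "x \<in> ball 0 e"
      then have "x \<bullet> x < e\<^sup>2" using assms by (simp add: dot_square_norm power_strict_mono)
      then have "f x > 0" unfolding f_def by (intro flat_pos) simp
      then show False using that by simp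
    qed
    ultimately have "AE x in lborel. x \<notin> ball (0::'a) e" by auto
    then have "ball (0::'a) e \<in> null_sets lborel" by (simp add: AE_iff_null ball_def)
    then have "negligible (ball (0::'a) e)" using null_sets_completionI negligible_iff_null_sets by blast
    then show False using assms open_not_negligible[of "ball (0::'a) e"] by auto
  qed
  moreover have "(LINT x|lborel. f x) \<ge> 0" using nn by simp
  ultimately have pos: "(LINT x|lborel. f x) > 0" by simp
  have "mollifier_kernel e (\<lambda>x. inverse (LINT x|lborel. f x) * f x)"
    unfolding mollifier_kernel_def using C supp int nn pos
    by (auto intro!: C_k_mult C_k_const)
  then show ?thesis by blast
qed

section \<open>Integrals of derivatives and derivatives of mollifications\<close>

text \<open>By translation invariance the integral of every difference quotient of \<open>f\<close> is zero. The mean value theorem bounds the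
  quotients by \<open>C\<close> on a fixed ball, so dominated convergence carries this over to the derivative.\<close>

lemma integral_directional_derivative_eq_0:
  fixes f :: "'a::euclidean_space \<Rightarrow> real"
  assumes der: "\<And>x. (f has_derivative f' x) (at x)"
    and supp: "\<And>x. norm x > r \<Longrightarrow> f x = 0"
    and bound: "\<And>x. \<bar>f' x b\<bar> \<le> C"
  shows "integrable lborel (\<lambda>x. f' x b)" "(LINT x|lborel. f' x b) = 0"
proof -
  define q where "q = (\<lambda>n x. (f (x + (1 / real (Suc n)) *\<^sub>R b) - f x) * real (Suc n))"
  have cont: "continuous_on UNIV f"
    by (intro continuous_at_imp_continuous_on ballI has_derivative_continuous[OF der])
  have fint: "integrable lborel f"
    by (rule integrable_continuous_compact_support[OF cont supp])
  have [measurable]: "f \<in> borel_measurable borel"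
    by (rule borel_measurable_continuous_onI[OF cont])
  have line: "((\<lambda>s. f (x + s *\<^sub>R b)) has_real_derivative f' (x + s *\<^sub>R b) b) (at s)" for x s
  proof -
    have "((\<lambda>s. f (x + s *\<^sub>R b)) has_derivative (\<lambda>h. f' (x + s *\<^sub>R b) (h *\<^sub>R b))) (at s)"
      by (rule has_derivative_compose[OF _ der, of "\<lambda>s. x + s *\<^sub>R b"]) (auto intro!: derivative_eq_intros)
    moreover have "f' (x + s *\<^sub>R b) (h *\<^sub>R b) = f' (x + s *\<^sub>R b) b * h" for h
      using has_derivative_linear[OF der] by (simp add: linear_cmul)
    ultimately show ?thesis by (simp add: has_field_derivative_def)
  qed
  have qlim: "(\<lambda>n. q n x) \<longlonglongrightarrow> f' x b" for x
  proof -
    have "((\<lambda>h. (f (x + h *\<^sub>R b) - f x) / h) \<longlongrightarrow> f' x b) (at 0)"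
      using line[of x 0] by (simp add: has_field_derivative_iff)
    moreover have "filterlim (\<lambda>n. 1 / real (Suc n)) (at 0) sequentially"
      unfolding filterlim_at using LIMSEQ_Suc[OF lim_1_over_n] by (simp add: eventually_sequentially)
    ultimately have "(\<lambda>n. (f (x + (1 / real (Suc n)) *\<^sub>R b) - f x) / (1 / real (Suc n))) \<longlonglongrightarrow> f' x b"
      by (rule filterlim_compose)
    then show ?thesis by (simp add: q_def)
  qed
  have qbound: "\<bar>q n x\<bar> \<le> C * indicator (cball 0 (r + norm b)) x" for n x
  proof (cases "norm x \<le> r + norm b")
    case True
    have "\<exists>z>0. z < 1 / real (Suc n) \<and> f (x + (1 / real (Suc n)) *\<^sub>R b) - f (x + 0 *\<^sub>R b)
        = (1 / real (Suc n) - 0) * f' (x + z *\<^sub>R b) b"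
      by (rule MVT2) (use line in auto)
    then obtain z where "f (x + (1 / real (Suc n)) *\<^sub>R b) - f x = (1 / real (Suc n)) * f' (x + z *\<^sub>R b) b"
      by auto
    then have "q n x = f' (x + z *\<^sub>R b) b" by (simp add: q_def)
    then show ?thesis using bound True by (auto simp: indicator_def)
  next
    case False
    have "norm x - norm ((1 / real (Suc n)) *\<^sub>R b) \<le> norm (x + (1 / real (Suc n)) *\<^sub>R b)"
      by (metis norm_diff_ineq)
    moreover have "norm ((1 / real (Suc n)) *\<^sub>R b) \<le> norm b"
    proof -
      have "(1 / real (Suc n)) * norm b \<le> 1 * norm b" by (intro mult_right_mono) auto
      then show ?thesis by simp
    qed
    ultimately have "f (x + (1 / real (Suc n)) *\<^sub>R b) = 0"
      by (intro supp) (use False in linarith)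
    moreover have "f x = 0" using False norm_ge_zero[of b] by (intro supp) linarith
    ultimately show ?thesis using False by (simp add: q_def)
  qed
  have W: "integrable lborel (\<lambda>x::'a. C * indicator (cball 0 (r + norm b)) x)"
    using emeasure_lborel_cball_finite[of "0::'a" "r + norm b"]
    by (intro integrable_mult_right integrable_real_indicator) auto
  have qm: "q n \<in> borel_measurable lborel" for n unfolding q_def by measurable
  have m: "(\<lambda>x. f' x b) \<in> borel_measurable lborel"
    by (rule borel_measurable_LIMSEQ_real[OF _ qm]) (use qlim in auto)
  have "(\<lambda>n. LINT x|lborel. q n x) \<longlonglongrightarrow> (LINT x|lborel. f' x b)"
    by (rule integral_dominated_convergence[OF m qm W]) (use qlim qbound in auto)
  moreover have "(LINT x|lborel. q n x) = 0" for n
  proof -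
    have "integrable (distr lborel borel ((+) ((1 / real (Suc n)) *\<^sub>R b))) f"
      using fint by (simp add: lborel_distr_plus)
    then have i: "integrable lborel (\<lambda>x. f (((1 / real (Suc n)) *\<^sub>R b) + x))"
      by (subst (asm) integrable_distr_eq) auto
    have "(LINT x|lborel. f (((1 / real (Suc n)) *\<^sub>R b) + x)) = (LINT x|distr lborel borel ((+) ((1 / real (Suc n)) *\<^sub>R b)). f x)"
      by (subst integral_distr) auto
    then have "(LINT x|lborel. f (((1 / real (Suc n)) *\<^sub>R b) + x)) = (LINT x|lborel. f x)"
      by (simp add: lborel_distr_plus)
    then show ?thesis using i fint by (simp add: q_def add.commute)
  qed
  ultimately have "(\<lambda>n. 0) \<longlonglongrightarrow> (LINT x|lborel. f' x b)" by (simp only:)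
  then show "(LINT x|lborel. f' x b) = 0" by (simp add: LIMSEQ_const_iff)
  show "integrable lborel (\<lambda>x. f' x b)"
    by (rule integrable_dominated_convergence[where s=q, OF m qm W]) (use qlim qbound in auto)
qed

definition mollify :: "('a::euclidean_space \<Rightarrow> real) \<Rightarrow> ('a \<Rightarrow> 'b::euclidean_space) \<Rightarrow> 'a \<Rightarrow> 'b" where
  "mollify k f z = (LINT y|lborel. k (z - y) *\<^sub>R f y)"

lemma continuous_compact_support_bounded:
  fixes g :: "'a::euclidean_space \<Rightarrow> real"
  assumes "continuous_on UNIV g" "\<And>x. norm x > r \<Longrightarrow> g x = 0"
  obtains M where "\<And>x. \<bar>g x\<bar> \<le> M"
proof -
  have "bounded (g ` cball 0 r)"
    by (intro compact_imp_bounded compact_continuous_image) (use assms(1) continuous_on_subset in auto)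
  then obtain B where B: "\<And>x. x \<in> cball 0 r \<Longrightarrow> norm (g x) \<le> B"
    unfolding bounded_iff by blast
  have "\<bar>g x\<bar> \<le> max B 0" for x
    using B[of x] assms(2)[of x] by (cases "norm x \<le> r") auto
  then show ?thesis by (rule that)
qed

lemma continuous_compact_support_uniform:
  fixes g :: "'a::euclidean_space \<Rightarrow> real"
  assumes c: "continuous_on UNIV g" and s: "\<And>x. norm x > r \<Longrightarrow> g x = 0" and "e > 0"
  shows "\<exists>d>0. \<forall>x h. norm h < d \<longrightarrow> \<bar>g (x + h) - g x\<bar> < e"
proof -
  have "uniformly_continuous_on (cball 0 (r + 1)) g"
    by (intro compact_uniformly_continuous) (use c continuous_on_subset in auto)
  then obtain d where d: "d > 0" "\<And>x y. x \<in> cball 0 (r + 1) \<Longrightarrow> y \<in> cball 0 (r + 1) \<Longrightarrow> dist y x < d \<Longrightarrow> dist (g y) (g x) < e"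
    unfolding uniformly_continuous_on_def using \<open>e > 0\<close> by metis
  have "\<bar>g (x + h) - g x\<bar> < e" if h: "norm h < min d 1" for x h
  proof (cases "norm x \<le> r + 1 \<and> norm (x + h) \<le> r + 1")
    case True
    then have "x \<in> cball 0 (r + 1)" "x + h \<in> cball 0 (r + 1)" unfolding mem_cball_0 by auto
    then have "dist (g (x + h)) (g x) < e"
      by (rule d(2)) (use h in \<open>simp add: dist_norm\<close>)
    then show ?thesis by (simp add: dist_norm)
  next
    case False
    have "norm (x + h) \<le> norm x + norm h" by (rule norm_triangle_ineq)
    moreover have "norm x \<le> norm (x + h) + norm h" using norm_triangle_ineq4[of "x + h" h] by simp
    ultimately have "norm x > r" "norm (x + h) > r" using False h by auto
    then show ?thesis using s \<open>e > 0\<close> by simp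
  qed
  then show ?thesis using d(1) by (intro exI[of _ "min d 1"]) auto
qed

lemma kernel_props:
  assumes k: "mollifier_kernel e k"
  shows kernel_deriv: "(k has_derivative frechet_derivative k (at x)) (at x)"
    and kernel_cont: "continuous_on UNIV k"
    and kernel_deriv_cont: "b \<in> Basis \<Longrightarrow> continuous_on UNIV (\<lambda>x. frechet_derivative k (at x) b)"
    and kernel_deriv_supp: "norm x > e \<Longrightarrow> frechet_derivative k (at x) h = 0"
    and kernel_supp: "norm x > e \<Longrightarrow> k x = 0"
    and kernel_nonneg: "k x \<ge> 0"
    and kernel_integrable: "integrable lborel k"
    and kernel_integral: "(LINT x|lborel. k x) = 1"
proof -
  have C: "C_k n k" for n using k by (simp add: mollifier_kernel_def)
  show 1: "(k has_derivative frechet_derivative k (at x)) (at x)" for x using C_k_has_derivative[OF C] .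
  show "continuous_on UNIV k" using C[of 0] by simp
  show "b \<in> Basis \<Longrightarrow> continuous_on UNIV (\<lambda>x. frechet_derivative k (at x) b)"
    using C[of "Suc 0"] by simp
  show s: "norm x > e \<Longrightarrow> k x = 0" for x using k by (simp add: mollifier_kernel_def)
  show "norm x > e \<Longrightarrow> frechet_derivative k (at x) h = 0"
  proof -
    assume x: "norm x > e"
    have "open {x::'a. norm x > e}" by (intro open_Collect_less continuous_intros)
    moreover have "((\<lambda>x. 0) has_derivative (\<lambda>h. 0)) (at x)" by simp
    ultimately have "(k has_derivative (\<lambda>h. 0)) (at x)"
      using x s by (metis (mono_tags, lifting) has_derivative_transform_within_open mem_Collect_eq)
    then have "frechet_derivative k (at x) = (\<lambda>h. 0)" using frechet_derivative_at by metis
    then show ?thesis by simp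
  qed
qed (use k in \<open>auto simp: mollifier_kernel_def\<close>)

lemma integrable_bounded_continuous_mult:
  fixes f :: "'a::euclidean_space \<Rightarrow> 'b::euclidean_space" and g :: "'a \<Rightarrow> real"
  assumes f: "integrable lborel f" and g: "continuous_on UNIV g" "\<And>x. \<bar>g x\<bar> \<le> M"
  shows "integrable lborel (\<lambda>y. g y *\<^sub>R f y)"
proof (rule Bochner_Integration.integrable_bound[of _ "\<lambda>y. M * norm (f y)"])
  have [measurable]: "f \<in> borel_measurable borel" using f by simp
  have [measurable]: "g \<in> borel_measurable borel" by (rule borel_measurable_continuous_onI[OF g(1)])
  show "(\<lambda>y. g y *\<^sub>R f y) \<in> borel_measurable lborel" by measurable
  show "AE x in lborel. norm (g x *\<^sub>R f x) \<le> norm (M * norm (f x))"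
    using g(2) by (auto intro!: AE_I2 mult_right_mono order_trans[OF g(2) abs_ge_self] simp: abs_mult)
qed (use f in simp)

lemma mollify_integrable:
  fixes f :: "'a::euclidean_space \<Rightarrow> 'b::euclidean_space"
  assumes k: "mollifier_kernel e k" and f: "integrable lborel f"
  shows "integrable lborel (\<lambda>y. k (z - y) *\<^sub>R f y)"
proof -
  obtain M where M: "\<And>x. \<bar>k x\<bar> \<le> M"
    using continuous_compact_support_bounded[OF kernel_cont[OF k] kernel_supp[OF k]] by blast
  have "continuous_on UNIV (\<lambda>y. k (z - y))"
    by (rule continuous_on_compose2[OF kernel_cont[OF k], of UNIV "\<lambda>y. z - y"])
      (auto intro!: continuous_intros)
  then show ?thesis
    by (rule integrable_bounded_continuous_mult[OF f, where M=M]) (rule M)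
qed

text \<open>The gradient of the kernel is uniformly continuous, so its first-order Taylor remainder is \<open>o(|h|)\<close> uniformly in the
  base point, and integrating the remainder against \<open>f\<close> keeps it \<open>o(|h|)\<close>.\<close>

lemma mollify_has_derivative:
  fixes f :: "'a::euclidean_space \<Rightarrow> real"
  assumes k: "mollifier_kernel e k" and f: "integrable lborel f"
  shows "(mollify k f has_derivative (\<lambda>h. LINT y|lborel. frechet_derivative k (at (z - y)) h * f y)) (at z)"
proof -
  let ?k' = "\<lambda>x. frechet_derivative k (at x)"
  have lin: "linear (?k' x)" for x by (rule has_derivative_linear[OF kernel_deriv[OF k]])
  have expand: "?k' x h = (\<Sum>b\<in>Basis. (h \<bullet> b) * ?k' x b)" for x h
  proof -
    have "?k' x h = ?k' x (\<Sum>b\<in>Basis. (h \<bullet> b) *\<^sub>R b)" by (simp add: euclidean_representation)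
    also have "\<dots> = (\<Sum>b\<in>Basis. (h \<bullet> b) * ?k' x b)"
      by (simp add: linear_sum[OF lin] linear_cmul[OF lin])
    finally show ?thesis .
  qed
  have ib: "integrable lborel (\<lambda>y. ?k' (z - y) b * f y)" if b: "b \<in> Basis" for b
  proof -
    obtain M where M: "\<And>x. \<bar>?k' x b\<bar> \<le> M"
      using continuous_compact_support_bounded[OF kernel_deriv_cont[OF k b] kernel_deriv_supp[OF k]] by blast
    have "continuous_on UNIV (\<lambda>y. ?k' (z - y) b)"
      by (rule continuous_on_compose2[OF kernel_deriv_cont[OF k b], of UNIV "\<lambda>y. z - y"])
        (auto intro!: continuous_intros)
    then show ?thesis
      using integrable_bounded_continuous_mult[OF f, of "\<lambda>y. ?k' (z - y) b" M] M by simp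
  qed
  have i: "integrable lborel (\<lambda>y. ?k' (z - y) h * f y)" for h
  proof -
    have "(\<lambda>y. ?k' (z - y) h * f y) = (\<lambda>y. \<Sum>b\<in>Basis. (h \<bullet> b) * (?k' (z - y) b * f y))"
      by (subst expand[of _ h]) (simp add: sum_distrib_right mult.assoc)
    then show ?thesis by (simp add: ib)
  qed
  have "linear (\<lambda>h. LINT y|lborel. ?k' (z - y) h * f y)"
    by (rule linearI) (simp_all add: linear_add[OF lin] linear_cmul[OF lin] distrib_right i mult.assoc)
  then have bl: "bounded_linear (\<lambda>h. LINT y|lborel. ?k' (z - y) h * f y)"
    by (simp add: linear_conv_bounded_linear)
  show ?thesis
    unfolding has_derivative_at_alt
  proof (intro conjI bl allI impI)
    fix \<epsilon> :: real assume "\<epsilon> > 0"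
    define N where "N = (LINT y|lborel. \<bar>f y\<bar>)"
    have "N \<ge> 0" by (simp add: N_def)
    define e' where "e' = \<epsilon> / (real DIM('a) * (N + 1))"
    have "e' > 0" using \<open>\<epsilon> > 0\<close> \<open>N \<ge> 0\<close> by (simp add: e'_def)
    have "\<forall>b\<in>(Basis::'a set). \<exists>d>0. \<forall>x h. norm h < d \<longrightarrow> \<bar>?k' (x + h) b - ?k' x b\<bar> < e'"
      using continuous_compact_support_uniform[OF kernel_deriv_cont[OF k] kernel_deriv_supp[OF k] \<open>e' > 0\<close>] by blast
    then obtain d where d: "\<And>b. b \<in> (Basis::'a set) \<Longrightarrow> d b > 0"
      "\<And>b x h. b \<in> (Basis::'a set) \<Longrightarrow> norm h < d b \<Longrightarrow> \<bar>?k' (x + h) b - ?k' x b\<bar> < e'"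
      by metis
    define \<delta> where "\<delta> = Min (d ` Basis)"
    have \<delta>: "\<delta> > 0" "\<And>b. b \<in> Basis \<Longrightarrow> \<delta> \<le> d b" using d(1) by (auto simp: \<delta>_def)
    have rem: "\<bar>k (x + h) - k x - ?k' x h\<bar> \<le> real DIM('a) * e' * norm h" if h: "norm h < \<delta>" for x h
    proof -
      have line: "((\<lambda>s. k (x + s *\<^sub>R h)) has_real_derivative ?k' (x + s *\<^sub>R h) h) (at s)" for s
      proof -
        have "((\<lambda>s. k (x + s *\<^sub>R h)) has_derivative (\<lambda>r. ?k' (x + s *\<^sub>R h) (r *\<^sub>R h))) (at s)"
          by (rule has_derivative_compose[OF _ kernel_deriv[OF k], of "\<lambda>s. x + s *\<^sub>R h"]) (auto intro!: derivative_eq_intros)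
        then show ?thesis by (simp add: has_field_derivative_def linear_cmul[OF lin] mult_commute_abs)
      qed
      have "\<exists>s>0. s < 1 \<and> k (x + 1 *\<^sub>R h) - k (x + 0 *\<^sub>R h) = (1 - 0) * ?k' (x + s *\<^sub>R h) h"
        by (rule MVT2) (use line in auto)
      then obtain s where s: "0 < s" "s < 1" "k (x + h) - k x = ?k' (x + s *\<^sub>R h) h" by auto
      have sh: "norm (s *\<^sub>R h) < \<delta>"
      proof -
        have "s * norm h \<le> 1 * norm h" using s by (intro mult_right_mono) auto
        then show ?thesis using h s by simp
      qed
      have "\<bar>k (x + h) - k x - ?k' x h\<bar> = \<bar>\<Sum>b\<in>Basis. (h \<bullet> b) * (?k' (x + s *\<^sub>R h) b - ?k' x b)\<bar>"
        unfolding s(3) by (subst expand[of x h], subst expand[of "x + s *\<^sub>R h" h]) (simp add: sum_subtractf right_diff_distrib)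
      also have "\<dots> \<le> (\<Sum>b\<in>Basis. \<bar>(h \<bullet> b) * (?k' (x + s *\<^sub>R h) b - ?k' x b)\<bar>)" by (rule sum_abs)
      also have "\<dots> \<le> (\<Sum>b\<in>(Basis::'a set). norm h * e')"
      proof (rule sum_mono)
        fix b :: 'a assume b: "b \<in> Basis"
        have "\<bar>?k' (x + s *\<^sub>R h) b - ?k' x b\<bar> \<le> e'"
          using d(2)[OF b, of "s *\<^sub>R h" x] sh \<delta>(2)[OF b] by simp
        then show "\<bar>(h \<bullet> b) * (?k' (x + s *\<^sub>R h) b - ?k' x b)\<bar> \<le> norm h * e'"
          using Basis_le_norm[OF b, of h] by (auto simp: abs_mult intro!: mult_mono)
      qed
      finally show ?thesis by (simp add: mult_ac)
    qed
    show "\<exists>d>0. \<forall>y. norm (y - z) < d \<longrightarrow> norm (mollify k f y - mollify k f z -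
        (LINT w|lborel. ?k' (z - w) (y - z) * f w)) \<le> \<epsilon> * norm (y - z)"
    proof (intro exI[of _ \<delta>] conjI \<delta>(1) allI impI)
      fix y assume y: "norm (y - z) < \<delta>"
      have "mollify k f y - mollify k f z - (LINT w|lborel. ?k' (z - w) (y - z) * f w)
          = (LINT w|lborel. (k (y - w) - k (z - w) - ?k' (z - w) (y - z)) * f w)"
        unfolding mollify_def
        using mollify_integrable[OF k f, of y] mollify_integrable[OF k f, of z] i[of "y - z"]
        by (simp add: left_diff_distrib)
      also have "norm \<dots> \<le> (LINT w|lborel. (real DIM('a) * e' * norm (y - z)) * \<bar>f w\<bar>)"
      proof (rule Bochner_Integration.integral_norm_bound_integral)
        show "integrable lborel (\<lambda>w. (k (y - w) - k (z - w) - ?k' (z - w) (y - z)) * f w)"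
          using mollify_integrable[OF k f, of y] mollify_integrable[OF k f, of z] i[of "y - z"]
          by (simp add: left_diff_distrib)
        show "norm ((k (y - w) - k (z - w) - ?k' (z - w) (y - z)) * f w) \<le> real DIM('a) * e' * norm (y - z) * \<bar>f w\<bar>" for w
          using rem[OF y, of "z - w"] by (simp add: abs_mult mult_right_mono)
      qed (use f in auto)
      also have "\<dots> = real DIM('a) * e' * N * norm (y - z)" by (simp add: N_def)
      also have "\<dots> \<le> \<epsilon> * norm (y - z)"
      proof (rule mult_right_mono)
        have "real DIM('a) * e' * N = \<epsilon> * (N / (N + 1))" using \<open>N \<ge> 0\<close> by (simp add: e'_def)
        also have "\<dots> \<le> \<epsilon> * 1" using \<open>N \<ge> 0\<close> \<open>\<epsilon> > 0\<close> by (intro mult_left_mono) auto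
        finally show "real DIM('a) * e' * N \<le> \<epsilon>" by simp
      qed simp
      finally show "norm (mollify k f y - mollify k f z - (LINT w|lborel. ?k' (z - w) (y - z) * f w)) \<le> \<epsilon> * norm (y - z)" .
    qed
  qed
qed

section \<open>Continuity of translations in the mean\<close>

lemma integral_translate:
  fixes f :: "'a::euclidean_space \<Rightarrow> 'b::euclidean_space"
  assumes "integrable lborel f"
  shows "integrable lborel (\<lambda>x. f (x - y))" "(LINT x|lborel. f (x - y)) = (LINT x|lborel. f x)"
proof -
  have [measurable]: "f \<in> borel_measurable borel" using assms by simp
  have "integrable (distr lborel borel ((+) (- y))) f" using assms by (simp only: lborel_distr_plus)
  then show "integrable lborel (\<lambda>x. f (x - y))" by (subst (asm) integrable_distr_eq) auto
  have "(LINT x|lborel. f (- y + x)) = (LINT x|distr lborel borel ((+) (- y)). f x)"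
    by (subst integral_distr) auto
  then show "(LINT x|lborel. f (x - y)) = (LINT x|lborel. f x)" by (simp only: lborel_distr_plus) simp
qed

text \<open>Integrable functions are generated by indicators of sets of finite measure, and the claim survives sums and dominated
  limits. For a set \<open>A\<close> choose a compact \<open>K\<close> and an open \<open>U\<close> with \<open>K \<subseteq> A \<subseteq> U\<close> and \<open>U - K\<close> of small measure: a short
  translation moves no point of \<open>K\<close> out of \<open>U\<close>, so the two indicators differ only on translates of \<open>U - K\<close>.\<close>

lemma translation_continuous_L1:
  fixes f :: "'a::euclidean_space \<Rightarrow> 'b::euclidean_space"
  assumes "integrable lborel f"
  shows "\<forall>e>0. \<exists>d>0. \<forall>y. norm y < d \<longrightarrow> (LINT x|lborel. norm (f (x - y) - f x)) \<le> e"
  using assms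
proof (induction rule: integrable_induct)
  case (base A c)
  show ?case
  proof (intro allI impI)
    fix e :: real assume "e > 0"
    define \<epsilon> where "\<epsilon> = e / (4 * (norm c + 1))"
    have "\<epsilon> > 0" using \<open>e > 0\<close> by (simp add: \<epsilon>_def add_nonneg_pos)
    have AL: "A \<in> sets lebesgue" using base by simp
    obtain C where C: "closed C" "C \<subseteq> A" "A - C \<in> lmeasurable" "emeasure lebesgue (A - C) < ennreal (\<epsilon>/3)"
      using sets_lebesgue_inner_closed[OF AL, of "\<epsilon>/3"] \<open>\<epsilon> > 0\<close> by auto
    obtain U where U: "open U" "A \<subseteq> U" "U - A \<in> lmeasurable" "emeasure lebesgue (U - A) < ennreal (\<epsilon>/3)"
      using sets_lebesgue_outer_open[OF AL, of "\<epsilon>/3"] \<open>\<epsilon> > 0\<close> by auto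
    have Cb[measurable]: "C \<in> sets borel" "U \<in> sets borel" "A \<in> sets borel" using C U base by auto
    have Cfin: "emeasure lborel C < \<infinity>"
      using emeasure_mono[OF C(2), of lborel] base by (auto intro: le_less_trans)
    \<comment> \<open>Inner regularity yields a closed set only; intersecting with a large ball makes it compact.\<close>
    have "(\<lambda>n. emeasure lborel (C - cball 0 (real n))) \<longlonglongrightarrow> emeasure lborel (\<Inter>n. C - cball 0 (real n))"
    proof (rule Lim_emeasure_decseq)
      show "decseq (\<lambda>n. C - cball 0 (real n))" by (auto simp: decseq_def)
      show "emeasure lborel (C - cball 0 (real n)) \<noteq> \<infinity>" for n
        using emeasure_mono[of "C - cball 0 (real n)" C lborel] Cfin by (auto simp: top_unique)
    qed auto
    moreover have "(\<Inter>n. C - cball 0 (real n)) = {}"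
    proof -
      have "\<exists>n. x \<in> cball 0 (real n)" for x :: 'a
        using real_arch_simple[of "norm x"] by (auto simp: mem_cball_0)
      then show ?thesis by blast
    qed
    ultimately have "(\<lambda>n. emeasure lborel (C - cball 0 (real n))) \<longlonglongrightarrow> 0" by (simp only: emeasure_empty)
    then have "\<forall>\<^sub>F n in sequentially. emeasure lborel (C - cball 0 (real n)) < ennreal (\<epsilon>/3)"
      by (rule order_tendstoD(2)) (use \<open>\<epsilon> > 0\<close> in auto)
    then obtain n where n: "emeasure lborel (C - cball 0 (real n)) < ennreal (\<epsilon>/3)"
      by (auto simp: eventually_sequentially)
    define K where "K = C \<inter> cball 0 (real n)"
    have K: "compact K" "K \<subseteq> A" using C by (auto simp: K_def compact_Int_closed Int_commute closed_Int_compact)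
    have [measurable]: "K \<in> sets borel" using K(1) by (simp add: compact_imp_closed)
    have UK: "emeasure lborel (U - K) \<le> ennreal \<epsilon>"
    proof -
      have "emeasure lborel (U - K) \<le> emeasure lborel ((U - A) \<union> ((A - C) \<union> (C - cball 0 (real n))))"
        by (rule emeasure_mono) (auto simp: K_def)
      also have "\<dots> \<le> emeasure lborel (U - A) + (emeasure lborel (A - C) + emeasure lborel (C - cball 0 (real n)))"
        by (intro order_trans[OF emeasure_subadditive] add_left_mono emeasure_subadditive) auto
      also have "\<dots> \<le> ennreal (\<epsilon>/3) + (ennreal (\<epsilon>/3) + ennreal (\<epsilon>/3))"
        using C(4) U(4) n by (intro add_mono) (auto simp: order.strict_implies_order)
      also have "\<dots> = ennreal \<epsilon>" using \<open>\<epsilon> > 0\<close> by (simp flip: ennreal_plus)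
      finally show ?thesis .
    qed
    then have UKfin: "emeasure lborel (U - K) < \<infinity>" by (rule le_less_trans) simp
    have mUK: "measure lborel (U - K) \<le> \<epsilon>"
      using UK \<open>\<epsilon> > 0\<close> by (simp add: measure_def enn2real_leI)
    obtain d where d: "d > 0" "(\<Union>x\<in>K. cball x d) \<subseteq> U"
      using compact_subset_open_imp_cball_epsilon_subset[OF K(1) U(1)] K(2) U(2) by blast
    have "(LINT x|lborel. norm (indicator A (x - y) *\<^sub>R c - indicator A x *\<^sub>R c)) \<le> e" if y: "norm y < d" for y
    proof -
      let ?D = "indicator (U - K) :: 'a \<Rightarrow> real"
      have iD: "integrable lborel ?D" by (rule integrable_real_indicator) (use UKfin in auto)
      have pw: "\<bar>indicator A (x - y) - indicator A x :: real\<bar> \<le> 2 * ?D x + 2 * ?D (x - y)" for x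
      proof -
        have "x \<in> U" if "x - y \<in> K" using d(2) that y by (auto simp: dist_norm dest!: subsetD[OF _ UN_I[OF that]])
        moreover have "x - y \<in> U" if "x \<in> K" using d(2) that y by (auto simp: dist_norm dest!: subsetD[OF _ UN_I[OF that]])
        ultimately show ?thesis using K(2) U(2) by (auto simp: indicator_def)
      qed
      have iA: "integrable lborel (indicator A :: 'a \<Rightarrow> real)"
        by (rule integrable_real_indicator) (use base in auto)
      have "(LINT x|lborel. norm (indicator A (x - y) *\<^sub>R c - indicator A x *\<^sub>R c))
          \<le> (LINT x|lborel. (2 * ?D x + 2 * ?D (x - y)) * norm c)"
      proof (rule integral_mono)
        show "integrable lborel (\<lambda>x. norm (indicator A (x - y) *\<^sub>R c - indicator A x *\<^sub>R c))"
          using iA integral_translate(1)[OF iA, of y] by auto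
        show "integrable lborel (\<lambda>x. (2 * ?D x + 2 * ?D (x - y)) * norm c)"
          using iD integral_translate(1)[OF iD, of y] by auto
        show "norm (indicator A (x - y) *\<^sub>R c - indicator A x *\<^sub>R c) \<le> (2 * ?D x + 2 * ?D (x - y)) * norm c" for x
          using mult_right_mono[OF pw[of x], of "norm c"] by (simp flip: scaleR_diff_left)
      qed
      also have "\<dots> = 4 * measure lborel (U - K) * norm c"
        using iD integral_translate[OF iD, of y] by simp
      also have "\<dots> \<le> 4 * \<epsilon> * (norm c + 1)"
        using mUK \<open>\<epsilon> > 0\<close> by (intro mult_mono) auto
      also have "\<dots> = e" by (simp add: \<epsilon>_def add_nonneg_pos[THEN less_imp_neq, symmetric] field_simps add_nonneg_eq_0_iff)
      finally show ?thesis .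
    qed
    then show "\<exists>d>0. \<forall>y. norm y < d \<longrightarrow> (LINT x|lborel. norm (indicator A (x - y) *\<^sub>R c - indicator A x *\<^sub>R c)) \<le> e"
      using d(1) by blast
  qed
next
  case (add f g)
  show ?case
  proof (intro allI impI)
    fix e :: real assume "e > 0"
    obtain d1 where d1: "d1 > 0" "\<And>y. norm y < d1 \<Longrightarrow> (LINT x|lborel. norm (f (x - y) - f x)) \<le> e/2"
      using add(3)[rule_format, of "e/2"] \<open>e > 0\<close> by auto
    obtain d2 where d2: "d2 > 0" "\<And>y. norm y < d2 \<Longrightarrow> (LINT x|lborel. norm (g (x - y) - g x)) \<le> e/2"
      using add(4)[rule_format, of "e/2"] \<open>e > 0\<close> by auto
    have "(LINT x|lborel. norm (f (x - y) + g (x - y) - (f x + g x))) \<le> e" if y: "norm y < min d1 d2" for y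
    proof -
      note i = add(1,2) integral_translate(1)[OF add(1), of y] integral_translate(1)[OF add(2), of y]
      have "(LINT x|lborel. norm (f (x - y) + g (x - y) - (f x + g x)))
          \<le> (LINT x|lborel. norm (f (x - y) - f x) + norm (g (x - y) - g x))"
      proof (rule integral_mono)
        show "norm (f (x - y) + g (x - y) - (f x + g x)) \<le> norm (f (x - y) - f x) + norm (g (x - y) - g x)" for x
          by (metis add_diff_add norm_triangle_ineq)
      qed (use i in auto)
      also have "\<dots> = (LINT x|lborel. norm (f (x - y) - f x)) + (LINT x|lborel. norm (g (x - y) - g x))"
        using i by (intro Bochner_Integration.integral_add) auto
      finally show ?thesis using d1(2)[of y] d2(2)[of y] y by auto
    qed
    then show "\<exists>d>0. \<forall>y. norm y < d \<longrightarrow> (LINT x|lborel. norm (f (x - y) + g (x - y) - (f x + g x))) \<le> e"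
      using d1(1) d2(1) by (intro exI[of _ "min d1 d2"]) auto
  qed
next
  case (lim f s)
  show ?case
  proof (intro allI impI)
    fix e :: real assume "e > 0"
    have "(\<lambda>i. LINT x|lborel. norm (s i x - f x)) \<longlonglongrightarrow> (LINT x|(lborel::'a measure). 0::real)"
    proof (rule integral_dominated_convergence[where w="\<lambda>x. 3 * norm (f x)"])
      show "AE x in lborel. (\<lambda>i. norm (s i x - f x)) \<longlonglongrightarrow> 0"
        by (intro AE_I2 tendsto_norm_zero LIM_zero lim(2))
      have "norm (s i x - f x) \<le> 3 * norm (f x)" for i x
        using norm_triangle_ineq4[of "s i x" "f x"] lim(3)[of x i] by simp
      then show "AE x in lborel. norm (norm (s i x - f x)) \<le> 3 * norm (f x)" for i by simp
      show "(\<lambda>x. norm (s i x - f x)) \<in> borel_measurable lborel" for i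
        by (intro borel_measurable_integrable integrable_norm Bochner_Integration.integrable_diff lim)
    qed (use lim in auto)
    then have "\<forall>\<^sub>F i in sequentially. (LINT x|lborel. norm (s i x - f x)) < e/3"
      using order_tendstoD(2)[of _ 0 sequentially "e/3"] \<open>e > 0\<close> by simp
    then obtain i where i: "(LINT x|lborel. norm (s i x - f x)) < e/3" by (auto simp: eventually_sequentially)
    obtain d where d: "d > 0" "\<And>y. norm y < d \<Longrightarrow> (LINT x|lborel. norm (s i (x - y) - s i x)) \<le> e/3"
      using lim(5)[rule_format, of "e/3" i] \<open>e > 0\<close> by auto
    have "(LINT x|lborel. norm (f (x - y) - f x)) \<le> e" if y: "norm y < d" for y
    proof -
      have sf: "integrable lborel (\<lambda>x. norm (s i x - f x))" using lim by auto
      note j = lim(1)[of i] lim(4) integral_translate(1)[OF lim(1), of i y] integral_translate(1)[OF lim(4), of y]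
        integral_translate[OF sf, of y]
      have "(LINT x|lborel. norm (f (x - y) - f x))
          \<le> (LINT x|lborel. norm (s i (x - y) - f (x - y)) + (norm (s i (x - y) - s i x) + norm (s i x - f x)))"
      proof (rule integral_mono)
        show "norm (f (x - y) - f x) \<le> norm (s i (x - y) - f (x - y)) + (norm (s i (x - y) - s i x) + norm (s i x - f x))" for x
        proof -
          have "norm (f (x - y) - f x) = norm (- (s i (x - y) - f (x - y)) + ((s i (x - y) - s i x) + (s i x - f x)))"
            by simp
          moreover have "\<dots> \<le> norm (- (s i (x - y) - f (x - y))) + norm ((s i (x - y) - s i x) + (s i x - f x))"
            by (rule norm_triangle_ineq)
          moreover have "norm ((s i (x - y) - s i x) + (s i x - f x)) \<le> norm (s i (x - y) - s i x) + norm (s i x - f x)"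
            by (rule norm_triangle_ineq)
          ultimately show ?thesis unfolding norm_minus_cancel by linarith
        qed
      qed (use j in auto)
      also have "\<dots> = (LINT x|lborel. norm (s i x - f x)) + ((LINT x|lborel. norm (s i (x - y) - s i x)) + (LINT x|lborel. norm (s i x - f x)))"
        using j sf by simp
      finally show ?thesis using i d(2)[OF y] by simp
    qed
    then show "\<exists>d>0. \<forall>y. norm y < d \<longrightarrow> (LINT x|lborel. norm (f (x - y) - f x)) \<le> e" using d(1) by blast
  qed
qed

section \<open>Convergence of mollifications\<close>

lemma mollify_translate:
  fixes f :: "'a::euclidean_space \<Rightarrow> 'b::euclidean_space"
  assumes k: "mollifier_kernel d k" and f: "integrable lborel f"
  shows "integrable lborel (\<lambda>w. k w *\<^sub>R f (x - w))" "mollify k f x = (LINT w|lborel. k w *\<^sub>R f (x - w))"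
proof -
  have [measurable]: "f \<in> borel_measurable borel" using f by simp
  have [measurable]: "k \<in> borel_measurable borel"
    by (rule borel_measurable_continuous_onI[OF kernel_cont[OF k]])
  have d: "lborel = distr lborel borel (\<lambda>w::'a. x - w)"
    using lborel_affine[of "-1" x] by (simp add: density_1)
  have i: "integrable lborel (\<lambda>y. k (x - y) *\<^sub>R f y)" by (rule mollify_integrable[OF k f])
  have "integrable (distr lborel borel (\<lambda>w::'a. x - w)) (\<lambda>y. k (x - y) *\<^sub>R f y)"
    using i by (simp only: d[symmetric])
  then show "integrable lborel (\<lambda>w. k w *\<^sub>R f (x - w))" by (subst (asm) integrable_distr_eq) auto
  have "mollify k f x = (LINT y|distr lborel borel (\<lambda>w::'a. x - w). k (x - y) *\<^sub>R f y)"
    unfolding mollify_def by (simp only: d[symmetric])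
  also have "\<dots> = (LINT w|lborel. k w *\<^sub>R f (x - w))" by (subst integral_distr) auto
  finally show "mollify k f x = (LINT w|lborel. k w *\<^sub>R f (x - w))" .
qed

lemma mollify_measurable:
  fixes f :: "'a::euclidean_space \<Rightarrow> 'b::euclidean_space"
  assumes k: "mollifier_kernel d k" and f: "integrable lborel f"
  shows "mollify k f \<in> borel_measurable borel"
proof -
  have [measurable]: "f \<in> borel_measurable borel" using f by simp
  have [measurable]: "k \<in> borel_measurable borel"
    by (rule borel_measurable_continuous_onI[OF kernel_cont[OF k]])
  have "(\<lambda>x. LINT y|lborel. k (x - y) *\<^sub>R f y) \<in> borel_measurable lborel"
    by (rule lborel.borel_measurable_lebesgue_integral) measurable
  then show ?thesis by (simp add: mollify_def[abs_def])
qed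

text \<open>A mollification is an average of translates \<open>f (x - w)\<close> with \<open>norm w \<le> d\<close>, so by Tonelli its distance to \<open>f\<close> is at most
  the average of the distances of these translates.\<close>

lemma mollify_L1_error:
  fixes f :: "'a::euclidean_space \<Rightarrow> 'b::euclidean_space"
  assumes f: "integrable lborel f" and "e \<ge> 0"
    and d: "\<And>y. norm y \<le> d \<Longrightarrow> (LINT x|lborel. norm (f (x - y) - f x)) \<le> e"
    and k: "mollifier_kernel d k"
  shows "(\<integral>\<^sup>+x. ennreal (norm (mollify k f x - f x)) \<partial>lborel) \<le> ennreal e"
proof -
  have [measurable]: "f \<in> borel_measurable borel" using f by simp
  have [measurable]: "k \<in> borel_measurable borel"
    by (rule borel_measurable_continuous_onI[OF kernel_cont[OF k]])
  have pt: "ennreal (norm (mollify k f x - f x)) \<le> (\<integral>\<^sup>+w. ennreal (k w * norm (f (x - w) - f x)) \<partial>lborel)" for x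
  proof -
    have ik: "integrable lborel (\<lambda>w. k w *\<^sub>R f x)" using kernel_integrable[OF k] by simp
    have i: "integrable lborel (\<lambda>w. k w *\<^sub>R (f (x - w) - f x))"
      using mollify_translate(1)[OF k f, of x] ik by (simp add: scaleR_diff_right)
    have "mollify k f x - f x = (LINT w|lborel. k w *\<^sub>R (f (x - w) - f x))"
      using mollify_translate[OF k f, of x] ik kernel_integral[OF k] kernel_integrable[OF k]
      by (simp add: scaleR_diff_right)
    then have "ennreal (norm (mollify k f x - f x)) \<le> (\<integral>\<^sup>+w. ennreal (norm (k w *\<^sub>R (f (x - w) - f x))) \<partial>lborel)"
      using integral_norm_bound_ennreal[OF i] by simp
    also have "\<dots> = (\<integral>\<^sup>+w. ennreal (k w * norm (f (x - w) - f x)) \<partial>lborel)"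
      using kernel_nonneg[OF k] by simp
    finally show ?thesis .
  qed
  have inner: "(\<integral>\<^sup>+x. ennreal (k w * norm (f (x - w) - f x)) \<partial>lborel) \<le> ennreal e * ennreal (k w)" for w
  proof (cases "norm w \<le> d")
    case True
    have i: "integrable lborel (\<lambda>x. norm (f (x - w) - f x))"
      using integral_translate(1)[OF f] f by auto
    have "(\<integral>\<^sup>+x. ennreal (k w * norm (f (x - w) - f x)) \<partial>lborel)
        = ennreal (k w) * (\<integral>\<^sup>+x. ennreal (norm (f (x - w) - f x)) \<partial>lborel)"
      using kernel_nonneg[OF k] by (subst nn_integral_cmult[symmetric]) (auto simp: ennreal_mult)
    also have "\<dots> = ennreal (k w) * ennreal (LINT x|lborel. norm (f (x - w) - f x))"
      by (subst nn_integral_eq_integral[OF i]) auto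
    also have "\<dots> \<le> ennreal (k w) * ennreal e"
      by (intro mult_left_mono ennreal_leI d True) auto
    finally show ?thesis by (simp add: mult.commute)
  next
    case False
    then show ?thesis using kernel_supp[OF k, of w] by simp
  qed
  have "(\<integral>\<^sup>+x. ennreal (norm (mollify k f x - f x)) \<partial>lborel)
      \<le> (\<integral>\<^sup>+x. (\<integral>\<^sup>+w. ennreal (k w * norm (f (x - w) - f x)) \<partial>lborel) \<partial>lborel)"
    by (intro nn_integral_mono pt)
  also have "\<dots> = (\<integral>\<^sup>+w. (\<integral>\<^sup>+x. ennreal (k w * norm (f (x - w) - f x)) \<partial>lborel) \<partial>lborel)"
    by (rule lborel_pair.Fubini') measurable
  also have "\<dots> \<le> (\<integral>\<^sup>+w. ennreal e * ennreal (k w) \<partial>lborel)" by (intro nn_integral_mono inner)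
  also have "\<dots> = ennreal e * (\<integral>\<^sup>+w. ennreal (k w) \<partial>lborel)" by (rule nn_integral_cmult) measurable
  also have "(\<integral>\<^sup>+w. ennreal (k w) \<partial>lborel) = ennreal 1"
    using kernel_integral[OF k] kernel_nonneg[OF k] kernel_integrable[OF k] by (subst nn_integral_eq_integral) auto
  finally show ?thesis by simp
qed

text \<open>Choose the kernels so that the \<open>n\<close>-th error has \<open>L\<^sup>1\<close> norm at most \<open>2\<^sup>-\<^sup>n\<close>. Then the sum of all errors is integrable: its
  finiteness almost everywhere gives pointwise convergence, and added to \<open>|f|\<close> it is a common majorant. With a
  vector-valued \<open>f\<close> this treats several functions with the same kernels.\<close>

lemma mollify_dominated_sequence:
  fixes f :: "'a::euclidean_space \<Rightarrow> 'b::euclidean_space"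
  assumes f: "integrable lborel f" and "d > 0"
  obtains k W where "\<And>n::nat. mollifier_kernel d (k n)" "integrable lborel W"
    "AE x in lborel. (\<lambda>n. mollify (k n) f x) \<longlonglongrightarrow> f x"
    "AE x in lborel. \<forall>n. norm (mollify (k n) f x) \<le> W x"
proof -
  have "\<exists>k. mollifier_kernel d k \<and> (\<integral>\<^sup>+x. ennreal (norm (mollify k f x - f x)) \<partial>lborel) \<le> ennreal ((1/2)^n)" for n
  proof -
    obtain d' where d': "d' > 0" "\<And>y. norm y < d' \<Longrightarrow> (LINT x|lborel. norm (f (x - y) - f x)) \<le> (1/2)^n"
      using translation_continuous_L1[OF f] by (meson zero_less_divide_1_iff zero_less_numeral zero_less_power)
    define \<delta> where "\<delta> = min d (d'/2)"
    have \<delta>: "\<delta> > 0" "\<delta> < d'" "\<delta> \<le> d" using \<open>d > 0\<close> d'(1) by (auto simp: \<delta>_def)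
    obtain k :: "'a \<Rightarrow> real" where k: "mollifier_kernel \<delta> k" using mollifier_kernel_exists[OF \<delta>(1)] by blast
    have "(\<integral>\<^sup>+x. ennreal (norm (mollify k f x - f x)) \<partial>lborel) \<le> ennreal ((1/2)^n)"
      by (rule mollify_L1_error[OF f _ _ k]) (use d'(2) \<delta>(2) in auto)
    moreover have "mollifier_kernel d k" using k \<delta>(3) by (auto simp: mollifier_kernel_def)
    ultimately show ?thesis by blast
  qed
  then obtain k where k: "\<And>n. mollifier_kernel d (k n)"
    and err: "\<And>n. (\<integral>\<^sup>+x. ennreal (norm (mollify (k n) f x - f x)) \<partial>lborel) \<le> ennreal ((1/2)^n)" by metis
  have [measurable]: "f \<in> borel_measurable borel" using f by simp
  have [measurable]: "mollify (k n) f \<in> borel_measurable borel" for n by (rule mollify_measurable[OF k f])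
  define S where "S = (\<lambda>x. \<Sum>n. ennreal (norm (mollify (k n) f x - f x)))"
  have [measurable]: "S \<in> borel_measurable lborel" unfolding S_def by measurable
  have "(\<integral>\<^sup>+x. S x \<partial>lborel) = (\<Sum>n. \<integral>\<^sup>+x. ennreal (norm (mollify (k n) f x - f x)) \<partial>lborel)"
    unfolding S_def by (rule nn_integral_suminf) measurable
  also have "\<dots> \<le> (\<Sum>n. ennreal ((1/2)^n))" by (intro suminf_le err summableI)
  also have "\<dots> = ennreal (\<Sum>n. (1/2)^n)"
    by (intro suminf_ennreal2 summable_geometric) auto
  finally have S2: "(\<integral>\<^sup>+x. S x \<partial>lborel) < \<infinity>" by (rule le_less_trans) simp
  have fin: "AE x in lborel. S x \<noteq> \<infinity>" by (rule nn_integral_PInf_AE) (use S2 in auto)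
  define W where "W = (\<lambda>x. norm (f x) + enn2real (S x))"
  have "integrable lborel (\<lambda>x. enn2real (S x))"
  proof (rule integrableI_nonneg)
    have "(\<integral>\<^sup>+x. ennreal (enn2real (S x)) \<partial>lborel) = (\<integral>\<^sup>+x. S x \<partial>lborel)"
      by (rule nn_integral_cong_AE) (use fin in \<open>auto simp: less_top\<close>)
    then show "(\<integral>\<^sup>+x. ennreal (enn2real (S x)) \<partial>lborel) < \<infinity>" using S2 by simp
  qed auto
  then have W: "integrable lborel W" unfolding W_def using f by simp
  have "AE x in lborel. (\<lambda>n. mollify (k n) f x) \<longlonglongrightarrow> f x"
    using fin
  proof eventually_elim
    fix x assume "S x \<noteq> \<infinity>"
    then have "summable (\<lambda>n. norm (mollify (k n) f x - f x))"
      unfolding S_def by (intro summable_suminf_not_top) auto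
    then have "(\<lambda>n. norm (mollify (k n) f x - f x)) \<longlonglongrightarrow> 0" by (rule summable_LIMSEQ_zero)
    then show "(\<lambda>n. mollify (k n) f x) \<longlonglongrightarrow> f x" 
      by (rule LIM_zero_cancel[OF tendsto_norm_zero_cancel])
  qed
  moreover have "AE x in lborel. \<forall>n. norm (mollify (k n) f x) \<le> W x"
    using fin
  proof eventually_elim
    fix x assume Sx: "S x \<noteq> \<infinity>"
    show "\<forall>n. norm (mollify (k n) f x) \<le> W x"
    proof
      fix n
      have "(\<Sum>i\<in>{n}. ennreal (norm (mollify (k i) f x - f x))) \<le> S x"
        unfolding S_def by (rule sum_le_suminf) auto
      then have "norm (mollify (k n) f x - f x) \<le> enn2real (S x)"
        using Sx enn2real_mono[of "ennreal (norm (mollify (k n) f x - f x))" "S x"] by (simp add: less_top)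
      then show "norm (mollify (k n) f x) \<le> W x"
        using norm_triangle_ineq2[of "mollify (k n) f x" "f x"] by (simp add: W_def)
    qed
  qed
  ultimately show ?thesis using that k W by blast
qed

section \<open>Averages of products and integration by parts\<close>

lemma mollify_bounded_linear:
  fixes f :: "'a::euclidean_space \<Rightarrow> 'b::euclidean_space" and T :: "'b \<Rightarrow> 'c::euclidean_space"
  assumes "bounded_linear T" "mollifier_kernel d k" "integrable lborel f"
  shows "mollify k (\<lambda>y. T (f y)) z = T (mollify k f z)"
  unfolding mollify_def
  using integral_bounded_linear[OF assms(1) mollify_integrable[OF assms(2,3), of z]]
  by (simp add: linear_simps(5)[OF assms(1)])

lemma kernel_shift:
  fixes k :: "'a::euclidean_space \<Rightarrow> real"
  assumes k: "mollifier_kernel d k"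
  shows "integrable lborel (\<lambda>y. k (z - y))" "(LINT y|lborel. k (z - y)) = 1"
proof -
  have [measurable]: "k \<in> borel_measurable borel"
    by (rule borel_measurable_continuous_onI[OF kernel_cont[OF k]])
  have e: "lborel = distr lborel borel (\<lambda>w::'a. z - w)"
    using lborel_affine[of "-1" z] by (simp add: density_1)
  have "integrable (distr lborel borel (\<lambda>w::'a. z - w)) k"
    using kernel_integrable[OF k] by (simp only: e[symmetric])
  then show "integrable lborel (\<lambda>y. k (z - y))" by (subst (asm) integrable_distr_eq) auto
  have "(LINT y|lborel. k (z - y)) = (LINT w|distr lborel borel (\<lambda>w::'a. z - w). k w)"
    by (subst integral_distr) auto
  then show "(LINT y|lborel. k (z - y)) = 1" using kernel_integral[OF k] by (simp only: e[symmetric])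
qed

lemma norm_mollify_le:
  fixes f :: "'a::euclidean_space \<Rightarrow> 'b::euclidean_space"
  assumes k: "mollifier_kernel d k" and "integrable lborel f"
  shows "norm (mollify k f z) \<le> mollify k (\<lambda>y. norm (f y)) z"
  unfolding mollify_def
  using integral_norm_bound[of lborel "\<lambda>y. k (z - y) *\<^sub>R f y"] kernel_nonneg[OF k] by simp

text \<open>The hypothesis compares \<open>H\<close> and \<open>D\<close> at independent points; averaging it first in \<open>y\<close> and then in \<open>y'\<close> bounds the product of
  the two averages. In this way a product of functions in dual Lebesgue spaces is dominated by the mollification of
  a single integrable function.\<close>

lemma mollify_product_bound:
  fixes H :: "'a::euclidean_space \<Rightarrow> 'b::euclidean_space" and D :: "'a \<Rightarrow> 'c::euclidean_space" and B :: "'a \<Rightarrow> real"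
  assumes k: "mollifier_kernel d k" and i: "integrable lborel H" "integrable lborel D" "integrable lborel B"
    and bound: "\<And>y y'. norm (H y) * norm (D y') \<le> B y + B y'"
  shows "norm (mollify k H z) * norm (mollify k D z) \<le> 2 * mollify k B z"
proof -
  note ks = kernel_shift[OF k, of z] and nn = kernel_nonneg[OF k]
  have ii: "integrable lborel (\<lambda>y. k (z - y) * norm (H y))" "integrable lborel (\<lambda>y. k (z - y) * norm (D y))"
    "integrable lborel (\<lambda>y. k (z - y) * B y)"
    using mollify_integrable[OF k integrable_norm[OF i(1)], of z] mollify_integrable[OF k integrable_norm[OF i(2)], of z]
      mollify_integrable[OF k i(3), of z] by simp_all
  have 1: "norm (mollify k H z) * norm (D y') \<le> mollify k B z + B y'" for y'
  proof -
    have "norm (mollify k H z) * norm (D y') \<le> mollify k (\<lambda>y. norm (H y)) z * norm (D y')"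
      by (intro mult_right_mono norm_mollify_le[OF k i(1)]) simp
    also have "\<dots> = (LINT y|lborel. k (z - y) * norm (H y) * norm (D y'))"
      by (simp add: mollify_def)
    also have "\<dots> \<le> (LINT y|lborel. k (z - y) * B y + k (z - y) * B y')"
    proof (rule integral_mono)
      show "k (z - y) * norm (H y) * norm (D y') \<le> k (z - y) * B y + k (z - y) * B y'" for y
        using mult_left_mono[OF bound[of y y'] nn[of "z - y"]] by (simp add: algebra_simps)
    qed (use ii ks in auto)
    also have "\<dots> = mollify k B z + B y'" using ii ks by (simp add: mollify_def)
    finally show ?thesis .
  qed
  have "norm (mollify k H z) * norm (mollify k D z) \<le> norm (mollify k H z) * mollify k (\<lambda>y. norm (D y)) z"
    by (intro mult_left_mono norm_mollify_le[OF k i(2)]) simp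
  also have "\<dots> = (LINT y|lborel. norm (mollify k H z) * (k (z - y) * norm (D y)))"
    by (simp add: mollify_def)
  also have "\<dots> \<le> (LINT y|lborel. k (z - y) * mollify k B z + k (z - y) * B y)"
  proof (rule integral_mono)
    show "norm (mollify k H z) * (k (z - y) * norm (D y)) \<le> k (z - y) * mollify k B z + k (z - y) * B y" for y
      using mult_left_mono[OF 1[of y] nn[of "z - y"]] by (simp add: algebra_simps)
  qed (use ii ks in auto)
  also have "\<dots> = 2 * mollify k B z" using ii ks by (simp add: mollify_def)
  finally show ?thesis .
qed

lemma mollify_range:
  fixes u :: "'a::euclidean_space \<Rightarrow> real"
  assumes k: "mollifier_kernel d k" and i: "integrable lborel u"
    and r: "AE y in lborel. y \<in> cball z d \<longrightarrow> m \<le> u y \<and> u y \<le> M"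
  shows "m \<le> mollify k u z" "mollify k u z \<le> M"
proof -
  note ks = kernel_shift[OF k, of z] and nn = kernel_nonneg[OF k]
  have ii: "integrable lborel (\<lambda>y. k (z - y) * u y)" using mollify_integrable[OF k i, of z] by simp
  have z0: "k (z - y) = 0" if "y \<notin> cball z d" for y
    using that by (intro kernel_supp[OF k]) (simp add: dist_norm)
  have "(LINT y|lborel. k (z - y) * m) \<le> (LINT y|lborel. k (z - y) * u y)"
  proof (rule integral_mono_AE)
    show "AE y in lborel. k (z - y) * m \<le> k (z - y) * u y"
      using r by eventually_elim (use z0 nn in \<open>auto intro: mult_left_mono\<close>)
  qed (use ii ks in auto)
  then show "m \<le> mollify k u z" using ks by (simp add: mollify_def)
  have "(LINT y|lborel. k (z - y) * u y) \<le> (LINT y|lborel. k (z - y) * M)"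
  proof (rule integral_mono_AE)
    show "AE y in lborel. k (z - y) * u y \<le> k (z - y) * M"
      using r by eventually_elim (use z0 nn in \<open>auto intro: mult_left_mono\<close>)
  qed (use ii ks in auto)
  then show "mollify k u z \<le> M" using ks by (simp add: mollify_def)
qed

definition mollify_deriv :: "('a::euclidean_space \<Rightarrow> real) \<Rightarrow> ('a \<Rightarrow> real) \<Rightarrow> 'a \<Rightarrow> 'a \<Rightarrow> real" where
  "mollify_deriv k f z h = (LINT y|lborel. frechet_derivative k (at (z - y)) h * f y)"

lemma mollify_deriv: "mollifier_kernel d k \<Longrightarrow> integrable lborel f \<Longrightarrow>
    (mollify k f has_derivative mollify_deriv k f z) (at z)"
  using mollify_has_derivative by (simp add: mollify_deriv_def[abs_def])

lemma integrable_mollify_deriv: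
  fixes f :: "'a::euclidean_space \<Rightarrow> real"
  assumes k: "mollifier_kernel d k" and f: "integrable lborel f" and b: "b \<in> Basis"
  shows "integrable lborel (\<lambda>y. frechet_derivative k (at (z - y)) b * f y)"
    and "\<exists>C. \<forall>z. \<bar>mollify_deriv k f z b\<bar> \<le> C"
proof -
  obtain M where M: "\<And>x. \<bar>frechet_derivative k (at x) b\<bar> \<le> M"
    using continuous_compact_support_bounded[OF kernel_deriv_cont[OF k b] kernel_deriv_supp[OF k]] by blast
  show i: "integrable lborel (\<lambda>y. frechet_derivative k (at (z - y)) b * f y)" for z
  proof -
    have "continuous_on UNIV (\<lambda>y. frechet_derivative k (at (z - y)) b)"
      by (rule continuous_on_compose2[OF kernel_deriv_cont[OF k b], of UNIV "\<lambda>y. z - y"])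
        (auto intro!: continuous_intros)
    then show ?thesis
      using integrable_bounded_continuous_mult[OF f, of "\<lambda>y. frechet_derivative k (at (z - y)) b" M] M by simp
  qed
  have "\<bar>mollify_deriv k f z b\<bar> \<le> (LINT y|lborel. M * \<bar>f y\<bar>)" for z
    unfolding mollify_deriv_def
    by (rule integral_abs_bound_integral) (use i f M in \<open>auto simp: abs_mult intro!: mult_right_mono\<close>)
  then show "\<exists>C. \<forall>z. \<bar>mollify_deriv k f z b\<bar> \<le> C" by blast
qed

lemma mollify_bounded:
  fixes f :: "'a::euclidean_space \<Rightarrow> real"
  assumes k: "mollifier_kernel d k" and f: "integrable lborel f"
  shows "\<exists>C. \<forall>z. \<bar>mollify k f z\<bar> \<le> C"
proof -
  obtain M where M: "\<And>x. \<bar>k x\<bar> \<le> M"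
    using continuous_compact_support_bounded[OF kernel_cont[OF k] kernel_supp[OF k]] by blast
  have "\<bar>mollify k f z\<bar> \<le> (LINT y|lborel. M * \<bar>f y\<bar>)" for z
    unfolding mollify_def real_scaleR_def
    by (rule integral_abs_bound_integral)
       (use mollify_integrable[OF k f, of z] f M in \<open>auto simp: abs_mult intro!: mult_right_mono\<close>)
  then show ?thesis by blast
qed

text \<open>Functions of class \<open>C\<^sup>1\<close> with compact support, together with their derivative. They multiply mollified, hence classical,
  equations, so first derivatives are all that is used, and powers \<open>\<phi>\<^sup>p\<close> with \<open>1 < p < 2\<close> are admitted.\<close>

locale cutoff =
  fixes S :: "'a::euclidean_space set" and \<psi> :: "'a \<Rightarrow> real" and \<psi>' :: "'a \<Rightarrow> 'a \<Rightarrow> real"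
  assumes compact: "compact S"
    and deriv: "\<And>z. (\<psi> has_derivative \<psi>' z) (at z)"
    and deriv_cont: "\<And>b. b \<in> Basis \<Longrightarrow> continuous_on UNIV (\<lambda>z. \<psi>' z b)"
    and supp: "\<And>z. z \<notin> S \<Longrightarrow> \<psi> z = 0"
begin

lemma deriv_supp: "\<psi>' z h = 0" if z: "z \<notin> S"
proof -
  have "open (- S)" using compact by (simp add: compact_imp_closed open_Compl)
  moreover have "((\<lambda>x. 0) has_derivative (\<lambda>h. 0)) (at z)" by simp
  ultimately have "(\<psi> has_derivative (\<lambda>h. 0)) (at z)"
    using z supp by (metis (mono_tags, lifting) Compl_iff has_derivative_transform_within_open)
  then have "\<psi>' z = (\<lambda>h. 0)" using deriv has_derivative_unique by blast
  then show ?thesis by simp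
qed

lemma cont: "continuous_on UNIV \<psi>"
  by (intro continuous_at_imp_continuous_on ballI has_derivative_continuous[OF deriv])

lemma radius: obtains r where "\<And>z. norm z > r \<Longrightarrow> z \<notin> S"
proof -
  obtain r where "\<And>x. x \<in> S \<Longrightarrow> norm x \<le> r" using compact_imp_bounded[OF compact] unfolding bounded_iff by blast
  then have "\<And>z. norm z > r \<Longrightarrow> z \<notin> S" by force
  then show ?thesis by (rule that)
qed

lemma bounded: obtains C where "\<And>z. \<bar>\<psi> z\<bar> \<le> C"
proof -
  obtain r where r: "\<And>z. norm z > r \<Longrightarrow> z \<notin> S" using radius by blast
  show ?thesis by (rule continuous_compact_support_bounded[OF cont, of r]) (use r supp that in blast)+
qed

lemma deriv_bounded: assumes "b \<in> Basis" obtains C where "\<And>z. \<bar>\<psi>' z b\<bar> \<le> C"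
proof -
  obtain r where r: "\<And>z. norm z > r \<Longrightarrow> z \<notin> S" using radius by blast
  show ?thesis by (rule continuous_compact_support_bounded[OF deriv_cont[OF assms], of r]) (use r deriv_supp that in blast)+
qed

text \<open>Here \<open>\<theta>\<close> is differentiable on \<open>S\<close> only, because it will be a function of a mollified solution that may leave the domain
  of the nonlinearity elsewhere; off \<open>S\<close> the product vanishes near each point.\<close>

lemma integration_by_parts:
  assumes \<theta>: "\<And>z. z \<in> S \<Longrightarrow> (\<theta> has_derivative \<theta>' z) (at z)" and b: "b \<in> Basis"
    and bd: "\<And>z. z \<in> S \<Longrightarrow> \<bar>\<theta> z\<bar> \<le> C" "\<And>z. z \<in> S \<Longrightarrow> \<bar>\<theta>' z b\<bar> \<le> C'"
  shows "integrable lborel (\<lambda>z. \<psi>' z b * \<theta> z + \<psi> z * \<theta>' z b)"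
    and "(LINT z|lborel. \<psi>' z b * \<theta> z + \<psi> z * \<theta>' z b) = 0"
proof -
  obtain r where r: "\<And>z. norm z > r \<Longrightarrow> z \<notin> S" using radius by blast
  obtain C1 where C1: "\<And>z. \<bar>\<psi> z\<bar> \<le> C1" using bounded by blast
  obtain C2 where C2: "\<And>z. \<bar>\<psi>' z b\<bar> \<le> C2" using deriv_bounded[OF b] by blast
  have der: "((\<lambda>z. \<psi> z * \<theta> z) has_derivative (\<lambda>h. \<psi>' z h * \<theta> z + \<psi> z * \<theta>' z h)) (at z)" for z
  proof (cases "z \<in> S")
    case True
    from has_derivative_mult[OF deriv[of z] \<theta>[OF True]] show ?thesis by (simp add: add.commute)
  next
    case False
    have "open (- S)" using compact by (simp add: compact_imp_closed open_Compl)
    moreover have "((\<lambda>x. 0) has_derivative (\<lambda>h. 0)) (at z)" by simp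
    ultimately have "((\<lambda>z. \<psi> z * \<theta> z) has_derivative (\<lambda>h. 0)) (at z)"
      using has_derivative_transform_within_open[of "\<lambda>x. 0" "\<lambda>h. 0" z UNIV "- S" "\<lambda>z. \<psi> z * \<theta> z"] False supp
      by auto
    then show ?thesis using False by (simp add: deriv_supp supp)
  qed
  have "\<bar>\<psi>' z b * \<theta> z + \<psi> z * \<theta>' z b\<bar> \<le> max 0 (C2 * C + C1 * C')" for z
  proof (cases "z \<in> S")
    case True
    have "\<bar>\<psi>' z b * \<theta> z + \<psi> z * \<theta>' z b\<bar> \<le> \<bar>\<psi>' z b\<bar> * \<bar>\<theta> z\<bar> + \<bar>\<psi> z\<bar> * \<bar>\<theta>' z b\<bar>"
      by (simp add: abs_mult[symmetric] abs_triangle_ineq)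
    also have "\<dots> \<le> C2 * C + C1 * C'"
      using C1[of z] C2[of z] bd[OF True] by (intro add_mono mult_mono) auto
    finally show ?thesis by simp
  qed (simp add: deriv_supp supp)
  from integral_directional_derivative_eq_0[OF der _ this, of r] r supp
  show "integrable lborel (\<lambda>z. \<psi>' z b * \<theta> z + \<psi> z * \<theta>' z b)"
    and "(LINT z|lborel. \<psi>' z b * \<theta> z + \<psi> z * \<theta>' z b) = 0" by auto
qed

end

section \<open>The renormalized identity\<close>

lemma integrable_Pair:
  fixes f :: "'a \<Rightarrow> 'b::{banach, second_countable_topology}" and g :: "'a \<Rightarrow> 'c::{banach, second_countable_topology}"
  assumes "integrable M f" "integrable M g"
  shows "integrable M (\<lambda>x. (f x, g x))"
proof -
  have "integrable M (\<lambda>x. (f x, 0) + (0, g x))"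
    by (intro Bochner_Integration.integrable_add
        integrable_bounded_linear[OF _ assms(1), of "\<lambda>x. (x, 0)"]
        integrable_bounded_linear[OF _ assms(2), of "\<lambda>x. (0, x)"] bounded_linear_intros)
  then show ?thesis by simp
qed

lemma continuous_on_pos_bounded:
  fixes f :: "real \<Rightarrow> real"
  assumes "continuous_on {0<..} f" "0 < m"
  obtains C where "\<And>x. m \<le> x \<Longrightarrow> x \<le> M \<Longrightarrow> \<bar>f x\<bar> \<le> C"
proof -
  have "bounded (f ` {m..M})"
    by (intro compact_imp_bounded compact_continuous_image continuous_on_subset[OF assms(1)]) (use assms(2) in auto)
  then show ?thesis using that unfolding bounded_iff by (metis atLeastAtMost_iff imageI real_norm_def)
qed

text \<open>In divergence form the hypotheses say \<open>u\<^sub>t = div H + g\<close> with \<open>D\<close> the spatial gradient of \<open>u\<close>, both tested only with smooth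
  functions in small balls around points of \<open>S\<close>. The conclusion is the equation tested with the inadmissible function
  \<open>b(u) \<psi>\<close>, where \<open>F' = b\<close>. Testing with translated kernels shows that the mollified functions satisfy the equation
  pointwise on \<open>S\<close>; there the product and chain rules are classical and integration by parts gives the identity. In
  the limit \<open>u\<^sub>\<epsilon>\<close> stays in \<open>[m, M]\<close>, the linear terms are dominated, and \<open>H\<^sub>\<epsilon> \<bullet> D\<^sub>\<epsilon>\<close> is dominated through \<open>B\<close>.\<close>

theorem renormalized_identity:
  fixes u g B :: "'a::euclidean_space \<times> real \<Rightarrow> real" and H D :: "'a \<times> real \<Rightarrow> 'a"
    and \<psi> :: "'a \<times> real \<Rightarrow> real" and \<psi>' :: "'a \<times> real \<Rightarrow> 'a \<times> real \<Rightarrow> real"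
    and F b b' :: "real \<Rightarrow> real"
  assumes cut: "cutoff S \<psi> \<psi>'" and d: "d > 0"
    and int: "integrable lborel u" "integrable lborel g" "integrable lborel H" "integrable lborel D" "integrable lborel B"
    and range: "AE y in lborel. y \<in> (\<Union>z\<in>S. cball z d) \<longrightarrow> m \<le> u y \<and> u y \<le> M" and m: "m > 0"
    and dom: "\<And>y y'. norm (H y) * norm (D y') \<le> B y + B y'"
    and grad: "\<And>\<phi> z e. (\<And>n. C_k n \<phi>) \<Longrightarrow> z \<in> S \<Longrightarrow> (\<And>y. y \<notin> cball z d \<Longrightarrow> \<phi> y = 0) \<Longrightarrow> e \<in> Basis \<Longrightarrow>
      (LINT y|lborel. u y * frechet_derivative \<phi> (at y) (e, 0)) = - (LINT y|lborel. \<phi> y * (D y \<bullet> e))"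
    and evol: "\<And>\<phi> z. (\<And>n. C_k n \<phi>) \<Longrightarrow> z \<in> S \<Longrightarrow> (\<And>y. y \<notin> cball z d \<Longrightarrow> \<phi> y = 0) \<Longrightarrow>
      (LINT y|lborel. (\<Sum>e\<in>Basis. (H y \<bullet> e) * frechet_derivative \<phi> (at y) (e, 0)) - u y * frechet_derivative \<phi> (at y) (0, 1))
        = (LINT y|lborel. g y * \<phi> y)"
    and F: "\<And>x. x > 0 \<Longrightarrow> (F has_real_derivative b x) (at x)"
    and b: "\<And>x. x > 0 \<Longrightarrow> (b has_real_derivative b' x) (at x)"
    and b': "continuous_on {0<..} b'"
    and meas: "F \<in> borel_measurable borel" "b \<in> borel_measurable borel" "b' \<in> borel_measurable borel"
  defines "R \<equiv> \<lambda>z. g z * b (u z) * \<psi> z - b (u z) * (\<Sum>e\<in>Basis. (H z \<bullet> e) * \<psi>' z (e, 0))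
      - \<psi> z * b' (u z) * (H z \<bullet> D z) + F (u z) * \<psi>' z (0, 1)"
  shows "integrable lborel R" "(LINT z|lborel. R z) = 0"
proof -
  interpret cutoff S \<psi> \<psi>' by (rule cut)
  let ?B = "Basis :: 'a set"
  have basis: "(e, 0) \<in> Basis" "(0, 1) \<in> (Basis :: ('a \<times> real) set)" if "e \<in> ?B" for e
    using that by (auto simp: Basis_prod_def)
  have basis1: "(0, 1) \<in> (Basis :: ('a \<times> real) set)" by (auto simp: Basis_prod_def)
  have contb: "continuous_on {0<..} b" "continuous_on {0<..} F"
    using F b by (auto intro!: continuous_at_imp_continuous_on DERIV_isCont)
  have Hi: "integrable lborel (\<lambda>y. H y \<bullet> e)" and Di: "integrable lborel (\<lambda>y. D y \<bullet> e)" for e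
    using int by auto
  obtain Cb where Cb: "\<And>x. m \<le> x \<Longrightarrow> x \<le> M \<Longrightarrow> \<bar>b x\<bar> \<le> Cb" using continuous_on_pos_bounded[OF contb(1) m] by blast
  obtain Cb' where Cb': "\<And>x. m \<le> x \<Longrightarrow> x \<le> M \<Longrightarrow> \<bar>b' x\<bar> \<le> Cb'" using continuous_on_pos_bounded[OF b' m] by blast
  obtain CF where CF: "\<And>x. m \<le> x \<Longrightarrow> x \<le> M \<Longrightarrow> \<bar>F x\<bar> \<le> CF" using continuous_on_pos_bounded[OF contb(2) m] by blast
  define Rk where "Rk = (\<lambda>k z. mollify k g z * b (mollify k u z) * \<psi> z
      - b (mollify k u z) * (\<Sum>e\<in>Basis. (mollify k H z \<bullet> e) * \<psi>' z (e, 0))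
      - \<psi> z * b' (mollify k u z) * (mollify k H z \<bullet> mollify k D z) + F (mollify k u z) * \<psi>' z (0, 1))"
  \<comment> \<open>For a fixed kernel the mollified functions are classical on \<open>S\<close>, and the identity is an integration by parts.\<close>
  have Rk: "integrable lborel (Rk k) \<and> (LINT z|lborel. Rk k z) = 0" if k: "mollifier_kernel d k" for k :: "'a \<times> real \<Rightarrow> real"
  proof -
    define un where "un = mollify k u"
    define un' where "un' = mollify_deriv k u"
    define Hn where "Hn = (\<lambda>e. mollify k (\<lambda>y. H y \<bullet> e))"
    define Hn' where "Hn' = (\<lambda>e. mollify_deriv k (\<lambda>y. H y \<bullet> e))"
    have Hn: "mollify k H z \<bullet> e = Hn e z" and Dn: "mollify k D z \<bullet> e = mollify k (\<lambda>y. D y \<bullet> e) z" for e z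
      unfolding Hn_def
      using mollify_bounded_linear[OF bounded_linear_inner_left k int(3)] mollify_bounded_linear[OF bounded_linear_inner_left k int(4)]
      by simp_all
    have du: "(un has_derivative un' z) (at z)" for z
      unfolding un_def un'_def by (rule mollify_deriv[OF k int(1)])
    have dH: "(Hn e has_derivative Hn' e z) (at z)" for e z
      unfolding Hn_def Hn'_def by (rule mollify_deriv[OF k Hi])
    have rng: "m \<le> un z" "un z \<le> M" if "z \<in> S" for z
    proof -
      have "AE y in lborel. y \<in> cball z d \<longrightarrow> m \<le> u y \<and> u y \<le> M"
        using range by eventually_elim (use that in auto)
      from mollify_range[OF k int(1) this] show "m \<le> un z" "un z \<le> M" by (simp_all add: un_def)
    qed
    have pos: "un z > 0" if "z \<in> S" for z using rng[OF that] m by simp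
    have test: "(\<And>n. C_k n (\<lambda>y. k (z - y)))" "(\<And>y. y \<notin> cball z d \<Longrightarrow> k (z - y) = 0)"
      "frechet_derivative (\<lambda>y. k (z - y)) (at y) h = - frechet_derivative k (at (z - y)) h" for z y h
    proof -
      have "C_k n k" for n using k by (simp add: mollifier_kernel_def)
      from C_k_affine[OF this, of _ z "-1"] show "C_k n (\<lambda>y. k (z - y))" for n by simp
      show "y \<notin> cball z d \<Longrightarrow> k (z - y) = 0" for y by (intro kernel_supp[OF k]) (simp add: dist_norm)
      have "((\<lambda>y. k (z - y)) has_derivative (\<lambda>h. frechet_derivative k (at (z - y)) (- h))) (at y)"
        by (rule has_derivative_compose[OF _ kernel_deriv[OF k], of "\<lambda>y. z - y"]) (auto intro!: derivative_eq_intros)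
      then have "frechet_derivative (\<lambda>y. k (z - y)) (at y) = (\<lambda>h. frechet_derivative k (at (z - y)) (- h))"
        using frechet_derivative_at by metis
      then show "frechet_derivative (\<lambda>y. k (z - y)) (at y) h = - frechet_derivative k (at (z - y)) h"
        using has_derivative_linear[OF kernel_deriv[OF k]] by (simp add: linear_neg)
    qed
    have Dun: "un' z (e, 0) = mollify k D z \<bullet> e" if z: "z \<in> S" and e: "e \<in> ?B" for z e
      using grad[OF test(1) z test(2) e] unfolding test(3) un'_def Dn
      by (simp add: mollify_deriv_def mollify_def mult.commute)
    have eqn: "(\<Sum>e\<in>?B. Hn' e z (e, 0)) - un' z (0, 1) = - mollify k g z" if z: "z \<in> S" for z
    proof -
      have i1: "integrable lborel (\<lambda>y. (H y \<bullet> e) * frechet_derivative k (at (z - y)) (e, 0))" if "e \<in> ?B" for e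
        using integrable_mollify_deriv(1)[OF k Hi basis(1)[OF that], of z e] by (simp add: mult.commute)
      have i2: "integrable lborel (\<lambda>y. u y * frechet_derivative k (at (z - y)) (0, 1))"
        using integrable_mollify_deriv(1)[OF k int(1) basis1, of z] by (simp add: mult.commute)
      have "(LINT y|lborel. (\<Sum>e\<in>?B. (H y \<bullet> e) * - frechet_derivative k (at (z - y)) (e, 0)) - u y * - frechet_derivative k (at (z - y)) (0, 1))
          = (LINT y|lborel. g y * k (z - y))"
        using evol[OF test(1) z test(2)] unfolding test(3) .
      moreover have "(LINT y|lborel. (\<Sum>e\<in>?B. (H y \<bullet> e) * - frechet_derivative k (at (z - y)) (e, 0)) - u y * - frechet_derivative k (at (z - y)) (0, 1))
         = - (\<Sum>e\<in>?B. LINT y|lborel. (H y \<bullet> e) * frechet_derivative k (at (z - y)) (e, 0)) + (LINT y|lborel. u y * frechet_derivative k (at (z - y)) (0, 1))"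
        using i1 i2 by (simp add: sum_negf Bochner_Integration.integral_sum)
      moreover have "(LINT y|lborel. (H y \<bullet> e) * frechet_derivative k (at (z - y)) (e, 0)) = Hn' e z (e, 0)" for e
        by (simp add: Hn'_def mollify_deriv_def mult.commute)
      moreover have "(LINT y|lborel. u y * frechet_derivative k (at (z - y)) (0, 1)) = un' z (0, 1)"
        by (simp add: un'_def mollify_deriv_def mult.commute)
      moreover have "(LINT y|lborel. g y * k (z - y)) = mollify k g z" by (simp add: mollify_def mult.commute)
      ultimately show ?thesis by simp
    qed
    have dF: "((\<lambda>z. F (un z)) has_derivative (\<lambda>h. b (un z) * un' z h)) (at z)" if "z \<in> S" for z
      using has_derivative_compose[OF du[of z] F[OF pos[OF that], unfolded has_field_derivative_def]] .
    have dbH: "((\<lambda>z. b (un z) * Hn e z) has_derivative (\<lambda>h. b' (un z) * un' z h * Hn e z + b (un z) * Hn' e z h)) (at z)"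
      if "z \<in> S" for z e
      using has_derivative_mult[OF has_derivative_compose[OF du[of z] b[OF pos[OF that], unfolded has_field_derivative_def]] dH[of e z]]
      by (simp add: add.commute)
    obtain Cu where Cu: "\<And>z. \<bar>un' z (0, 1)\<bar> \<le> Cu"
      using integrable_mollify_deriv(2)[OF k int(1) basis1] unfolding un'_def by blast
    have I0: "integrable lborel (\<lambda>z. \<psi>' z (0, 1) * F (un z) + \<psi> z * (b (un z) * un' z (0, 1)))"
      "(LINT z|lborel. \<psi>' z (0, 1) * F (un z) + \<psi> z * (b (un z) * un' z (0, 1))) = 0"
    proof -
      have bd: "\<bar>b (un z) * un' z (0, 1)\<bar> \<le> Cb * Cu" if "z \<in> S" for z
        using Cb[OF rng[OF that]] Cu[of z] unfolding abs_mult by (intro mult_mono) auto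
      show "integrable lborel (\<lambda>z. \<psi>' z (0, 1) * F (un z) + \<psi> z * (b (un z) * un' z (0, 1)))"
        "(LINT z|lborel. \<psi>' z (0, 1) * F (un z) + \<psi> z * (b (un z) * un' z (0, 1))) = 0"
        using integration_by_parts[OF dF basis1 CF[OF rng] bd] by auto
    qed
    have Ie: "integrable lborel (\<lambda>z. \<psi>' z (e, 0) * (b (un z) * Hn e z) + \<psi> z * (b' (un z) * un' z (e, 0) * Hn e z + b (un z) * Hn' e z (e, 0)))
      \<and> (LINT z|lborel. \<psi>' z (e, 0) * (b (un z) * Hn e z) + \<psi> z * (b' (un z) * un' z (e, 0) * Hn e z + b (un z) * Hn' e z (e, 0))) = 0"
      if e: "e \<in> ?B" for e
    proof -
      obtain C1 where C1: "\<And>z. \<bar>un' z (e, 0)\<bar> \<le> C1"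
        using integrable_mollify_deriv(2)[OF k int(1) basis(1)[OF e]] unfolding un'_def by blast
      obtain C2 where C2: "\<And>z. \<bar>Hn' e z (e, 0)\<bar> \<le> C2"
        using integrable_mollify_deriv(2)[OF k Hi basis(1)[OF e], of e] unfolding Hn'_def by blast
      obtain C3 where C3: "\<And>z. \<bar>Hn e z\<bar> \<le> C3"
        using mollify_bounded[OF k Hi, of e] unfolding Hn_def by blast
      have nn: "0 \<le> C1" "0 \<le> C2" "0 \<le> C3" using C1[of 0] C2[of 0] C3[of 0] by linarith+
      have bd1: "\<bar>b (un z) * Hn e z\<bar> \<le> Cb * C3" if "z \<in> S" for z
        using Cb[OF rng[OF that]] C3[of z] unfolding abs_mult by (intro mult_mono) auto
      have bd2: "\<bar>b' (un z) * un' z (e, 0) * Hn e z + b (un z) * Hn' e z (e, 0)\<bar> \<le> Cb' * C1 * C3 + Cb * C2" if "z \<in> S" for z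
      proof -
        have "\<bar>b' (un z) * un' z (e, 0) * Hn e z\<bar> \<le> Cb' * C1 * C3"
          using Cb'[OF rng[OF that]] C1[of z] C3[of z] nn unfolding abs_mult by (intro mult_mono) auto
        moreover have "\<bar>b (un z) * Hn' e z (e, 0)\<bar> \<le> Cb * C2"
          using Cb[OF rng[OF that]] C2[of z] unfolding abs_mult by (intro mult_mono) auto
        ultimately show ?thesis by linarith
      qed
      show ?thesis using integration_by_parts[OF dbH basis(1)[OF e] bd1 bd2] by blast
    qed
    have Rsum: "Rk k z = - ((\<Sum>e\<in>?B. \<psi>' z (e, 0) * (b (un z) * Hn e z) + \<psi> z * (b' (un z) * un' z (e, 0) * Hn e z + b (un z) * Hn' e z (e, 0)))
        - (\<psi>' z (0, 1) * F (un z) + \<psi> z * (b (un z) * un' z (0, 1))))" for z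
    proof (cases "z \<in> S")
      case True
      have "(\<Sum>e\<in>?B. \<psi>' z (e, 0) * (b (un z) * Hn e z) + \<psi> z * (b' (un z) * un' z (e, 0) * Hn e z + b (un z) * Hn' e z (e, 0)))
          = (\<Sum>e\<in>?B. b (un z) * (Hn e z * \<psi>' z (e, 0)) + \<psi> z * b' (un z) * (Hn e z * (mollify k D z \<bullet> e)) + \<psi> z * b (un z) * Hn' e z (e, 0))"
        by (rule sum.cong) (use Dun[OF True] in \<open>auto simp: algebra_simps\<close>)
      also have "\<dots> = b (un z) * (\<Sum>e\<in>?B. Hn e z * \<psi>' z (e, 0)) + \<psi> z * b' (un z) * (\<Sum>e\<in>?B. Hn e z * (mollify k D z \<bullet> e))
          + \<psi> z * b (un z) * (\<Sum>e\<in>?B. Hn' e z (e, 0))"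
        by (simp add: sum.distrib sum_distrib_left)
      also have "(\<Sum>e\<in>?B. Hn e z * (mollify k D z \<bullet> e)) = mollify k H z \<bullet> mollify k D z"
        unfolding Hn[symmetric] by (rule euclidean_inner[symmetric])
      also have "(\<Sum>e\<in>?B. Hn' e z (e, 0)) = un' z (0, 1) - mollify k g z" using eqn[OF True] by simp
      finally show ?thesis unfolding Rk_def Hn un_def[symmetric] by (simp add: algebra_simps)
    qed (simp add: Rk_def deriv_supp supp)
    show ?thesis
      unfolding Rsum using I0 Ie by (simp add: Bochner_Integration.integral_sum)
  qed
  \<comment> \<open>Bundling the five functions into one vector gives them a common sequence of kernels and a common majorant.\<close>
  define f where "f = (\<lambda>y. (H y, D y, u y, g y, B y))"
  have f: "integrable lborel f" unfolding f_def by (intro integrable_Pair int)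
  obtain k W where k: "\<And>n::nat. mollifier_kernel d (k n)" and W: "integrable lborel W"
    and lim: "AE x in lborel. (\<lambda>n. mollify (k n) f x) \<longlonglongrightarrow> f x"
    and bnd: "AE x in lborel. \<forall>n. norm (mollify (k n) f x) \<le> W x"
    using mollify_dominated_sequence[OF f d] by blast
  have comp: "mollify (k n) f z = (mollify (k n) H z, mollify (k n) D z, mollify (k n) u z, mollify (k n) g z, mollify (k n) B z)" for n z
  proof -
    note ml = mollify_bounded_linear[OF _ k[of n] f, of _ z, symmetric]
    have "fst (mollify (k n) f z) = mollify (k n) H z"
      using ml[of fst] by (simp add: f_def bounded_linear_fst)
    moreover have "fst (snd (mollify (k n) f z)) = mollify (k n) D z"
      using ml[of "\<lambda>x. fst (snd x)"] by (simp add: f_def bounded_linear_intros)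
    moreover have "fst (snd (snd (mollify (k n) f z))) = mollify (k n) u z"
      using ml[of "\<lambda>x. fst (snd (snd x))"] by (simp add: f_def bounded_linear_intros)
    moreover have "fst (snd (snd (snd (mollify (k n) f z)))) = mollify (k n) g z"
      using ml[of "\<lambda>x. fst (snd (snd (snd x)))"] by (simp add: f_def bounded_linear_intros)
    moreover have "snd (snd (snd (snd (mollify (k n) f z)))) = mollify (k n) B z"
      using ml[of "\<lambda>x. snd (snd (snd (snd x)))"] by (simp add: f_def bounded_linear_intros)
    ultimately show ?thesis by (metis prod.collapse)
  qed
  have [measurable]: "u \<in> borel_measurable borel" "g \<in> borel_measurable borel" "H \<in> borel_measurable borel" "D \<in> borel_measurable borel"
    using int by simp_all
  note meas[measurable]
  have [measurable]: "\<psi> \<in> borel_measurable borel" by (rule borel_measurable_continuous_onI[OF cont])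
  have [measurable]: "(\<lambda>z. \<psi>' z e) \<in> borel_measurable borel" if "e \<in> Basis" for e
    by (rule borel_measurable_continuous_onI[OF deriv_cont[OF that]])
  have [measurable]: "(\<lambda>z. \<psi>' z (0, 1)) \<in> borel_measurable borel"
    by (rule borel_measurable_continuous_onI[OF deriv_cont[OF basis1]])
  have [measurable]: "(\<lambda>z. \<Sum>e\<in>?B. (H z \<bullet> e) * \<psi>' z (e, 0)) \<in> borel_measurable borel"
    by (intro borel_measurable_sum borel_measurable_times borel_measurable_inner borel_measurable_const)
       (auto intro!: borel_measurable_continuous_onI[OF deriv_cont[OF basis(1)]])
  have Rm: "R \<in> borel_measurable lborel" unfolding R_def by measurable
  have [measurable]: "S \<in> sets borel" using compact by (simp add: compact_imp_closed)
  obtain C\<psi> where C\<psi>: "\<And>z. \<bar>\<psi> z\<bar> \<le> C\<psi>" using bounded by blast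
  have "\<forall>e\<in>Basis. \<exists>C. \<forall>z. \<bar>\<psi>' z e\<bar> \<le> C" using deriv_bounded by metis
  then obtain C' where C': "\<And>e z. e \<in> Basis \<Longrightarrow> \<bar>\<psi>' z e\<bar> \<le> C' e" by metis
  define C where "C = \<bar>Cb\<bar> + \<bar>Cb'\<bar> + \<bar>CF\<bar> + \<bar>C\<psi>\<bar> + (\<Sum>e\<in>Basis. \<bar>C' e\<bar>)"
  have C: "Cb \<le> C" "Cb' \<le> C" "CF \<le> C" "C\<psi> \<le> C" and C0: "C \<ge> 0"
  proof -
    have "0 \<le> (\<Sum>e\<in>Basis. \<bar>C' e\<bar>)" by (rule sum_nonneg) simp
    then show "Cb \<le> C" "Cb' \<le> C" "CF \<le> C" "C\<psi> \<le> C" "C \<ge> 0" unfolding C_def by linarith+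
  qed
  have C'C: "\<bar>\<psi>' z e\<bar> \<le> C" if "e \<in> Basis" for e z
  proof -
    have "\<bar>C' e\<bar> \<le> (\<Sum>e\<in>Basis. \<bar>C' e\<bar>)" by (rule member_le_sum) (use that in auto)
    then show ?thesis using C'[OF that, of z] unfolding C_def by linarith
  qed
  define W' where "W' = (\<lambda>z. indicator S z * (C * C * ((real DIM('a) + 3) * W z + 1)))"
  have W': "integrable lborel W'"
  proof -
    have "emeasure lborel S < \<infinity>" using compact_imp_bounded[OF compact] by (rule emeasure_bounded_finite)
    then have "integrable lborel (\<lambda>z. indicator S z *\<^sub>R (C * C * (real DIM('a) + 3) * W z) + C * C * indicator S z)"
      by (intro Bochner_Integration.integrable_add integrable_mult_indicator integrable_mult_right W integrable_real_indicator) auto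
    then show ?thesis unfolding W'_def by (rule back_subst[of "integrable lborel"]) (auto simp: algebra_simps)
  qed
  have L: "(\<lambda>n. LINT z|lborel. Rk (k n) z) \<longlonglongrightarrow> (LINT z|lborel. R z)" and iR: "integrable lborel R"
  proof -
    have Rkm: "Rk (k n) \<in> borel_measurable lborel" for n using Rk[OF k[of n]] by auto
    have conv: "AE z in lborel. (\<lambda>n. Rk (k n) z) \<longlonglongrightarrow> R z"
      using lim range
    proof eventually_elim
      fix z assume l: "(\<lambda>n. mollify (k n) f z) \<longlonglongrightarrow> f z" and r: "z \<in> (\<Union>z\<in>S. cball z d) \<longrightarrow> m \<le> u z \<and> u z \<le> M"
      show "(\<lambda>n. Rk (k n) z) \<longlonglongrightarrow> R z"
      proof (cases "z \<in> S")
        case True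
        then have uz: "u z > 0" using r d m by fastforce
        have lH: "(\<lambda>n. mollify (k n) H z) \<longlonglongrightarrow> H z" and lD: "(\<lambda>n. mollify (k n) D z) \<longlonglongrightarrow> D z"
          and lu: "(\<lambda>n. mollify (k n) u z) \<longlonglongrightarrow> u z" and lg: "(\<lambda>n. mollify (k n) g z) \<longlonglongrightarrow> g z"
          using tendsto_fst[OF l] tendsto_fst[OF tendsto_snd[OF l]] tendsto_fst[OF tendsto_snd[OF tendsto_snd[OF l]]]
            tendsto_fst[OF tendsto_snd[OF tendsto_snd[OF tendsto_snd[OF l]]]]
          unfolding comp by (simp_all add: f_def)
        have lb: "(\<lambda>n. b (mollify (k n) u z)) \<longlonglongrightarrow> b (u z)" "(\<lambda>n. F (mollify (k n) u z)) \<longlonglongrightarrow> F (u z)"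
          "(\<lambda>n. b' (mollify (k n) u z)) \<longlonglongrightarrow> b' (u z)"
          using uz continuous_on_interior[OF contb(1), of "u z"] continuous_on_interior[OF contb(2), of "u z"]
            continuous_on_interior[OF b', of "u z"]
          by (auto intro!: isCont_tendsto_compose[OF _ lu] simp: interior_open)
        show ?thesis unfolding Rk_def R_def by (intro tendsto_intros lH lD lu lg lb)
      qed (simp add: Rk_def R_def supp deriv_supp)
    qed
    have dombd: "AE z in lborel. norm (Rk (k n) z) \<le> W' z" for n
      using bnd
    proof eventually_elim
      fix z assume bd: "\<forall>n. norm (mollify (k n) f z) \<le> W z"
      show "norm (Rk (k n) z) \<le> W' z"
      proof (cases "z \<in> S")
        case True
        have nW: "norm (mollify (k n) H z) \<le> W z" "\<bar>mollify (k n) g z\<bar> \<le> W z" "\<bar>mollify (k n) B z\<bar> \<le> W z"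
        proof -
          have n: "norm (mollify (k n) f z) \<le> W z" using bd by blast
          let ?H = "mollify (k n) H z" and ?D = "mollify (k n) D z" and ?U = "mollify (k n) u z"
            and ?G = "mollify (k n) g z" and ?B = "mollify (k n) B z"
          have ch: "norm (D', U, G, B) \<le> norm (H', D', U, G, B)" "norm (U, G, B) \<le> norm (D', U, G, B)"
            "norm (G, B) \<le> norm (U, G, B)" "norm G \<le> norm (G, B)" "norm B \<le> norm (G, B)" "norm H' \<le> norm (H', D', U, G, B)"
            for H' D' :: 'a and U G B :: real by (rule norm_snd_le norm_fst_le)+
          show "norm (mollify (k n) H z) \<le> W z" "\<bar>mollify (k n) g z\<bar> \<le> W z" "\<bar>mollify (k n) B z\<bar> \<le> W z"
            using n ch(1)[of ?D ?U ?G ?B ?H] ch(2)[of ?U ?G ?B ?D] ch(3)[of ?G ?B ?U] ch(4)[of ?G ?B] ch(5)[of ?B ?G] ch(6)[of ?H ?D ?U ?G ?B]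
            unfolding comp real_norm_def by linarith+
        qed
        have "AE y in lborel. y \<in> cball z d \<longrightarrow> m \<le> u y \<and> u y \<le> M"
          using range by eventually_elim (use True in auto)
        note rg = mollify_range[OF k[of n] int(1) this]
        have W0: "W z \<ge> 0" using nW(1) norm_ge_zero order_trans by blast
        have t1: "\<bar>mollify (k n) g z * b (mollify (k n) u z) * \<psi> z\<bar> \<le> W z * C * C"
          unfolding abs_mult using nW(2) Cb[OF rg] C\<psi>[of z] C W0 C0 by (intro mult_mono) auto
        have "\<bar>\<Sum>e\<in>?B. (mollify (k n) H z \<bullet> e) * \<psi>' z (e, 0)\<bar> \<le> (\<Sum>e\<in>?B. W z * C)"
        proof (rule order_trans[OF sum_abs sum_mono])
          fix e assume e: "e \<in> ?B"
          show "\<bar>(mollify (k n) H z \<bullet> e) * \<psi>' z (e, 0)\<bar> \<le> W z * C"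
            unfolding abs_mult using Basis_le_norm[OF e, of "mollify (k n) H z"] nW(1) C'C[OF basis(1)[OF e], of z] C0 W0
            by (intro mult_mono) auto
        qed
        then have t2: "\<bar>b (mollify (k n) u z) * (\<Sum>e\<in>?B. (mollify (k n) H z \<bullet> e) * \<psi>' z (e, 0))\<bar> \<le> C * (real DIM('a) * (W z * C))"
          unfolding abs_mult using Cb[OF rg] C C0 by (intro mult_mono) auto
        have "\<bar>mollify (k n) H z \<bullet> mollify (k n) D z\<bar> \<le> 2 * W z"
          using Cauchy_Schwarz_ineq2[of "mollify (k n) H z" "mollify (k n) D z"]
            mollify_product_bound[OF k[of n] int(3,4,5) dom, of z] nW(3) by linarith
        then have t3: "\<bar>\<psi> z * b' (mollify (k n) u z) * (mollify (k n) H z \<bullet> mollify (k n) D z)\<bar> \<le> C * C * (2 * W z)"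
          unfolding abs_mult using Cb'[OF rg] C\<psi>[of z] C C0 W0 by (intro mult_mono) auto
        have t4: "\<bar>F (mollify (k n) u z) * \<psi>' z (0, 1)\<bar> \<le> C * C"
          unfolding abs_mult using CF[OF rg] C C'C[OF basis1, of z] C0 by (intro mult_mono) auto
        have "norm (Rk (k n) z) \<le> W z * C * C + C * (real DIM('a) * (W z * C)) + C * C * (2 * W z) + C * C"
          unfolding Rk_def real_norm_def using t1 t2 t3 t4 by linarith
        also have "\<dots> = W' z" using True by (simp add: W'_def algebra_simps)
        finally show ?thesis .
      qed (simp add: Rk_def W'_def supp deriv_supp)
    qed
    show "(\<lambda>n. LINT z|lborel. Rk (k n) z) \<longlonglongrightarrow> (LINT z|lborel. R z)"
      by (rule integral_dominated_convergence[OF Rm Rkm W' conv dombd])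
    show "integrable lborel R"
      by (rule integrable_dominated_convergence[where s="\<lambda>n. Rk (k n)", OF Rm Rkm W' conv dombd])
  qed
  show "integrable lborel R" by (rule iR)
  have "(\<lambda>n::nat. 0) \<longlonglongrightarrow> (LINT z|lborel. R z)" using L Rk[OF k] by simp
  then show "(LINT z|lborel. R z) = 0" by (simp add: LIMSEQ_const_iff)
qed

section \<open>Geometry of the Grushin gauge\<close>

lemma rpow_pos: "r > 0 \<Longrightarrow> rpow r s > 0" and rpow_eq: "r > 0 \<Longrightarrow> rpow r s = r powr s"
  by (auto simp: rpow_def)

lemma continuous_rpow_norm:
  fixes f :: "'a::topological_space \<Rightarrow> 'b::real_normed_vector"
  assumes "continuous_on S f" "\<gamma> \<ge> 0"
  shows "continuous_on S (\<lambda>z. rpow (norm (f z)) \<gamma>)"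
  using assms by (cases "\<gamma> = 0") (auto simp: rpow_def intro!: continuous_intros continuous_on_powr')

text \<open>The power \<open>\<rho>\<close> to the \<open>2 (1 + \<gamma>)\<close>, which is smooth off \<open>x = 0\<close> without any root.\<close>

definition grushin_gauge :: "real \<Rightarrow> ('m::finite, 'k::finite) pt \<Rightarrow> real" where
  "grushin_gauge \<gamma> z = norm (fst z) powr (2 * (1 + \<gamma>)) + (1 + \<gamma>)\<^sup>2 * (norm (snd z))\<^sup>2"

lemma rho_gauge: "grushin_rho \<gamma> z = grushin_gauge \<gamma> z powr (1 / (2 * (1 + \<gamma>)))"
  by (simp add: grushin_rho_def grushin_gauge_def)

lemma gauge_nonneg: "grushin_gauge \<gamma> z \<ge> 0" by (simp add: grushin_gauge_def)

lemma gauge_pos: "fst z \<noteq> 0 \<Longrightarrow> grushin_gauge \<gamma> z > 0"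
  by (simp add: grushin_gauge_def add_pos_nonneg)

lemma rho_pos: "fst z \<noteq> 0 \<Longrightarrow> grushin_rho \<gamma> z > 0"
  using gauge_pos[of z \<gamma>] by (simp add: rho_gauge)

lemma rho_nonneg: "grushin_rho \<gamma> z \<ge> 0" by (simp add: rho_gauge)

lemma continuous_rho:
  assumes "\<gamma> \<ge> 0" shows "continuous_on S (grushin_rho \<gamma>)"
  unfolding grushin_rho_def[abs_def] using assms
  by (intro continuous_intros continuous_on_powr') (auto simp: add_nonneg_nonneg)

lemma rho_powr: "\<gamma> \<ge> 0 \<Longrightarrow> grushin_rho \<gamma> z powr (2 * (1 + \<gamma>)) = grushin_gauge \<gamma> z"
  using gauge_nonneg[of \<gamma> z] by (simp add: rho_gauge powr_powr)

lemma norm_fst_le_rho: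
  assumes "\<gamma> \<ge> 0" shows "norm (fst z) \<le> grushin_rho \<gamma> z"
proof -
  have "(norm (fst z) powr (2 * (1 + \<gamma>))) powr (1 / (2 * (1 + \<gamma>))) \<le> grushin_rho \<gamma> z"
    unfolding rho_gauge using assms by (intro powr_mono2) (auto simp: grushin_gauge_def)
  then show ?thesis using assms by (simp add: powr_powr)
qed

lemma norm_snd_le_rho:
  fixes z :: "('m::finite, 'k::finite) pt"
  assumes "\<gamma> \<ge> 0" shows "norm (snd z) \<le> grushin_rho \<gamma> z powr (1 + \<gamma>)"
proof -
  have "((norm (snd z))\<^sup>2) \<le> (1 + \<gamma>)\<^sup>2 * (norm (snd z))\<^sup>2"
  proof -
    have "1 * (norm (snd z))\<^sup>2 \<le> (1 + \<gamma>)\<^sup>2 * (norm (snd z))\<^sup>2"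
      using assms by (intro mult_right_mono) auto
    then show ?thesis by simp
  qed
  also have "\<dots> \<le> grushin_gauge \<gamma> z" by (simp add: grushin_gauge_def)
  also have "\<dots> = (grushin_rho \<gamma> z powr (1 + \<gamma>))\<^sup>2"
    using rho_powr[OF assms, of z] by (simp add: powr_powr power2_eq_square powr_add[symmetric])
  finally show ?thesis by (rule power2_le_imp_le) simp
qed

lemma bounded_rho_le:
  assumes "\<gamma> \<ge> 0" shows "bounded {z :: ('m::finite, 'k::finite) pt. grushin_rho \<gamma> z \<le> r}"
proof -
  have "norm z \<le> r + r powr (1 + \<gamma>)" if "grushin_rho \<gamma> z \<le> r" for z :: "('m, 'k) pt"
  proof -
    have "norm z \<le> norm (fst z) + norm (snd z)" by (metis norm_Pair_le prod.collapse)
    also have "\<dots> \<le> r + r powr (1 + \<gamma>)"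
      using norm_fst_le_rho[OF assms, of z] norm_snd_le_rho[OF assms, of z] that rho_nonneg[of \<gamma> z]
        powr_mono2[of "1 + \<gamma>" "grushin_rho \<gamma> z" r] assms by simp
    finally show ?thesis .
  qed
  then show ?thesis unfolding bounded_iff by blast
qed

lemma open_grushin_ball: "\<gamma> \<ge> 0 \<Longrightarrow> open (grushin_ball \<gamma> R)"
  unfolding grushin_ball_def by (intro open_Collect_less continuous_rho continuous_on_const)

definition rho_grad :: "real \<Rightarrow> ('m::finite, 'k::finite) pt \<Rightarrow> ('m, 'k) pt" where
  "rho_grad \<gamma> z = (grushin_rho \<gamma> z / grushin_gauge \<gamma> z) *\<^sub>R
     ((norm (fst z) powr (2 * \<gamma>)) *\<^sub>R fst z, (1 + \<gamma>) *\<^sub>R snd z)"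

lemma rho_has_derivative:
  fixes z :: "('m::finite, 'k::finite) pt"
  assumes \<gamma>: "\<gamma> \<ge> 0" and x: "fst z \<noteq> 0"
  shows "(grushin_rho \<gamma> has_derivative (\<lambda>h. rho_grad \<gamma> z \<bullet> h)) (at z)"
proof -
  have nz: "(fst z \<bullet> fst z) > 0" using x by simp
  have np: "norm (fst v) powr (2 * (1 + \<gamma>)) = (fst v \<bullet> fst v) powr (1 + \<gamma>)" for v :: "('m, 'k) pt"
    by (simp add: norm_eq_sqrt_inner powr_half_sqrt[symmetric] powr_powr add_divide_distrib)
  have np2: "norm (fst z) powr (2 * \<gamma>) = (fst z \<bullet> fst z) powr \<gamma>"
    by (simp add: norm_eq_sqrt_inner powr_half_sqrt[symmetric] powr_powr)
  have ge: "grushin_gauge \<gamma> v = (fst v \<bullet> fst v) powr (1 + \<gamma>) + (1 + \<gamma>)\<^sup>2 * (snd v \<bullet> snd v)" for v :: "('m, 'k) pt"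
    by (simp only: grushin_gauge_def np dot_square_norm)
  define N' where "N' = (\<lambda>h::('m, 'k) pt. 2 * (1 + \<gamma>) * (((fst z \<bullet> fst z) powr \<gamma>) * (fst z \<bullet> fst h) + (1 + \<gamma>) * (snd z \<bullet> snd h)))"
  have d1: "((\<lambda>v::('m, 'k) pt. (fst v \<bullet> fst v) powr (1 + \<gamma>)) has_derivative
      (\<lambda>h. (1 + \<gamma>) * (fst z \<bullet> fst z) powr \<gamma> * (2 * (fst z \<bullet> fst h)))) (at z)"
  proof -
    have "((\<lambda>v::('m, 'k) pt. fst v \<bullet> fst v) has_derivative (\<lambda>h. 2 * (fst z \<bullet> fst h))) (at z)"
      by (auto intro!: derivative_eq_intros simp: inner_commute)
    moreover have "((\<lambda>t. t powr (1 + \<gamma>)) has_derivative (\<lambda>h. (1 + \<gamma>) * (fst z \<bullet> fst z) powr \<gamma> * h)) (at (fst z \<bullet> fst z))"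
      using has_real_derivative_powr[OF nz, of "1 + \<gamma>"] by (simp add: has_field_derivative_def)
    ultimately show ?thesis by (rule has_derivative_compose)
  qed
  have d2: "((\<lambda>v::('m, 'k) pt. (1 + \<gamma>)\<^sup>2 * (snd v \<bullet> snd v)) has_derivative
      (\<lambda>h. (1 + \<gamma>)\<^sup>2 * (2 * (snd z \<bullet> snd h)))) (at z)"
    by (auto intro!: derivative_eq_intros simp: inner_commute)
  have dN: "(grushin_gauge \<gamma> has_derivative N') (at z)"
    unfolding ge[abs_def] using has_derivative_add[OF d1 d2]
    by (rule has_derivative_eq_rhs) (simp add: N'_def fun_eq_iff algebra_simps power2_eq_square)
  define G where "G = grushin_gauge \<gamma> z"
  have G: "G > 0" using gauge_pos[OF x] by (simp add: G_def)
  have "((\<lambda>t. t powr (1 / (2 * (1 + \<gamma>)))) has_derivative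
      (\<lambda>h. (1 / (2 * (1 + \<gamma>))) * G powr (1 / (2 * (1 + \<gamma>)) - 1) * h)) (at G)"
    using has_real_derivative_powr[OF G, of "1 / (2 * (1 + \<gamma>))"] unfolding has_field_derivative_def .
  from has_derivative_compose[OF dN this[unfolded G_def]]
  have "(grushin_rho \<gamma> has_derivative (\<lambda>h. (1 / (2 * (1 + \<gamma>))) * G powr (1 / (2 * (1 + \<gamma>)) - 1) * N' h)) (at z)"
    by (simp add: rho_gauge[abs_def] G_def)
  then show ?thesis
  proof (rule has_derivative_eq_rhs)
    have "G powr (1 / (2 * (1 + \<gamma>)) - 1) = grushin_rho \<gamma> z / G"
      using G by (simp add: powr_diff rho_gauge G_def)
    then show "(\<lambda>h. (1 / (2 * (1 + \<gamma>))) * G powr (1 / (2 * (1 + \<gamma>)) - 1) * N' h) = (\<lambda>h. rho_grad \<gamma> z \<bullet> h)"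
    proof -
      have "rho_grad \<gamma> z \<bullet> h = (grushin_rho \<gamma> z / G) * ((fst z \<bullet> fst z) powr \<gamma> * (fst z \<bullet> fst h) + (1 + \<gamma>) * (snd z \<bullet> snd h))" for h
        unfolding rho_grad_def G_def np2 inner_scaleR_left
        by (simp only: inner_prod_def inner_scaleR_left fst_conv snd_conv)
      moreover have "1 / (2 * (1 + \<gamma>)) * q * (2 * (1 + \<gamma>) * X) = q * X" for q X :: real using \<gamma> by simp
      ultimately show ?thesis
        by (simp only: N'_def \<open>G powr (1 / (2 * (1 + \<gamma>)) - 1) = grushin_rho \<gamma> z / G\<close>)
    qed
  qed
qed

text \<open>Turns a Euclidean gradient at \<open>z\<close> into the Grushin gradient; it is a symmetric operator, so it also turns the flux of
  a Grushin divergence into the flux of the Euclidean one.\<close>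

definition horizontal :: "real \<Rightarrow> ('m::finite, 'k::finite) pt \<Rightarrow> ('m, 'k) pt \<Rightarrow> ('m, 'k) pt" where
  "horizontal \<gamma> z v = (fst v, rpow (norm (fst z)) \<gamma> *\<^sub>R snd v)"

text \<open>The identity \<open>|\<nabla>\<^sub>\<gamma> \<rho>| = (|x| / \<rho>)\<^sup>\<gamma>\<close>: the \<open>x\<close>-part and the \<open>y\<close>-part of the squared length recombine to the gauge itself.\<close>

lemma norm_horizontal_rho_grad:
  assumes \<gamma>: "\<gamma> \<ge> 0" and x: "fst z \<noteq> 0"
  shows "norm (horizontal \<gamma> z (rho_grad \<gamma> z)) = (norm (fst z) / grushin_rho \<gamma> z) powr \<gamma>"
proof -
  define a where "a = norm (fst z)"
  define b where "b = norm (snd z)"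
  define G where "G = grushin_gauge \<gamma> z"
  define r where "r = grushin_rho \<gamma> z"
  have a: "a > 0" using x by (simp add: a_def)
  have G: "G > 0" and r: "r > 0" using gauge_pos[OF x] rho_pos[OF x] by (simp_all add: G_def r_def)
  have Gr: "G = r powr (2 * (1 + \<gamma>))" using rho_powr[OF \<gamma>, of z] by (simp add: G_def r_def)
  have Gab: "G = a powr (2 * (1 + \<gamma>)) + (1 + \<gamma>)\<^sup>2 * b\<^sup>2" by (simp add: G_def grushin_gauge_def a_def b_def)
  have p2: "(t powr s)\<^sup>2 = t powr (2 * s)" for t s :: real by (simp add: power2_eq_square powr_add[symmetric])
  have "horizontal \<gamma> z (rho_grad \<gamma> z) = ((r / G * a powr (2 * \<gamma>)) *\<^sub>R fst z, (a powr \<gamma> * (r / G) * (1 + \<gamma>)) *\<^sub>R snd z)"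
    using a by (simp add: horizontal_def rho_grad_def r_def G_def a_def rpow_eq)
  then have "(norm (horizontal \<gamma> z (rho_grad \<gamma> z)))\<^sup>2 = (r / G * a powr (2 * \<gamma>) * a)\<^sup>2 + (a powr \<gamma> * (r / G) * (1 + \<gamma>) * b)\<^sup>2"
    by (simp add: norm_Pair a_def b_def power_mult_distrib power_divide)
  also have "\<dots> = (r / G)\<^sup>2 * (a powr \<gamma>)\<^sup>2 * ((a powr \<gamma>)\<^sup>2 * a\<^sup>2 + (1 + \<gamma>)\<^sup>2 * b\<^sup>2)"
  proof -
    have "(q * t\<^sup>2 * a)\<^sup>2 + (t * q * (1 + \<gamma>) * b)\<^sup>2 = q\<^sup>2 * t\<^sup>2 * (t\<^sup>2 * a\<^sup>2 + (1 + \<gamma>)\<^sup>2 * b\<^sup>2)" for q t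
      by (simp add: power2_eq_square algebra_simps)
    then show ?thesis by (simp only: p2[symmetric, of a \<gamma>])
  qed
  also have "(a powr \<gamma>)\<^sup>2 * a\<^sup>2 + (1 + \<gamma>)\<^sup>2 * b\<^sup>2 = G"
  proof -
    have "a powr (2 * (1 + \<gamma>)) = a powr (2 * \<gamma>) * a powr 2" by (simp add: powr_add[symmetric] algebra_simps)
    then show ?thesis unfolding Gab p2 using a by simp
  qed
  also have "(r / G)\<^sup>2 * (a powr \<gamma>)\<^sup>2 * G = ((a / r) powr \<gamma>)\<^sup>2"
  proof -
    have "G = (r powr \<gamma>)\<^sup>2 * r\<^sup>2"
      unfolding Gr p2 using r by (simp add: powr_add[symmetric] algebra_simps flip: powr_numeral)
    then have "(r / G)\<^sup>2 * G = 1 / (r powr \<gamma>)\<^sup>2" using r G by (simp add: power2_eq_square field_simps)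
    moreover have "(a / r) powr \<gamma> = a powr \<gamma> / r powr \<gamma>" using a r by (simp add: powr_divide)
    moreover have "(r / G)\<^sup>2 * (a powr \<gamma>)\<^sup>2 * G = ((r / G)\<^sup>2 * G) * (a powr \<gamma>)\<^sup>2" by (simp only: mult_ac)
    ultimately show ?thesis by (simp only: power_divide) simp
  qed
  finally have "norm (horizontal \<gamma> z (rho_grad \<gamma> z)) = (a / r) powr \<gamma>"
    by (simp add: power2_eq_iff_nonneg)
  then show ?thesis by (simp add: a_def r_def)
qed

text \<open>The gauge is homogeneous of degree one under the anisotropic dilations.\<close>

lemma rho_dilation:
  fixes z :: "('m::finite, 'k::finite) pt"
  assumes \<gamma>: "\<gamma> \<ge> 0" and r: "r > 0"
  shows "grushin_rho \<gamma> (r *\<^sub>R fst z, r powr (1 + \<gamma>) *\<^sub>R snd z) = r * grushin_rho \<gamma> z"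
proof -
  have "grushin_gauge \<gamma> (r *\<^sub>R fst z, r powr (1 + \<gamma>) *\<^sub>R snd z) = r powr (2 * (1 + \<gamma>)) * grushin_gauge \<gamma> z"
  proof -
    have "(r powr (1 + \<gamma>))\<^sup>2 = r powr (2 * (1 + \<gamma>))" by (simp add: power2_eq_square powr_add[symmetric])
    then show ?thesis using r by (simp add: grushin_gauge_def powr_mult power_mult_distrib algebra_simps)
  qed
  then show ?thesis unfolding rho_gauge using r gauge_nonneg[of \<gamma> z] \<gamma>
    by (simp add: powr_mult powr_powr)
qed

text \<open>The dilation is diagonal with \<open>m\<close> entries \<open>r\<close> and \<open>k\<close> entries \<open>r\<close> to the \<open>1 + \<gamma>\<close>, so it multiplies volumes by \<open>r\<close> to the homogeneous
  dimension.\<close>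

lemma emeasure_dilation:
  fixes A :: "('m::finite, 'k::finite) pt set"
  assumes \<gamma>: "\<gamma> \<ge> 0" and r: "r > 0" and A[measurable]: "A \<in> sets borel"
  shows "emeasure lborel ((\<lambda>z. (r *\<^sub>R fst z, r powr (1 + \<gamma>) *\<^sub>R snd z)) -` A) * ennreal (r powr (real CARD('m) + (1 + \<gamma>) * real CARD('k)))
    = emeasure lborel A"
proof -
  define c where "c = (\<lambda>j::('m, 'k) pt. if snd j = 0 then r else r powr (1 + \<gamma>))"
  define T where "T = (\<lambda>z::('m, 'k) pt. (r *\<^sub>R fst z, r powr (1 + \<gamma>) *\<^sub>R snd z))"
  have c: "c j \<noteq> 0" "c j > 0" for j using r by (auto simp: c_def)
  have inj: "inj_on (\<lambda>u. (u, 0)) Basis" "inj_on (\<lambda>v. (0, v)) Basis" by (auto simp: inj_on_def)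
  have split: "(\<Sum>j\<in>(Basis::('m, 'k) pt set). F j) = (\<Sum>u\<in>Basis. F (u, 0)) + (\<Sum>v\<in>Basis. F (0, v))" for F :: "('m, 'k) pt \<Rightarrow> ('m, 'k) pt"
    unfolding Basis_prod_def by (subst sum.union_disjoint) (auto simp: sum.reindex inj)
  have psplit: "(\<Prod>j\<in>(Basis::('m, 'k) pt set). F j) = (\<Prod>u\<in>Basis. F (u, 0)) * (\<Prod>v\<in>Basis. F (0, v))" for F :: "('m, 'k) pt \<Rightarrow> real"
    unfolding Basis_prod_def by (subst prod.union_disjoint) (auto simp: prod.reindex inj)
  have T: "T z = 0 + (\<Sum>j\<in>Basis. (c j * (z \<bullet> j)) *\<^sub>R j)" for z
  proof -
    have "(\<Sum>u\<in>Basis. (c (u, 0) * (z \<bullet> (u, 0))) *\<^sub>R (u, 0::real ^ 'k)) = (r *\<^sub>R fst z, 0)"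
    proof -
      have "(\<Sum>u\<in>Basis. (c (u, 0) * (z \<bullet> (u, 0))) *\<^sub>R (u, 0::real ^ 'k)) = (\<Sum>u\<in>Basis. (r *\<^sub>R ((fst z \<bullet> u) *\<^sub>R u), 0))"
        by (simp add: c_def inner_prod_def)
      also have "\<dots> = (r *\<^sub>R (\<Sum>u\<in>Basis. (fst z \<bullet> u) *\<^sub>R u), 0)"
        by (simp add: sum_prod scaleR_sum_right)
      finally show ?thesis by (simp add: euclidean_representation)
    qed
    moreover have "(\<Sum>v\<in>Basis. (c (0, v) * (z \<bullet> (0, v))) *\<^sub>R (0::real ^ 'm, v)) = (0, r powr (1 + \<gamma>) *\<^sub>R snd z)"
    proof -
      have "(\<Sum>v\<in>Basis. (c (0, v) * (z \<bullet> (0, v))) *\<^sub>R (0::real ^ 'm, v)) = (\<Sum>v\<in>Basis. (0, r powr (1 + \<gamma>) *\<^sub>R ((snd z \<bullet> v) *\<^sub>R v)))"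
        by (rule sum.cong) (auto simp: c_def inner_prod_def nonzero_Basis)
      also have "\<dots> = (0, r powr (1 + \<gamma>) *\<^sub>R (\<Sum>v\<in>Basis. (snd z \<bullet> v) *\<^sub>R v))"
        by (simp add: sum_prod scaleR_sum_right)
      finally show ?thesis by (simp add: euclidean_representation)
    qed
    ultimately show ?thesis unfolding split by (simp add: T_def)
  qed
  have "(\<Prod>j\<in>Basis. \<bar>c j\<bar>) = r ^ CARD('m) * (r powr (1 + \<gamma>)) ^ CARD('k)"
  proof -
    have "(\<Prod>j\<in>Basis. \<bar>c j\<bar>) = (\<Prod>u\<in>(Basis::(real^'m) set). r) * (\<Prod>v\<in>(Basis::(real^'k) set). r powr (1 + \<gamma>))"
      unfolding psplit using r by (intro arg_cong2[where f="(*)"] prod.cong) (auto simp: c_def nonzero_Basis)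
    then show ?thesis by simp
  qed
  also have "\<dots> = r powr (real CARD('m) + (1 + \<gamma>) * real CARD('k))"
  proof -
    have "(r powr (1 + \<gamma>)) ^ n = r powr ((1 + \<gamma>) * real n)" for n
      using r by (simp add: powr_powr[symmetric] powr_realpow)
    moreover have "r ^ n = r powr real n" for n using r by (simp add: powr_realpow)
    ultimately show ?thesis by (simp only: powr_add)
  qed
  finally have pr: "(\<Prod>j\<in>Basis. \<bar>c j\<bar>) = r powr (real CARD('m) + (1 + \<gamma>) * real CARD('k))" .
  have lb: "lborel = density (distr lborel borel T) (\<lambda>_. ennreal (r powr (real CARD('m) + (1 + \<gamma>) * real CARD('k))))"
    using lborel_affine_euclidean[of c 0] c unfolding T[abs_def] pr by simp
  have Tm[measurable]: "T \<in> borel \<rightarrow>\<^sub>M borel"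
    unfolding T_def by (intro borel_measurable_continuous_onI continuous_intros)
  have "emeasure lborel A = (\<integral>\<^sup>+x. ennreal (r powr (real CARD('m) + (1 + \<gamma>) * real CARD('k))) * indicator A x \<partial>distr lborel borel T)"
    by (subst lb, subst emeasure_density) auto
  also have "\<dots> = ennreal (r powr (real CARD('m) + (1 + \<gamma>) * real CARD('k))) * emeasure (distr lborel borel T) A"
    by (simp add: nn_integral_cmult)
  also have "emeasure (distr lborel borel T) A = emeasure lborel (T -` A)"
    by (subst emeasure_distr) auto
  finally show ?thesis by (simp add: T_def mult.commute)
qed

section \<open>Volumes of shells near the boundary\<close>

text \<open>A dilation-invariant set meets the gauge ball of radius \<open>r\<close> in the dilate of its intersection with the unit ball.\<close>

lemma emeasure_cone:
  fixes \<Gamma> :: "('m::finite, 'k::finite) pt set"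
  assumes \<gamma>: "\<gamma> \<ge> 0" and r: "r > 0" and m[measurable]: "\<Gamma> \<in> sets borel"
    and inv: "\<And>r z. r > 0 \<Longrightarrow> (r *\<^sub>R fst z, r powr (1 + \<gamma>) *\<^sub>R snd z) \<in> \<Gamma> \<longleftrightarrow> z \<in> \<Gamma>"
  shows "emeasure lborel (\<Gamma> \<inter> {z. grushin_rho \<gamma> z < r})
    = ennreal (r powr (real CARD('m) + (1 + \<gamma>) * real CARD('k))) * emeasure lborel (\<Gamma> \<inter> {z. grushin_rho \<gamma> z < 1})"
proof -
  have [measurable]: "(\<lambda>z::('m,'k) pt. grushin_rho \<gamma> z) \<in> borel_measurable borel"
    using continuous_rho[OF \<gamma>] by (rule borel_measurable_continuous_onI)
  have "(\<lambda>z. (r *\<^sub>R fst z, r powr (1 + \<gamma>) *\<^sub>R snd z)) -` (\<Gamma> \<inter> {z. grushin_rho \<gamma> z < r}) = \<Gamma> \<inter> {z. grushin_rho \<gamma> z < 1}"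
    by (rule set_eqI) (use r in \<open>simp add: inv[OF r] rho_dilation[OF \<gamma> r] del: split_paired_All\<close>)
  moreover have "\<Gamma> \<inter> {z. grushin_rho \<gamma> z < r} \<in> sets borel" by measurable
  ultimately show ?thesis
    using emeasure_dilation[OF \<gamma> r, of "\<Gamma> \<inter> {z. grushin_rho \<gamma> z < r}"] by (simp add: mult.commute)
qed

lemma measure_cone_annulus:
  fixes \<Gamma> :: "('m::finite, 'k::finite) pt set"
  assumes \<gamma>: "\<gamma> \<ge> 0" and r: "0 < r" "r \<le> r'" and m[measurable]: "\<Gamma> \<in> sets borel"
    and inv: "\<And>r z. r > 0 \<Longrightarrow> (r *\<^sub>R fst z, r powr (1 + \<gamma>) *\<^sub>R snd z) \<in> \<Gamma> \<longleftrightarrow> z \<in> \<Gamma>"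
    and Q: "Q = real CARD('m) + (1 + \<gamma>) * real CARD('k)"
  shows "measure lborel (\<Gamma> \<inter> {z. r \<le> grushin_rho \<gamma> z \<and> grushin_rho \<gamma> z < r'})
    = (r' powr Q - r powr Q) * measure lborel (\<Gamma> \<inter> {z. grushin_rho \<gamma> z < 1})"
proof -
  have [measurable]: "(\<lambda>z::('m,'k) pt. grushin_rho \<gamma> z) \<in> borel_measurable borel"
    using continuous_rho[OF \<gamma>] by (rule borel_measurable_continuous_onI)
  have cone: "measure lborel (\<Gamma> \<inter> {z. grushin_rho \<gamma> z < s}) = s powr Q * measure lborel (\<Gamma> \<inter> {z. grushin_rho \<gamma> z < 1})" if "s > 0" for s
    using emeasure_cone[OF \<gamma> that m inv] by (simp add: measure_def Q enn2real_mult)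
  have fin: "emeasure lborel (\<Gamma> \<inter> {z. grushin_rho \<gamma> z < s}) \<noteq> \<infinity>" for s
  proof -
    have "bounded (\<Gamma> \<inter> {z. grushin_rho \<gamma> z < s})"
      by (rule bounded_subset[OF bounded_rho_le[OF \<gamma>, of s]]) auto
    from emeasure_bounded_finite[OF this] show ?thesis by simp
  qed
  have "\<Gamma> \<inter> {z. r \<le> grushin_rho \<gamma> z \<and> grushin_rho \<gamma> z < r'} = \<Gamma> \<inter> {z. grushin_rho \<gamma> z < r'} - \<Gamma> \<inter> {z. grushin_rho \<gamma> z < r}"
    by auto
  also have "measure lborel \<dots> = measure lborel (\<Gamma> \<inter> {z. grushin_rho \<gamma> z < r'}) - measure lborel (\<Gamma> \<inter> {z. grushin_rho \<gamma> z < r})"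
    using fin r by (intro measure_Diff) auto
  finally show ?thesis
    using cone[of r] cone[of r'] r by (simp only: left_diff_distrib)
qed

lemma exp_shell_bounds:
  fixes t s Q :: real
  assumes "0 \<le> s" "s \<le> t" "t \<le> 1" "Q > 0"
  shows "exp (- Q * s) - exp (- Q * t) \<le> Q * (t - s)"
    and "exp (- Q) * Q * (t - s) \<le> exp (- Q * s) - exp (- Q * t)"
proof -
  have "exp (- Q * t) = exp (- Q * s) * exp (- (Q * (t - s)))"
    by (simp add: exp_add[symmetric] algebra_simps)
  then have d: "exp (- Q * s) - exp (- Q * t) = exp (- Q * s) * (1 - exp (- (Q * (t - s))))"
    by (simp add: algebra_simps)
  have d': "exp (- Q * s) - exp (- Q * t) = exp (- Q * t) * (exp (Q * (t - s)) - 1)"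
    by (simp add: algebra_simps exp_add[symmetric])
  have q: "0 \<le> Q * (t - s)" using assms by simp
  have "exp (- Q * s) * (1 - exp (- (Q * (t - s)))) \<le> 1 * (Q * (t - s))"
  proof (rule mult_mono)
    show "1 - exp (- (Q * (t - s))) \<le> Q * (t - s)"
      using exp_ge_add_one_self[of "- (Q * (t - s))"] by linarith
  qed (use assms q in auto)
  then show "exp (- Q * s) - exp (- Q * t) \<le> Q * (t - s)" unfolding d by simp
  have "exp (- Q) * (Q * (t - s)) \<le> exp (- Q * t) * (exp (Q * (t - s)) - 1)"
  proof (rule mult_mono)
    show "Q * (t - s) \<le> exp (Q * (t - s)) - 1"
      using exp_ge_add_one_self[of "Q * (t - s)"] by linarith
  qed (use assms q in auto)
  then show "exp (- Q) * Q * (t - s) \<le> exp (- Q * s) - exp (- Q * t)" unfolding d' by (simp add: mult.assoc)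
qed

text \<open>The layer where \<open>L = ln (R / \<rho>)\<close> lies between \<open>exp (- (j + 1))\<close> and \<open>exp (- j)\<close>.\<close>

definition shell :: "real \<Rightarrow> real \<Rightarrow> nat \<Rightarrow> ('m::finite, 'k::finite) pt set" where
  "shell \<gamma> R j = {z. R * exp (- exp (- real j)) \<le> grushin_rho \<gamma> z \<and> grushin_rho \<gamma> z < R * exp (- exp (- real (Suc j)))}"

lemma shell_iff:
  assumes "R > 0"
  shows "z \<in> shell \<gamma> R j \<longleftrightarrow> 0 < grushin_rho \<gamma> z \<and> exp (- real (Suc j)) < ln (R / grushin_rho \<gamma> z) \<and> ln (R / grushin_rho \<gamma> z) \<le> exp (- real j)"
proof (cases "grushin_rho \<gamma> z > 0")
  case True
  have "R * exp (- t) \<le> grushin_rho \<gamma> z \<longleftrightarrow> ln (R / grushin_rho \<gamma> z) \<le> t" for t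
  proof -
    have "ln (R / grushin_rho \<gamma> z) \<le> t \<longleftrightarrow> R / grushin_rho \<gamma> z \<le> exp t"
      using True assms by (metis divide_pos_pos exp_le_cancel_iff exp_ln)
    then show ?thesis using True by (simp add: exp_minus field_simps)
  qed
  from this[of "exp (- real j)"] this[of "exp (- real (Suc j))"] show ?thesis
    using True unfolding shell_def by (auto simp: not_le[symmetric])
next
  case False
  then have "grushin_rho \<gamma> z = 0" using rho_nonneg[of \<gamma> z] by simp
  moreover have "0 < R * exp (- exp (- real j))" using assms by simp
  ultimately show ?thesis by (auto simp: shell_def not_le)
qed

text \<open>On the \<open>j\<close>-th shell \<open>1/L\<close> is comparable to \<open>exp j\<close>, so these two-sided bounds say that every shell, and its part in a cone,
  carries about the same amount of \<open>1/L\<close>: the integral of \<open>1/L\<close> diverges logarithmically at the boundary.\<close>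

lemma shell_measure:
  fixes \<Gamma> :: "('m::finite, 'k::finite) pt set"
  assumes \<gamma>: "\<gamma> \<ge> 0" and R: "R > 0" and m[measurable]: "\<Gamma> \<in> sets borel"
    and inv: "\<And>r z. r > 0 \<Longrightarrow> (r *\<^sub>R fst z, r powr (1 + \<gamma>) *\<^sub>R snd z) \<in> \<Gamma> \<longleftrightarrow> z \<in> \<Gamma>"
    and Q: "Q = real CARD('m) + (1 + \<gamma>) * real CARD('k)"
    and V: "V = R powr Q * measure lborel (\<Gamma> \<inter> {z. grushin_rho \<gamma> z < 1})"
  shows "measure lborel (\<Gamma> \<inter> shell \<gamma> R j) \<le> V * Q * exp (- real j)"
    and "V * Q * exp (- Q) * (1 - exp (-1)) * exp (- real j) \<le> measure lborel (\<Gamma> \<inter> shell \<gamma> R j)"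
    and "\<Gamma> \<inter> shell \<gamma> R j \<in> sets borel" "emeasure lborel (\<Gamma> \<inter> shell \<gamma> R j) < \<infinity>"
proof -
  let ?t = "exp (- real j)" and ?s = "exp (- real (Suc j))"
  have [measurable]: "(\<lambda>z::('m,'k) pt. grushin_rho \<gamma> z) \<in> borel_measurable borel"
    using continuous_rho[OF \<gamma>] by (rule borel_measurable_continuous_onI)
  have Qp: "Q > 0" unfolding Q using \<gamma> by (simp add: add_pos_nonneg)
  have V0: "V \<ge> 0" unfolding V by simp
  have st: "0 \<le> ?s" "?s \<le> ?t" "?t \<le> 1" by auto
  have ps: "(R * exp (- x)) powr Q = R powr Q * exp (- Q * x)" for x
    using R by (simp add: powr_mult exp_powr_real mult.commute)
  have ms: "measure lborel (\<Gamma> \<inter> shell \<gamma> R j) = V * (exp (- Q * ?s) - exp (- Q * ?t))"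
    unfolding shell_def
    using measure_cone_annulus[OF \<gamma> _ _ m inv Q, of "R * exp (- ?t)" "R * exp (- ?s)"] R st(2)
    unfolding ps by (simp add: V algebra_simps)
  have ts: "?t - ?s \<le> ?t" "?t - ?s = (1 - exp (-1)) * ?t" by (auto simp: algebra_simps exp_add[symmetric])
  have "measure lborel (\<Gamma> \<inter> shell \<gamma> R j) \<le> V * (Q * ?t)"
    unfolding ms using exp_shell_bounds(1)[OF st Qp] V0 Qp ts(1)
    by (intro mult_left_mono) (auto intro: order_trans mult_left_mono)
  then show "measure lborel (\<Gamma> \<inter> shell \<gamma> R j) \<le> V * Q * exp (- real j)" by (simp add: mult.assoc)
  have "V * (exp (- Q) * Q * (?t - ?s)) \<le> measure lborel (\<Gamma> \<inter> shell \<gamma> R j)"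
    unfolding ms using exp_shell_bounds(2)[OF st Qp] V0 by (intro mult_left_mono)
  then show "V * Q * exp (- Q) * (1 - exp (-1)) * exp (- real j) \<le> measure lborel (\<Gamma> \<inter> shell \<gamma> R j)"
    unfolding ts(2) by (simp add: mult_ac)
  show "\<Gamma> \<inter> shell \<gamma> R j \<in> sets borel" unfolding shell_def by measurable
  have "bounded (\<Gamma> \<inter> shell \<gamma> R j)"
    by (rule bounded_subset[OF bounded_rho_le[OF \<gamma>, of "R * exp (- ?s)"]]) (auto simp: shell_def)
  then show "emeasure lborel (\<Gamma> \<inter> shell \<gamma> R j) < \<infinity>"
    by (rule emeasure_bounded_finite)
qed

text \<open>The cone keeps a fixed angle to the degenerate set \<open>x = 0\<close>; being open and containing the point with \<open>y = 0\<close>, it has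
  positive volume.\<close>

lemma cone_measure_pos:
  assumes \<gamma>: "\<gamma> \<ge> 0"
  shows "measure lborel ({z::('m::finite, 'k::finite) pt. norm (fst z) > grushin_rho \<gamma> z / 2} \<inter> {z. grushin_rho \<gamma> z < 1}) > 0"
proof -
  let ?A = "{z::('m, 'k) pt. norm (fst z) > grushin_rho \<gamma> z / 2} \<inter> {z. grushin_rho \<gamma> z < 1}"
  have o: "open ?A"
  proof (rule open_Int)
    have c: "continuous_on UNIV (\<lambda>z::('m, 'k) pt. grushin_rho \<gamma> z)" by (rule continuous_rho[OF \<gamma>])
    have "continuous_on UNIV (\<lambda>z::('m, 'k) pt. grushin_rho \<gamma> z / 2)"
      by (rule continuous_on_divide[OF c continuous_on_const]) simp
    then show "open {z::('m, 'k) pt. norm (fst z) > grushin_rho \<gamma> z / 2}"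
      by (rule open_Collect_less) (intro continuous_intros)
    show "open {z::('m, 'k) pt. grushin_rho \<gamma> z < 1}"
      by (rule open_Collect_less[OF c continuous_on_const])
  qed
  obtain e :: "real ^ 'm" where e: "norm e = 1" using vector_choose_size[OF zero_le_one] by blast
  have "grushin_rho \<gamma> ((1/2) *\<^sub>R e, 0 :: real ^ 'k) = 1/2"
    using e \<gamma> by (simp add: grushin_rho_def powr_powr)
  then have "((1/2) *\<^sub>R e, 0) \<in> ?A" using e by simp
  then have "\<not> negligible ?A" using o open_not_negligible by blast
  moreover have "negligible ?A" if "emeasure lborel ?A = 0"
  proof -
    have "?A \<in> null_sets lborel" using that o by (intro null_setsI) auto
    then show ?thesis unfolding negligible_iff_null_sets by (rule null_sets_completionI)
  qed
  ultimately have "emeasure lborel ?A \<noteq> 0" by blast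
  then have nz: "emeasure lborel ?A \<noteq> 0" .
  have fin: "emeasure lborel ?A < \<infinity>"
    by (rule emeasure_bounded_finite, rule bounded_subset[OF bounded_rho_le[OF \<gamma>, of 1]]) auto
  have "measure lborel A > 0" if "emeasure lborel A \<noteq> 0" "emeasure lborel A < \<infinity>" for A :: "('m, 'k) pt set"
  proof (rule ccontr)
    assume "\<not> measure lborel A > 0"
    then have m0: "measure lborel A = 0" using measure_nonneg[of lborel A] by linarith
    have "emeasure lborel A \<noteq> top" using that(2) by (auto simp: less_le)
    from emeasure_eq_ennreal_measure[OF this] have "emeasure lborel A = 0" unfolding m0 by (simp only: ennreal_0)
    then show False using that(1) by contradiction
  qed
  from this[OF nz fin] show ?thesis .
qed

section \<open>Representatives, compact supports and space-time integrals\<close>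

text \<open>Differentiating lowers the exponent and replaces \<open>\<phi>\<close> by other smooth functions whose support is no larger, so the induction
  has to run over all exponents and all such \<open>\<phi>\<close>.\<close>

lemma C_k_powr_mult:
  fixes X \<phi> :: "'a::euclidean_space \<Rightarrow> real"
  assumes "\<And>n. C_k n X" "\<And>n. C_k n \<phi>" "closure {y. \<phi> y \<noteq> 0} \<subseteq> {y. X y > 0}"
  shows "C_k n (\<lambda>y. X y powr a * \<phi> y)"
proof -
  have der: "((\<lambda>y. X y powr a * \<phi> y) has_derivative
      (\<lambda>h. X y powr (a - 1) * (a * frechet_derivative X (at y) h * \<phi> y) + X y powr a * frechet_derivative \<phi> (at y) h)) (at y)"
    and supp': "y \<notin> closure {y. \<phi> y \<noteq> 0} \<Longrightarrow> frechet_derivative \<phi> (at y) h = 0"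
    if X: "\<And>n. C_k n X" and \<phi>: "\<And>n. C_k n \<phi>" and s: "closure {y. \<phi> y \<noteq> 0} \<subseteq> {y. X y > 0}"
    for a \<phi> y h and X :: "'a \<Rightarrow> real"
  proof -
    have z: "\<phi> y = 0" "(\<phi> has_derivative (\<lambda>h. 0)) (at y)" "((\<lambda>y. X y powr a * \<phi> y) has_derivative (\<lambda>h. 0)) (at y)"
      if y: "y \<notin> closure {y. \<phi> y \<noteq> 0}" for y
    proof -
      have o: "open (- closure {y. \<phi> y \<noteq> 0})" by (intro open_Compl closed_closure)
      have z: "\<phi> v = 0" if "v \<in> - closure {y. \<phi> y \<noteq> 0}" for v
        using that closure_subset[of "{y. \<phi> y \<noteq> 0}"] by blast
      have c: "((\<lambda>y. 0 :: real) has_derivative (\<lambda>h. 0)) (at y)" by simp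
      have z2: "X v powr a * \<phi> v = 0" if "v \<in> - closure {y. \<phi> y \<noteq> 0}" for v
        unfolding z[OF that] by simp
      have y': "y \<in> - closure {y. \<phi> y \<noteq> 0}" using y by blast
      show "\<phi> y = 0" by (rule z[OF y'])
      show "(\<phi> has_derivative (\<lambda>h. 0)) (at y)"
        by (rule has_derivative_transform_within_open[OF c o y']) (erule z[symmetric])
      show "((\<lambda>y. X y powr a * \<phi> y) has_derivative (\<lambda>h. 0)) (at y)"
        by (rule has_derivative_transform_within_open[OF c o y']) (erule z2[symmetric])
    qed
    show sp: "y \<notin> closure {y. \<phi> y \<noteq> 0} \<Longrightarrow> frechet_derivative \<phi> (at y) h = 0" for y h
      using frechet_derivative_at[OF z(2)] by metis
    show "((\<lambda>y. X y powr a * \<phi> y) has_derivative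
      (\<lambda>h. X y powr (a - 1) * (a * frechet_derivative X (at y) h * \<phi> y) + X y powr a * frechet_derivative \<phi> (at y) h)) (at y)"
    proof (cases "y \<in> closure {y. \<phi> y \<noteq> 0}")
      case True
      then have Xy: "X y > 0" using s by blast
      have "((\<lambda>y. X y powr a) has_derivative (\<lambda>h. a * X y powr (a - 1) * frechet_derivative X (at y) h)) (at y)"
        using has_derivative_compose[OF C_k_has_derivative[OF X] has_real_derivative_powr[OF Xy, of a, unfolded has_field_derivative_def]] .
      from has_derivative_mult[OF this C_k_has_derivative[OF \<phi>]]
      show ?thesis by (rule has_derivative_eq_rhs) (simp add: fun_eq_iff algebra_simps)
    next
      case False
      show ?thesis using z(3)[OF False] by (rule has_derivative_eq_rhs) (simp add: fun_eq_iff z(1)[OF False] sp[OF False])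
    qed
  qed
  show ?thesis using assms(2,3)
  proof (induction n arbitrary: a \<phi>)
    case 0
    have "continuous_on UNIV (\<lambda>y. X y powr a * \<phi> y)"
      by (intro continuous_at_imp_continuous_on ballI has_derivative_continuous[OF der[OF assms(1) 0]])
    then show ?case by simp
  next
    case (Suc n)
    have \<phi>: "C_k n \<phi>" for n by (rule Suc.prems(1))
    have X: "C_k n X" for n by (rule assms(1))
    have d: "C_k n (\<lambda>y. frechet_derivative f (at y) b)" if "\<And>n. C_k n f" "b \<in> Basis" for f :: "'a \<Rightarrow> real" and b n
      using that(1)[of "Suc n"] that(2) by simp
    show ?case
    proof (rule C_k_SucI[OF der[OF X \<phi> Suc.prems(2)]], rule C_k_add)
      fix b :: 'a assume b: "b \<in> Basis"
      show "C_k n (\<lambda>y. X y powr (a - 1) * (a * frechet_derivative X (at y) b * \<phi> y))"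
      proof (rule Suc.IH)
        show "C_k n (\<lambda>y. a * frechet_derivative X (at y) b * \<phi> y)" for n
          by (intro C_k_mult C_k_const d X \<phi> b)
        have "closure {y. a * frechet_derivative X (at y) b * \<phi> y \<noteq> 0} \<subseteq> closure {y. \<phi> y \<noteq> 0}"
          by (rule closure_mono) auto
        then show "closure {y. a * frechet_derivative X (at y) b * \<phi> y \<noteq> 0} \<subseteq> {y. X y > 0}"
          using Suc.prems(2) by blast
      qed
      show "C_k n (\<lambda>y. X y powr a * frechet_derivative \<phi> (at y) b)"
      proof (rule Suc.IH)
        show "C_k n (\<lambda>y. frechet_derivative \<phi> (at y) b)" for n by (intro d \<phi> b)
        have "{y. frechet_derivative \<phi> (at y) b \<noteq> 0} \<subseteq> closure {y. \<phi> y \<noteq> 0}"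
          using supp'[OF X \<phi> Suc.prems(2)] by blast
        then have "closure {y. frechet_derivative \<phi> (at y) b \<noteq> 0} \<subseteq> closure {y. \<phi> y \<noteq> 0}"
          by (rule closure_minimal[OF _ closed_closure])
        then show "closure {y. frechet_derivative \<phi> (at y) b \<noteq> 0} \<subseteq> {y. X y > 0}"
          using Suc.prems(2) by blast
      qed
    qed
  qed
qed

text \<open>Lebesgue integrable functions are replaced by Borel ones so that Tonelli applies on the product measure.\<close>

lemma borel_representative:
  fixes f :: "'a::euclidean_space \<Rightarrow> 'b::euclidean_space"
  assumes f: "f absolutely_integrable_on K" and K[measurable]: "K \<in> sets borel"
  obtains f' where "integrable lborel f'" "AE z in lborel. z \<in> K \<longrightarrow> f' z = f z" "\<And>z. z \<notin> K \<Longrightarrow> f' z = 0"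
proof -
  define h where "h = (\<lambda>z. indicator K z *\<^sub>R f z)"
  have h: "integrable lebesgue h" using f by (simp add: set_integrable_def h_def)
  have "\<forall>e\<in>Basis. \<exists>g. g \<in> borel_measurable lborel \<and> (AE z in lborel. h z \<bullet> e = g z)"
  proof
    fix e :: 'b
    have "integrable lebesgue (\<lambda>z. h z \<bullet> e)" using h by simp
    then show "\<exists>g. g \<in> borel_measurable lborel \<and> (AE z in lborel. h z \<bullet> e = g z)"
      using completion_ex_borel_measurable_real[of "\<lambda>z. h z \<bullet> e" lborel] by blast
  qed
  then obtain g where g: "\<And>e. e \<in> Basis \<Longrightarrow> g e \<in> borel_measurable lborel"
    "\<And>e. e \<in> Basis \<Longrightarrow> AE z in lborel. h z \<bullet> e = g e z" by metis
  define f' where "f' = (\<lambda>z. indicator K z *\<^sub>R (\<Sum>e\<in>Basis. g e z *\<^sub>R e))"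
  have f'm: "f' \<in> borel_measurable lborel"
    unfolding f'_def using g(1) by (intro borel_measurable_scaleR borel_measurable_sum borel_measurable_const) auto
  have "AE z in lborel. \<forall>e\<in>Basis. h z \<bullet> e = g e z"
    using g(2) by (simp add: AE_finite_all)
  then have ae: "AE z in lborel. f' z = h z"
  proof eventually_elim
    fix z assume hg: "\<forall>e\<in>Basis. h z \<bullet> e = g e z"
    have "(\<Sum>e\<in>Basis. g e z *\<^sub>R e) = (\<Sum>e\<in>Basis. (h z \<bullet> e) *\<^sub>R e)"
      by (rule sum.cong) (use hg in simp_all)
    then have "(\<Sum>e\<in>Basis. g e z *\<^sub>R e) = h z" by (simp only: euclidean_representation)
    then show "f' z = h z" by (simp add: f'_def h_def indicator_def)
  qed
  have "integrable lebesgue f' \<longleftrightarrow> integrable lebesgue h"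
    by (rule integrable_cong_AE) (use f'm h ae in \<open>auto intro: measurable_completion AE_completion\<close>)
  then have "integrable lborel f'" using h f'm by (simp add: integrable_completion)
  moreover have "AE z in lborel. z \<in> K \<longrightarrow> f' z = f z" using ae by eventually_elim (simp add: h_def)
  moreover have "z \<notin> K \<Longrightarrow> f' z = 0" for z by (simp add: f'_def)
  ultimately show ?thesis by (rule that)
qed

lemma lebesgue_on_transfer:
  fixes E E' :: "'a::euclidean_space \<Rightarrow> 'b::euclidean_space"
  assumes m: "E' \<in> borel_measurable borel" and \<Omega>: "\<Omega> \<in> sets borel"
    and ae: "AE z in lborel. z \<in> \<Omega> \<longrightarrow> E z = E' z" and z: "\<And>z. z \<notin> \<Omega> \<Longrightarrow> E' z = 0"
  shows "(LINT z|lebesgue_on \<Omega>. E z) = (LINT z|lborel. E' z)"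
proof -
  have ae': "AE z in lebesgue. E' z = indicator \<Omega> z *\<^sub>R E z"
    by (rule AE_completion) (use ae in eventually_elim, auto simp: z indicator_def)
  have m': "E' \<in> borel_measurable lebesgue" using m by (intro measurable_completion) simp
  have "(LINT z|lebesgue_on \<Omega>. E z) = (LINT z|lebesgue. indicator \<Omega> z *\<^sub>R E z)"
    using \<Omega> by (subst integral_restrict_space) (auto simp: sets.sets_into_space)
  also have "\<dots> = (LINT z|lebesgue. E' z)"
    by (rule integral_cong_AE[OF borel_measurable_AE[OF m' ae'] m']) (use ae' in eventually_elim, simp)
  also have "\<dots> = (LINT z|lborel. E' z)" by (rule integral_completion) (use m in simp)
  finally show ?thesis .
qed

lemma integrable_times_continuous_compact:
  fixes f :: "'a::euclidean_space \<Rightarrow> real"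
  assumes f: "integrable lborel f" and c: "continuous_on UNIV c" "bounded S" "\<And>y. y \<notin> S \<Longrightarrow> c y = 0"
  shows "integrable lborel (\<lambda>y. f y * c y)"
proof -
  obtain r where r: "\<And>x. x \<in> S \<Longrightarrow> norm x \<le> r" using c(2) unfolding bounded_iff by blast
  have "\<And>x. norm x > r \<Longrightarrow> c x = 0" using r c(3) by force
  then obtain M where "\<And>x. \<bar>c x\<bar> \<le> M" using continuous_compact_support_bounded[OF c(1)] by metis
  from integrable_bounded_continuous_mult[OF f c(1) this] show ?thesis by (simp add: mult.commute)
qed

lemma locally_bounded_compact:
  assumes "locally_bounded_on f S" "compact K" "K \<subseteq> S"
  obtains M where "\<And>x. x \<in> K \<Longrightarrow> \<bar>f x\<bar> \<le> M"
proof -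
  have "\<forall>x\<in>K. \<exists>U. open U \<and> x \<in> U \<and> bounded (f ` (U \<inter> S))"
    using assms(1,3) unfolding locally_bounded_on_def by blast
  then obtain U where U: "\<And>x. x \<in> K \<Longrightarrow> open (U x)" "\<And>x. x \<in> K \<Longrightarrow> x \<in> U x"
    "\<And>x. x \<in> K \<Longrightarrow> bounded (f ` (U x \<inter> S))" by metis
  obtain C where C: "C \<subseteq> K" "finite C" "K \<subseteq> (\<Union>x\<in>C. U x)"
    by (rule compactE_image[OF assms(2), of K U]) (use U in auto)
  have "bounded (\<Union>x\<in>C. f ` (U x \<inter> S))" using C U(3) by (intro bounded_UN) auto
  moreover have "f ` K \<subseteq> (\<Union>x\<in>C. f ` (U x \<inter> S))" using C(3) assms(3) by blast
  ultimately have "bounded (f ` K)" by (rule bounded_subset)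
  then show ?thesis using that unfolding bounded_iff by auto
qed

lemma cutoff_product:
  assumes 1: "cutoff S f (\<lambda>z h. gf z \<bullet> h)" and 2: "cutoff I \<tau> (\<lambda>t h. d\<tau> t * h)"
  shows "cutoff (S \<times> I) (\<lambda>y. f (fst y) * \<tau> (snd y))
    (\<lambda>y h. \<tau> (snd y) * (gf (fst y) \<bullet> fst h) + f (fst y) * d\<tau> (snd y) * snd h)"
proof -
  interpret f: cutoff S f "\<lambda>z h. gf z \<bullet> h" by (rule 1)
  interpret \<tau>: cutoff I \<tau> "\<lambda>t h. d\<tau> t * h" by (rule 2)
  show ?thesis
  proof
    show "compact (S \<times> I)" by (intro compact_Times f.compact \<tau>.compact)
    show "((\<lambda>y. f (fst y) * \<tau> (snd y)) has_derivative
      (\<lambda>h. \<tau> (snd y) * (gf (fst y) \<bullet> fst h) + f (fst y) * d\<tau> (snd y) * snd h)) (at y)" for y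
    proof -
      have "((\<lambda>y. f (fst y)) has_derivative (\<lambda>h. gf (fst y) \<bullet> fst h)) (at y)"
        by (rule has_derivative_compose[OF _ f.deriv, of fst]) (auto intro!: derivative_eq_intros)
      moreover have "((\<lambda>y. \<tau> (snd y)) has_derivative (\<lambda>h. d\<tau> (snd y) * snd h)) (at y)"
        by (rule has_derivative_compose[OF _ \<tau>.deriv, of snd]) (auto intro!: derivative_eq_intros)
      ultimately show ?thesis
        by (rule has_derivative_eq_rhs[OF has_derivative_mult]) (simp add: fun_eq_iff algebra_simps)
    qed
    show "continuous_on UNIV (\<lambda>y. \<tau> (snd y) * (gf (fst y) \<bullet> fst b) + f (fst y) * d\<tau> (snd y) * snd b)"
      if b: "b \<in> Basis" for b
    proof -
      have cf: "continuous_on UNIV (\<lambda>y. f (fst y))" and c\<tau>: "continuous_on UNIV (\<lambda>y. \<tau> (snd y))"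
        by (rule continuous_on_compose2[OF f.cont continuous_on_fst[OF continuous_on_id]], simp)
           (rule continuous_on_compose2[OF \<tau>.cont continuous_on_snd[OF continuous_on_id]], simp)
      have "continuous_on UNIV d\<tau>" using \<tau>.deriv_cont[of 1] by simp
      then have cd: "continuous_on UNIV (\<lambda>y. d\<tau> (snd y))"
        by (rule continuous_on_compose2[OF _ continuous_on_snd[OF continuous_on_id]]) simp
      have cg: "continuous_on UNIV (\<lambda>y. gf (fst y) \<bullet> fst b)"
      proof (cases "fst b \<in> Basis")
        case True
        show ?thesis by (rule continuous_on_compose2[OF f.deriv_cont[OF True] continuous_on_fst[OF continuous_on_id]]) simp
      next
        case False
        then have "fst b = 0" using b by (auto simp: Basis_prod_def)
        then show ?thesis by simp
      qed
      show ?thesis by (intro continuous_intros cf c\<tau> cd cg)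
    qed
    show "y \<notin> S \<times> I \<Longrightarrow> f (fst y) * \<tau> (snd y) = 0" for y
      using f.supp \<tau>.supp by (cases y) auto
  qed
qed

text \<open>Almost every time slice of the Borel representative agrees almost everywhere with \<open>u t\<close>, whose \<open>L\<^sup>1\<close> norm is at most \<open>M0\<close>.\<close>

lemma space_time_L1_bound:
  fixes u' :: "'a::euclidean_space \<times> real \<Rightarrow> real" and u :: "real \<Rightarrow> 'a \<Rightarrow> real"
  assumes u': "integrable lborel u'" and ae: "AE y in lborel. y \<in> S \<times> {t1..t2} \<longrightarrow> u' y = u (snd y) (fst y)"
    and nn: "\<And>y. y \<in> S \<times> {t1..t2} \<Longrightarrow> u (snd y) (fst y) \<ge> 0"
    and S[measurable]: "S \<in> sets borel" "S \<subseteq> \<Omega>" "\<Omega> \<in> sets borel" and t: "t1 \<le> t2"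
    and L1: "\<And>t. t \<in> {t1..t2} \<Longrightarrow> integrable (lebesgue_on \<Omega>) (u t)"
      "\<And>t. t \<in> {t1..t2} \<Longrightarrow> (LINT z|lebesgue_on \<Omega>. \<bar>u t z\<bar>) \<le> M0"
  shows "(LINT y|lborel. indicator (S \<times> {t1..t2}) y * u' y) \<le> (t2 - t1) * M0"
proof -
  have M0: "M0 \<ge> 0" using L1(2)[of t1] t by (intro order_trans[OF integral_nonneg_AE L1(2)[of t1]]) auto
  have [measurable]: "u' \<in> borel_measurable borel" using u' by simp
  define f where "f = (\<lambda>y. ennreal (indicator (S \<times> {t1..t2}) y * u' y))"
  have SI: "S \<times> {t1..t2} \<in> sets (borel \<Otimes>\<^sub>M borel)" by measurable
  then have SIb[measurable]: "S \<times> {t1..t2} \<in> sets borel" by (simp only: borel_prod)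
  have fm: "f \<in> borel_measurable (lborel \<Otimes>\<^sub>M lborel)" unfolding f_def lborel_prod by measurable
  \<comment> \<open>The exceptional null set has null slices at almost every time.\<close>
  obtain N where N: "N \<in> sets lborel" "emeasure lborel N = 0"
    "{y \<in> space lborel. \<not> (y \<in> S \<times> {t1..t2} \<longrightarrow> u' y = u (snd y) (fst y))} \<subseteq> N"
    by (rule AE_E[OF ae]) blast
  have "AE t in lborel. (\<integral>\<^sup>+z. indicator N (z, t) \<partial>lborel) = 0"
  proof -
    have Nm: "(indicator N :: 'a \<times> real \<Rightarrow> ennreal) \<in> borel_measurable (lborel \<Otimes>\<^sub>M lborel)"
      using N(1) by (simp add: lborel_prod)
    have "(\<integral>\<^sup>+t. (\<integral>\<^sup>+z. indicator N (z, t) \<partial>lborel) \<partial>lborel) = 0"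
      using lborel_pair.nn_integral_snd[OF Nm] N by (simp add: lborel_prod)
    moreover have "(\<lambda>t. \<integral>\<^sup>+z. indicator N (z, t) \<partial>lborel) \<in> borel_measurable lborel"
      by (rule lborel.borel_measurable_nn_integral)
         (use measurable_compose[OF measurable_pair_swap' Nm] in \<open>simp add: case_prod_beta'\<close>)
    ultimately show ?thesis by (subst (asm) nn_integral_0_iff_AE) auto
  qed
  then have slice: "AE t in lborel. (\<integral>\<^sup>+z. f (z, t) \<partial>lborel) \<le> indicator {t1..t2} t * ennreal M0"
  proof eventually_elim
    fix t assume N0: "(\<integral>\<^sup>+z. indicator N (z, t) \<partial>lborel) = 0"
    show "(\<integral>\<^sup>+z. f (z, t) \<partial>lborel) \<le> indicator {t1..t2} t * ennreal M0"
    proof (cases "t \<in> {t1..t2}")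
      case True
      have Nt: "(\<lambda>z. (z, t)) -` N \<in> sets lborel"
        using measurable_sets[of "\<lambda>z. (z, t)" borel borel N] N(1) by (auto intro!: borel_measurable_continuous_onI continuous_intros)
      have "(\<lambda>z. indicator N (z, t) :: ennreal) = indicator ((\<lambda>z. (z, t)) -` N)" by (auto simp: indicator_def)
      then have "emeasure lborel ((\<lambda>z. (z, t)) -` N) = 0" using N0 Nt by simp
      then have "AE z in lborel. (z, t) \<notin> N" using Nt by (intro AE_I[where N="(\<lambda>z. (z, t)) -` N"]) auto
      then have aez: "AE z in lborel. f (z, t) \<le> ennreal \<bar>u t z\<bar> * indicator \<Omega> z"
      proof eventually_elim
        fix z assume "(z, t) \<notin> N"
        then have "(z, t) \<in> S \<times> {t1..t2} \<longrightarrow> u' (z, t) = u t z"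
          using subsetD[OF N(3), of "(z, t)"] by auto
        then show "f (z, t) \<le> ennreal \<bar>u t z\<bar> * indicator \<Omega> z"
          using S(2) True by (auto simp: f_def indicator_def intro!: ennreal_leI)
      qed
      have "(\<integral>\<^sup>+z. f (z, t) \<partial>lborel) = (\<integral>\<^sup>+z. f (z, t) \<partial>lebesgue)" by (simp add: nn_integral_completion)
      also have "\<dots> \<le> (\<integral>\<^sup>+z. ennreal \<bar>u t z\<bar> * indicator \<Omega> z \<partial>lebesgue)"
        by (rule nn_integral_mono_AE[OF AE_completion[OF aez]])
      also have "\<dots> = (\<integral>\<^sup>+z. ennreal \<bar>u t z\<bar> \<partial>lebesgue_on \<Omega>)"
        using S(3) by (subst nn_integral_restrict_space) auto
      also have "\<dots> = ennreal (LINT z|lebesgue_on \<Omega>. \<bar>u t z\<bar>)"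
        using L1(1)[OF True] by (intro nn_integral_eq_integral) auto
      also have "\<dots> \<le> ennreal M0" by (intro ennreal_leI L1(2) True)
      finally show ?thesis using True by simp
    next
      case False
      then show ?thesis by (simp add: f_def)
    qed
  qed
  have "(\<integral>\<^sup>+y. f y \<partial>lborel) = (\<integral>\<^sup>+t. (\<integral>\<^sup>+z. f (z, t) \<partial>lborel) \<partial>lborel)"
    using lborel_pair.nn_integral_snd[OF fm] by (simp add: lborel_prod)
  also have "\<dots> \<le> (\<integral>\<^sup>+t. indicator {t1..t2} t * ennreal M0 \<partial>lborel)" by (rule nn_integral_mono_AE[OF slice])
  also have "\<dots> = ennreal ((t2 - t1) * M0)"
    using t M0 by (simp add: nn_integral_multc ennreal_mult)
  finally have le: "(\<integral>\<^sup>+y. f y \<partial>lborel) \<le> ennreal ((t2 - t1) * M0)" .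
  have "integrable lborel (\<lambda>y. indicator (S \<times> {t1..t2}) y *\<^sub>R u' y)"
    by (rule integrable_mult_indicator[OF _ u']) simp
  then have i: "integrable lborel (\<lambda>y. indicator (S \<times> {t1..t2}) y * u' y)" by simp
  have "AE y in lborel. 0 \<le> indicator (S \<times> {t1..t2}) y * u' y"
    using ae by eventually_elim (use nn in \<open>auto simp: indicator_def\<close>)
  then have "ennreal (LINT y|lborel. indicator (S \<times> {t1..t2}) y * u' y) = (\<integral>\<^sup>+y. f y \<partial>lborel)"
    unfolding f_def by (rule nn_integral_eq_integral[OF i, symmetric])
  then have "ennreal (LINT y|lborel. indicator (S \<times> {t1..t2}) y * u' y) \<le> ennreal ((t2 - t1) * M0)" using le by simp
  then show ?thesis by (subst (asm) ennreal_le_iff) (use t M0 in auto)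
qed

lemma integral_product_split:
  fixes f :: "'a::euclidean_space \<Rightarrow> real" and \<tau> :: "real \<Rightarrow> real"
  assumes f: "integrable lborel f" and \<tau>: "integrable lborel \<tau>"
  shows "integrable lborel (\<lambda>y. \<tau> (snd y) * f (fst y))"
    and "(LINT y|lborel. \<tau> (snd y) * f (fst y)) = (LINT t|lborel. \<tau> t) * (LINT z|lborel. f z)"
proof -
  have [measurable]: "f \<in> borel_measurable borel" "\<tau> \<in> borel_measurable borel" using assms by simp_all
  have m: "(\<lambda>y. \<tau> (snd y) * f (fst y)) \<in> borel_measurable (lborel \<Otimes>\<^sub>M lborel)" by measurable
  have i: "integrable (lborel \<Otimes>\<^sub>M lborel) (\<lambda>y. \<tau> (snd y) * f (fst y))"
    by (rule lborel_pair.Fubini_integrable[OF m]) (use assms in \<open>auto simp: abs_mult\<close>)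
  then show "integrable lborel (\<lambda>y. \<tau> (snd y) * f (fst y))" by (simp add: lborel_prod)
  have "(LINT y|(lborel \<Otimes>\<^sub>M lborel). \<tau> (snd y) * f (fst y)) = (LINT z|lborel. (LINT t|lborel. \<tau> t * f z))"
    using lborel_pair.integral_fst'[OF i] by simp
  then show "(LINT y|lborel. \<tau> (snd y) * f (fst y)) = (LINT t|lborel. \<tau> t) * (LINT z|lborel. f z)"
    by (simp add: lborel_prod)
qed

section \<open>Inequalities for powers and the Euclidean form of the weak gradient\<close>

lemma young_powr:
  fixes a b p :: real
  assumes "a \<ge> 0" "b \<ge> 0" "p > 1"
  shows "p * a powr (p - 1) * b \<le> (p - 1) * a powr p + b powr p"
proof -
  have "a powr (p - 1) * b \<le> (a powr (p - 1)) powr (p / (p - 1)) / (p / (p - 1)) + b powr p / p"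
    by (rule Youngs_inequality) (use assms in \<open>auto simp: field_simps\<close>)
  also have "(a powr (p - 1)) powr (p / (p - 1)) = a powr p" using assms by (simp add: powr_powr)
  finally have "p * (a powr (p - 1) * b) \<le> p * (a powr p / (p / (p - 1)) + b powr p / p)"
    by (rule mult_left_mono) (use assms in simp)
  also have "\<dots> = (p - 1) * a powr p + b powr p" using assms by (simp add: field_simps)
  finally show ?thesis by (simp only: mult.assoc)
qed

lemma powr_le_one_add: "0 \<le> (x::real) \<Longrightarrow> 0 \<le> r \<Longrightarrow> r \<le> 1 \<Longrightarrow> x powr r \<le> 1 + x"
proof -
  assume a: "0 \<le> x" "0 \<le> r" "r \<le> 1"
  show ?thesis
  proof (cases "x \<le> 1")
    case True
    have "x powr r \<le> 1 powr r" using a True by (intro powr_mono2) auto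
    then show ?thesis using a by simp
  next
    case False
    then have "x powr r \<le> x powr 1" using a by (intro powr_mono) auto
    then show ?thesis using a False by simp
  qed
qed

text \<open>The larger of the two numbers dominates the mixed product.\<close>

lemma powr_mixed_le:
  assumes "(a::real) \<ge> 0" "b \<ge> 0" "p > 1"
  shows "a powr (p - 1) * b \<le> a powr p + b powr p"
proof (cases "a \<le> b")
  case True
  have "a powr (p - 1) * b \<le> b powr (p - 1) * b"
    using assms True by (intro mult_right_mono powr_mono2) auto
  also have "\<dots> = b powr p" using assms by (cases "b = 0") (auto simp: powr_diff)
  finally show ?thesis by (simp add: add_increasing)
next
  case False
  then have "a powr (p - 1) * b \<le> a powr (p - 1) * a" using assms by (intro mult_left_mono) auto
  also have "\<dots> = a powr p" using assms False by (simp add: powr_diff)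
  finally show ?thesis by (simp add: add_increasing2)
qed

lemma horizontal_inner: "horizontal \<gamma> z v \<bullet> w = v \<bullet> horizontal \<gamma> z w"
  by (simp add: horizontal_def inner_prod_def)

lemma norm_horizontal_le: "norm (horizontal \<gamma> z v) \<le> (1 + \<bar>rpow (norm (fst z)) \<gamma>\<bar>) * norm v"
proof -
  have "norm (horizontal \<gamma> z v) \<le> norm (fst v) + \<bar>rpow (norm (fst z)) \<gamma>\<bar> * norm (snd v)"
    unfolding horizontal_def by (rule order_trans[OF norm_Pair_le]) simp
  also have "\<dots> \<le> norm v + \<bar>rpow (norm (fst z)) \<gamma>\<bar> * norm v"
    by (intro add_mono mult_left_mono) (metis norm_fst_le prod.collapse, metis norm_snd_le prod.collapse, simp)
  finally show ?thesis by (simp add: algebra_simps)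
qed

lemma grushin_grad_slice:
  fixes \<phi> :: "('m::finite, 'k::finite) pt \<times> real \<Rightarrow> real"
  assumes d: "\<And>y. \<phi> differentiable (at y)"
  shows "grushin_grad \<gamma> (\<lambda>z'. \<phi> (z', t)) z = horizontal \<gamma> z (\<Sum>e\<in>Basis. frechet_derivative \<phi> (at (z, t)) (e, 0) *\<^sub>R e)"
    and "deriv (\<lambda>s. \<phi> (z, s)) t = frechet_derivative \<phi> (at (z, t)) (0, 1)"
proof -
  let ?d = "frechet_derivative \<phi> (at (z, t))"
  have der: "(\<phi> has_derivative ?d) (at (z, t))" using d by (simp add: frechet_derivative_works)
  have "((\<lambda>z'. \<phi> (z', t)) has_derivative (\<lambda>h. ?d (h, 0))) (at z)"
    by (rule has_derivative_compose[where f="\<lambda>z'. (z', t)" and g=\<phi> and x=z and g'="?d"])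
       (use der in \<open>auto intro!: derivative_eq_intros\<close>)
  then have fd: "frechet_derivative (\<lambda>z'. \<phi> (z', t)) (at z) = (\<lambda>h. ?d (h, 0))"
    using frechet_derivative_at by metis
  let ?g = "\<Sum>e\<in>Basis. ?d (e, 0) *\<^sub>R e :: ('m, 'k) pt"
  have comp: "?g \<bullet> e = ?d (e, 0)" if "e \<in> Basis" for e
    using that by (simp add: inner_sum_left_Basis)
  have b1: "(axis i (1::real), 0) \<in> (Basis :: ('m, 'k) pt set)" for i :: 'm
    by (auto simp: Basis_prod_def Basis_vec_def)
  have b2: "(0, axis j (1::real)) \<in> (Basis :: ('m, 'k) pt set)" for j :: 'k
    by (auto simp: Basis_prod_def Basis_vec_def)
  have "fst ?g $ i = ?d ((axis i 1, 0), 0)" for i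
    using comp[OF b1[of i]] by (simp add: inner_prod_def inner_axis)
  moreover have "snd ?g $ j = ?d ((0, axis j 1), 0)" for j
    using comp[OF b2[of j]] by (simp add: inner_prod_def inner_axis)
  ultimately show "grushin_grad \<gamma> (\<lambda>z'. \<phi> (z', t)) z = horizontal \<gamma> z ?g"
    by (simp add: grushin_grad_def horizontal_def X_field_def Y_field_def fd vec_eq_iff)
  have "((\<lambda>s. \<phi> (z, s)) has_derivative (\<lambda>h. ?d (0, h))) (at t)"
    by (rule has_derivative_compose[where f="\<lambda>s. (z, s)" and g=\<phi> and x=t and g'="?d"])
       (use der in \<open>auto intro!: derivative_eq_intros\<close>)
  moreover have "(\<lambda>h. ?d (0, h)) = (*) (?d (0, 1))"
  proof
    fix h :: real
    show "?d (0, h) = ?d (0, 1) * h"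
    using linear_cmul[OF has_derivative_linear[OF der], of h "(0, 1)"] by (simp add: mult.commute)
  qed
  ultimately have "((\<lambda>s. \<phi> (z, s)) has_real_derivative ?d (0, 1)) (at t)"
    by (simp only: has_field_derivative_def)
  then show "deriv (\<lambda>s. \<phi> (z, s)) t = ?d (0, 1)" by (rule DERIV_imp_deriv)
qed

lemma test_function_ball:
  fixes \<phi> :: "'a::euclidean_space \<Rightarrow> real"
  assumes "\<And>n. C_k n \<phi>" "\<And>y. y \<notin> cball z d \<Longrightarrow> \<phi> y = 0" "cball z d \<subseteq> U"
  shows "test_function U \<phi>" "closure {y. \<phi> y \<noteq> 0} \<subseteq> cball z d"
    "\<And>y h. y \<notin> cball z d \<Longrightarrow> frechet_derivative \<phi> (at y) h = 0"
proof -
  show c: "closure {y. \<phi> y \<noteq> 0} \<subseteq> cball z d"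
    by (rule closure_minimal) (use assms(2) in blast, simp)
  have "compact (closure {y. \<phi> y \<noteq> 0})"
    using c bounded_subset[OF bounded_cball] by (simp add: compact_eq_bounded_closed)
  then show "test_function U \<phi>" using assms c unfolding test_function_def by blast
  show "frechet_derivative \<phi> (at y) h = 0" if y: "y \<notin> cball z d" for y h
  proof -
    have o: "open (- cball z d)" by (intro open_Compl closed_cball)
    have "((\<lambda>y. 0 :: real) has_derivative (\<lambda>h. 0)) (at y)" by simp
    from has_derivative_transform_within_open[OF this o, of \<phi>] y assms(2)
    have "(\<phi> has_derivative (\<lambda>h. 0)) (at y)" by auto
    then show ?thesis using frechet_derivative_at by metis
  qed
qed

text \<open>On a set avoiding \<open>x = 0\<close> the weak Grushin gradient \<open>(G\<^sub>x, G\<^sub>y)\<close> gives the Euclidean weak gradient \<open>(G\<^sub>x, |x|\<^sup>-\<^sup>\<gamma> G\<^sub>y)\<close>. For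
  the \<open>y\<close>-components the equation is tested with \<open>|x|\<^sup>-\<^sup>\<gamma> \<phi>\<close>, which is smooth because \<open>\<phi>\<close> vanishes near \<open>x = 0\<close>, and whose
  \<open>y\<close>-derivatives only see \<open>\<phi>\<close> because \<open>|x|\<close> does not depend on \<open>y\<close>.\<close>

lemma weak_gradient_euclidean:
  fixes u :: "real \<Rightarrow> ('m::finite, 'k::finite) pt \<Rightarrow> real" and G G0 :: "('m, 'k) pt \<times> real \<Rightarrow> ('m, 'k) pt"
    and u0 \<phi> :: "('m, 'k) pt \<times> real \<Rightarrow> real"
  assumes \<gamma>: "\<gamma> \<ge> 0" and \<Omega>: "open \<Omega>" and weak: "weak_grushin_grad \<gamma> \<Omega> T u G"
    and K: "K \<subseteq> \<Omega> \<times> {0<..<T}" "\<And>y. y \<in> K \<Longrightarrow> fst (fst y) \<noteq> 0"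
    and u0: "integrable lborel u0" "AE y in lborel. y \<in> K \<longrightarrow> u0 y = u (snd y) (fst y)" "\<And>y. y \<notin> K \<Longrightarrow> u0 y = 0"
    and G0: "integrable lborel G0" "AE y in lborel. y \<in> K \<longrightarrow> G0 y = G y" "\<And>y. y \<notin> K \<Longrightarrow> G0 y = 0"
    and \<phi>: "\<And>n. C_k n \<phi>" "\<And>y. y \<notin> cball z d \<Longrightarrow> \<phi> y = 0" and zK: "cball z d \<subseteq> K" and e: "e \<in> Basis"
  shows "(LINT y|lborel. u0 y * frechet_derivative \<phi> (at y) (e, 0))
    = - (LINT y|lborel. \<phi> y * ((fst (G0 y), (1 / rpow (norm (fst (fst y))) \<gamma>) *\<^sub>R snd (G0 y)) \<bullet> e))"
proof -
  let ?U = "\<Omega> \<times> {0<..<T}"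
  have Ub: "?U \<in> sets borel" using \<Omega> by (intro borel_open open_Times) auto
  \<comment> \<open>One component of the vector identity; the factor \<open>rp\<close> is the weight of the field belonging to \<open>e\<close>.\<close>
  have main: "(LINT y|lborel. u0 y * (rp y * frechet_derivative \<phi> (at y) (e, 0))) = - (LINT y|lborel. \<phi> y * (G0 y \<bullet> e))"
    if \<phi>: "\<And>n. C_k n \<phi>" "\<And>y. y \<notin> cball z d \<Longrightarrow> \<phi> y = 0" and e: "e \<in> Basis"
      and rp: "\<And>y. rp y = (if snd e = 0 then 1 else rpow (norm (fst (fst y))) \<gamma>)"
    for \<phi> e and rp :: "('m, 'k) pt \<times> real \<Rightarrow> real"
  proof -
    have tf: "test_function ?U \<phi>" "\<And>y h. y \<notin> cball z d \<Longrightarrow> frechet_derivative \<phi> (at y) h = 0"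
      using test_function_ball[of \<phi> z d ?U] \<phi> order_trans[OF zK K(1)] by blast+
    let ?g = "\<lambda>y. \<Sum>e\<in>Basis. frechet_derivative \<phi> (at y) (e, 0) *\<^sub>R e :: ('m, 'k) pt"
    let ?h = "\<lambda>y. horizontal \<gamma> (fst y) (?g y)"
    have dphi: "\<phi> differentiable (at y)" for y
      using C_k_has_derivative[OF \<phi>(1)[of "Suc 0"]] differentiable_def by blast
    have cdphi: "continuous_on UNIV (\<lambda>y. frechet_derivative \<phi> (at y) (e, 0))" if "e \<in> Basis" for e :: "('m, 'k) pt"
    proof -
      have "(e, 0) \<in> (Basis :: (('m, 'k) pt \<times> real) set)" using that by (auto simp: Basis_prod_def)
      then show ?thesis using \<phi>(1)[of "Suc 0"] by simp
    qed
    have c\<phi>: "continuous_on UNIV \<phi>" using \<phi>(1)[of 0] by simp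
    have crp: "continuous_on UNIV (\<lambda>y::('m, 'k) pt \<times> real. rpow (norm (fst (fst y))) \<gamma>)"
      by (intro continuous_rpow_norm \<gamma> continuous_intros)
    have cg: "continuous_on UNIV ?g" by (intro continuous_intros cdphi)
    have ch: "continuous_on UNIV ?h"
      unfolding horizontal_def by (intro continuous_intros crp cg)
    have h0: "?h y = 0" if "y \<notin> cball z d" for y 
    proof -
      have "?g y = 0" by (rule sum.neutral) (simp add: tf(2)[OF that])
      then show ?thesis by (simp only: horizontal_def fst_zero snd_zero scaleR_zero_right zero_prod_def[symmetric])
    qed
    have ih: "integrable lborel (\<lambda>y. u0 y * (?h y \<bullet> b))" for b
      by (rule integrable_times_continuous_compact[OF u0(1) _ bounded_cball[of z d]])
         (use h0 in \<open>auto intro!: continuous_intros ch\<close>)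
    have ihv: "integrable lborel (\<lambda>y. u0 y *\<^sub>R ?h y)"
    proof -
      have "integrable lborel (\<lambda>y. \<Sum>b\<in>Basis. (u0 y * (?h y \<bullet> b)) *\<^sub>R b)"
        by (intro Bochner_Integration.integrable_sum integrable_scaleR_left ih)
      moreover have "(\<Sum>b\<in>Basis. (u0 y * (?h y \<bullet> b)) *\<^sub>R b) = u0 y *\<^sub>R ?h y" for y
        using euclidean_representation[of "u0 y *\<^sub>R ?h y"] by simp
      ultimately show ?thesis by simp
    qed
    have iGv: "integrable lborel (\<lambda>y. \<phi> y *\<^sub>R G0 y)"
    proof -
      have "integrable lborel (\<lambda>y. \<Sum>b\<in>Basis. ((G0 y \<bullet> b) * \<phi> y) *\<^sub>R b)"
        by (intro Bochner_Integration.integrable_sum integrable_scaleR_left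
            integrable_times_continuous_compact[OF _ c\<phi> bounded_cball[of z d] \<phi>(2)] integrable_inner_left G0(1)) 
      moreover have "(\<Sum>b\<in>Basis. ((G0 y \<bullet> b) * \<phi> y) *\<^sub>R b) = \<phi> y *\<^sub>R G0 y" for y
        using euclidean_representation[of "\<phi> y *\<^sub>R G0 y"] by (simp add: mult.commute)
      ultimately show ?thesis by simp
    qed
    have "(LINT (z, t)|lebesgue_on ?U. u t z *\<^sub>R grushin_grad \<gamma> (\<lambda>z'. \<phi> (z', t)) z)
        = - (LINT (z, t)|lebesgue_on ?U. \<phi> (z, t) *\<^sub>R G (z, t))"
      using weak tf(1) unfolding weak_grushin_grad_def by blast
    moreover have "(LINT (z, t)|lebesgue_on ?U. u t z *\<^sub>R grushin_grad \<gamma> (\<lambda>z'. \<phi> (z', t)) z)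
        = (LINT y|lborel. u0 y *\<^sub>R ?h y)"
    proof (rule lebesgue_on_transfer[OF _ Ub])
      show "(\<lambda>y. u0 y *\<^sub>R ?h y) \<in> borel_measurable borel" using ihv by simp
      show "AE y in lborel. y \<in> ?U \<longrightarrow> (case y of (z, t) \<Rightarrow> u t z *\<^sub>R grushin_grad \<gamma> (\<lambda>z'. \<phi> (z', t)) z) = u0 y *\<^sub>R ?h y"
        using u0(2)
      proof eventually_elim
        fix y assume y: "y \<in> K \<longrightarrow> u0 y = u (snd y) (fst y)"
        have "(case y of (z, t) \<Rightarrow> u t z *\<^sub>R grushin_grad \<gamma> (\<lambda>z'. \<phi> (z', t)) z) = u (snd y) (fst y) *\<^sub>R ?h y"
          by (cases y) (simp add: grushin_grad_slice(1)[OF dphi])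
        then show "y \<in> ?U \<longrightarrow> (case y of (z, t) \<Rightarrow> u t z *\<^sub>R grushin_grad \<gamma> (\<lambda>z'. \<phi> (z', t)) z) = u0 y *\<^sub>R ?h y"
          using y h0[of y] zK by (cases "y \<in> cball z d") auto
      qed
      show "y \<notin> ?U \<Longrightarrow> u0 y *\<^sub>R ?h y = 0" for y using u0(3)[of y] K(1) by auto
    qed
    moreover have "(LINT (z, t)|lebesgue_on ?U. \<phi> (z, t) *\<^sub>R G (z, t)) = (LINT y|lborel. \<phi> y *\<^sub>R G0 y)"
    proof (rule lebesgue_on_transfer[OF _ Ub])
      show "(\<lambda>y. \<phi> y *\<^sub>R G0 y) \<in> borel_measurable borel" using iGv by simp
      show "AE y in lborel. y \<in> ?U \<longrightarrow> (case y of (z, t) \<Rightarrow> \<phi> (z, t) *\<^sub>R G (z, t)) = \<phi> y *\<^sub>R G0 y"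
        using G0(2)
      proof eventually_elim
        fix y assume y: "y \<in> K \<longrightarrow> G0 y = G y"
        then show "y \<in> ?U \<longrightarrow> (case y of (z, t) \<Rightarrow> \<phi> (z, t) *\<^sub>R G (z, t)) = \<phi> y *\<^sub>R G0 y"
          using \<phi>(2)[of y] zK by (cases "y \<in> cball z d") (auto simp: case_prod_beta)
      qed
      show "y \<notin> ?U \<Longrightarrow> \<phi> y *\<^sub>R G0 y = 0" for y using G0(3)[of y] K(1) by auto
    qed
    ultimately have "(LINT y|lborel. u0 y *\<^sub>R ?h y) \<bullet> e = (- (LINT y|lborel. \<phi> y *\<^sub>R G0 y)) \<bullet> e" by simp
    moreover have "(LINT y|lborel. u0 y *\<^sub>R ?h y) \<bullet> e = (LINT y|lborel. u0 y * (?h y \<bullet> e))"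
      using ihv by (simp flip: integral_inner_left)
    moreover have "(LINT y|lborel. \<phi> y *\<^sub>R G0 y) \<bullet> e = (LINT y|lborel. \<phi> y * (G0 y \<bullet> e))"
      using iGv by (simp flip: integral_inner_left)
    moreover have "?h y \<bullet> e = rp y * frechet_derivative \<phi> (at y) (e, 0)" for y
    proof -
      have "horizontal \<gamma> (fst y) e = rp y *\<^sub>R e"
        using e unfolding rp by (auto simp: horizontal_def Basis_prod_def nonzero_Basis)
      moreover have "?g y \<bullet> e = frechet_derivative \<phi> (at y) (e, 0)" using e by (simp add: inner_sum_left_Basis)
      ultimately show ?thesis unfolding horizontal_inner by simp
    qed
    ultimately show ?thesis by simp
  qed
  show ?thesis
  proof (cases "snd e = 0")
    case True
    have "(fst (G0 y), (1 / rpow (norm (fst (fst y))) \<gamma>) *\<^sub>R snd (G0 y)) \<bullet> e = G0 y \<bullet> e" for y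
      using True by (simp add: inner_prod_def)
    then show ?thesis using main[OF \<phi> e, of "\<lambda>_. 1"] True by simp
  next
    case False
    then have fe: "fst e = 0" using e by (auto simp: Basis_prod_def)
    define X where "X = (\<lambda>y::('m, 'k) pt \<times> real. fst (fst y) \<bullet> fst (fst y))"
    define \<phi>1 where "\<phi>1 = (\<lambda>y. X y powr (- \<gamma> / 2) * \<phi> y)"
    have X: "C_k n X" for n
    proof -
      have "C_k n (\<lambda>y::('m, 'k) pt \<times> real. \<Sum>i\<in>Basis. (fst (fst y) \<bullet> i) * (fst (fst y) \<bullet> i))"
      proof -
        have "C_k n (\<lambda>y::('m, 'k) pt \<times> real. \<Sum>i\<in>I. (fst (fst y) \<bullet> i) * (fst (fst y) \<bullet> i))" if "finite I" for I
          using that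
        proof induction
          case empty then show ?case using C_k_const[of n 0] by simp
        next
          case (insert i I)
          have "C_k n (\<lambda>y::('m, 'k) pt \<times> real. fst (fst y) \<bullet> i)"
            by (intro C_k_bounded_linear bounded_linear_intros)
          then show ?case using insert by (simp add: C_k_add C_k_mult)
        qed
        then show ?thesis by simp
      qed
      moreover have "X y = (\<Sum>i\<in>Basis. (fst (fst y) \<bullet> i) * (fst (fst y) \<bullet> i))" for y
        unfolding X_def by (rule euclidean_inner)
      ultimately show ?thesis by presburger
    qed
    have Xpos: "X y > 0" if "y \<in> K" for y using K(2)[OF that] by (simp add: X_def)
    have cl: "closure {y. \<phi> y \<noteq> 0} \<subseteq> cball z d"
      using test_function_ball(2)[of \<phi> z d K] \<phi> zK by blast
    have \<phi>1: "C_k n \<phi>1" for n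
      unfolding \<phi>1_def by (rule C_k_powr_mult[OF X \<phi>(1)]) (use cl zK Xpos in blast)
    have \<phi>10: "\<phi>1 y = 0" if "y \<notin> cball z d" for y using \<phi>(2)[OF that] by (simp add: \<phi>1_def)
    have rX: "X y powr (- \<gamma> / 2) = 1 / rpow (norm (fst (fst y))) \<gamma>" if "X y > 0" for y
    proof -
      have n0: "norm (fst (fst y)) > 0" using that by (auto simp: X_def)
      have "X y powr (- \<gamma> / 2) = norm (fst (fst y)) powr (- \<gamma>)"
        by (simp add: X_def norm_eq_sqrt_inner powr_half_sqrt[symmetric] powr_powr)
      then show ?thesis using n0 by (simp add: rpow_eq powr_minus_divide)
    qed
    have d1: "rpow (norm (fst (fst y))) \<gamma> * frechet_derivative \<phi>1 (at y) (e, 0) = frechet_derivative \<phi> (at y) (e, 0)" if "y \<in> K" for y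
    proof -
      let ?c = "X y powr (- \<gamma> / 2)"
      have "((\<lambda>s. \<phi>1 (y + s *\<^sub>R (e, 0))) has_derivative (\<lambda>h. frechet_derivative \<phi>1 (at (y + 0 *\<^sub>R (e, 0))) (h *\<^sub>R (e, 0)))) (at 0)"
        by (rule has_derivative_compose[OF _ C_k_has_derivative[OF \<phi>1[of "Suc 0"]], of "\<lambda>s. y + s *\<^sub>R (e, 0)"])
           (auto intro!: derivative_eq_intros)
      moreover have "((\<lambda>s. \<phi> (y + s *\<^sub>R (e, 0))) has_derivative (\<lambda>h. frechet_derivative \<phi> (at (y + 0 *\<^sub>R (e, 0))) (h *\<^sub>R (e, 0)))) (at 0)"
        by (rule has_derivative_compose[OF _ C_k_has_derivative[OF \<phi>(1)[of "Suc 0"]], of "\<lambda>s. y + s *\<^sub>R (e, 0)"])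
           (auto intro!: derivative_eq_intros)
      then have "((\<lambda>s. ?c * \<phi> (y + s *\<^sub>R (e, 0))) has_derivative (\<lambda>h. ?c * frechet_derivative \<phi> (at (y + 0 *\<^sub>R (e, 0))) (h *\<^sub>R (e, 0)))) (at 0)"
        by (rule has_derivative_mult_right)
      moreover have "(\<lambda>s. \<phi>1 (y + s *\<^sub>R (e, 0))) = (\<lambda>s. ?c * \<phi> (y + s *\<^sub>R (e, 0)))"
        by (simp add: \<phi>1_def X_def fe)
      ultimately have "(\<lambda>h. frechet_derivative \<phi>1 (at (y + 0 *\<^sub>R (e, 0))) (h *\<^sub>R (e, 0)))
          = (\<lambda>h. ?c * frechet_derivative \<phi> (at (y + 0 *\<^sub>R (e, 0))) (h *\<^sub>R (e, 0)))"
        using has_derivative_unique by metis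
      from fun_cong[OF this, of 1] have "frechet_derivative \<phi>1 (at y) (e, 0) = ?c * frechet_derivative \<phi> (at y) (e, 0)"
        by (simp only: scaleR_one scaleR_zero_left add_0_right)
      moreover have "rpow (norm (fst (fst y))) \<gamma> > 0" using K(2)[OF that] by (intro rpow_pos) simp
      ultimately show ?thesis using rX[OF Xpos[OF that]] by simp
    qed
    have "(LINT y|lborel. u0 y * frechet_derivative \<phi> (at y) (e, 0))
        = (LINT y|lborel. u0 y * (rpow (norm (fst (fst y))) \<gamma> * frechet_derivative \<phi>1 (at y) (e, 0)))"
    proof (rule Bochner_Integration.integral_cong)
      show "u0 y * frechet_derivative \<phi> (at y) (e, 0) = u0 y * (rpow (norm (fst (fst y))) \<gamma> * frechet_derivative \<phi>1 (at y) (e, 0))" for y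
        using d1[of y] u0(3)[of y] by (cases "y \<in> K") auto
    qed simp
    also have "\<dots> = - (LINT y|lborel. \<phi>1 y * (G0 y \<bullet> e))"
      by (rule main[OF \<phi>1 \<phi>10 e]) (simp_all add: False)
    also have "(LINT y|lborel. \<phi>1 y * (G0 y \<bullet> e)) = (LINT y|lborel. \<phi> y * ((fst (G0 y), (1 / rpow (norm (fst (fst y))) \<gamma>) *\<^sub>R snd (G0 y)) \<bullet> e))"
    proof (rule Bochner_Integration.integral_cong)
      show "\<phi>1 y * (G0 y \<bullet> e) = \<phi> y * ((fst (G0 y), (1 / rpow (norm (fst (fst y))) \<gamma>) *\<^sub>R snd (G0 y)) \<bullet> e)" for y
      proof (cases "y \<in> K")
        case True
        show ?thesis using rX[OF Xpos[OF True]] fe by (simp add: \<phi>1_def inner_prod_def)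
      next
        case False
        show ?thesis
          unfolding G0(3)[OF False] fst_zero snd_zero scaleR_zero_right zero_prod_def[symmetric] inner_zero_left by simp
      qed
    qed simp
    finally show ?thesis .
  qed
qed

section \<open>The Euclidean form of the equation and the Picone inequality\<close>

text \<open>Since \<open>horizontal\<close> is symmetric, the Grushin flux \<open>Fl\<close> tested with a Grushin gradient is the Euclidean flux
  \<open>H = horizontal Fl\<close> tested with a Euclidean gradient.\<close>

lemma evolution_euclidean:
  fixes u :: "real \<Rightarrow> ('m::finite, 'k::finite) pt \<Rightarrow> real" and Fl :: "('m, 'k) pt \<times> real \<Rightarrow> ('m, 'k) pt"
    and H :: "('m, 'k) pt \<times> real \<Rightarrow> ('m, 'k) pt" and u0 g g0 \<phi> :: "('m, 'k) pt \<times> real \<Rightarrow> real"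
  assumes \<Omega>: "open \<Omega>" and evol: "distributional_evolution \<gamma> \<Omega> T u Fl g"
    and K: "K \<subseteq> \<Omega> \<times> {0<..<T}"
    and u0: "integrable lborel u0" "AE y in lborel. y \<in> K \<longrightarrow> u0 y = u (snd y) (fst y)" "\<And>y. y \<notin> K \<Longrightarrow> u0 y = 0"
    and H: "integrable lborel H" "AE y in lborel. y \<in> K \<longrightarrow> H y = horizontal \<gamma> (fst y) (Fl y)" "\<And>y. y \<notin> K \<Longrightarrow> H y = 0"
    and g0: "integrable lborel g0" "AE y in lborel. y \<in> K \<longrightarrow> g0 y = g y" "\<And>y. y \<notin> K \<Longrightarrow> g0 y = 0"
    and \<phi>: "\<And>n. C_k n \<phi>" "\<And>y. y \<notin> cball z d \<Longrightarrow> \<phi> y = 0" and zK: "cball z d \<subseteq> K"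
  shows "(LINT y|lborel. (\<Sum>e\<in>Basis. (H y \<bullet> e) * frechet_derivative \<phi> (at y) (e, 0)) - u0 y * frechet_derivative \<phi> (at y) (0, 1))
    = (LINT y|lborel. g0 y * \<phi> y)"
proof -
  let ?U = "\<Omega> \<times> {0<..<T}"
  have Ub: "?U \<in> sets borel" using \<Omega> by (intro borel_open open_Times) auto
  have tf: "test_function ?U \<phi>" "\<And>y h. y \<notin> cball z d \<Longrightarrow> frechet_derivative \<phi> (at y) h = 0"
    using test_function_ball[of \<phi> z d ?U] \<phi> order_trans[OF zK K] by blast+
  let ?g = "\<lambda>y. \<Sum>e\<in>Basis. frechet_derivative \<phi> (at y) (e, 0) *\<^sub>R e :: ('m, 'k) pt"
  let ?S = "\<lambda>y. \<Sum>e\<in>Basis. (H y \<bullet> e) * frechet_derivative \<phi> (at y) (e, 0)"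
  have dphi: "\<phi> differentiable (at y)" for y
    using C_k_has_derivative[OF \<phi>(1)[of "Suc 0"]] differentiable_def by blast
  have cd: "continuous_on UNIV (\<lambda>y. frechet_derivative \<phi> (at y) b)" if "b \<in> Basis" for b
    using \<phi>(1)[of "Suc 0"] that by simp
  have b1: "(e, 0) \<in> (Basis :: (('m, 'k) pt \<times> real) set)" if "e \<in> Basis" for e :: "('m, 'k) pt"
    using that by (auto simp: Basis_prod_def)
  have b2: "(0, 1) \<in> (Basis :: (('m, 'k) pt \<times> real) set)" by (auto simp: Basis_prod_def)
  have c\<phi>: "continuous_on UNIV \<phi>" using \<phi>(1)[of 0] by simp
  have iS: "integrable lborel ?S"
  proof (rule Bochner_Integration.integrable_sum)
    fix e :: "('m, 'k) pt" assume e: "e \<in> Basis"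
    have "integrable lborel (\<lambda>y. H y \<bullet> e)" using H(1) by simp
    then show "integrable lborel (\<lambda>y. (H y \<bullet> e) * frechet_derivative \<phi> (at y) (e, 0))"
      by (rule integrable_times_continuous_compact[OF _ cd[OF b1[OF e]] bounded_cball[of z d]]) (rule tf(2))
  qed
  have iu: "integrable lborel (\<lambda>y. u0 y * frechet_derivative \<phi> (at y) (0, 1))"
    by (rule integrable_times_continuous_compact[OF u0(1) cd[OF b2] bounded_cball[of z d]]) (rule tf(2))
  have ig: "integrable lborel (\<lambda>y. g0 y * \<phi> y)"
    by (rule integrable_times_continuous_compact[OF g0(1) c\<phi> bounded_cball[of z d]]) (rule \<phi>(2))
  have "- (LINT (z, t)|lebesgue_on ?U. u t z * deriv (\<lambda>s. \<phi> (z, s)) t) =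
       - (LINT (z, t)|lebesgue_on ?U. Fl (z, t) \<bullet> grushin_grad \<gamma> (\<lambda>z'. \<phi> (z', t)) z)
       + (LINT (z, t)|lebesgue_on ?U. g (z, t) * \<phi> (z, t))"
    using evol tf(1) unfolding distributional_evolution_def by blast
  moreover have "(LINT (z, t)|lebesgue_on ?U. u t z * deriv (\<lambda>s. \<phi> (z, s)) t) = (LINT y|lborel. u0 y * frechet_derivative \<phi> (at y) (0, 1))"
  proof (rule lebesgue_on_transfer[OF _ Ub])
    show "(\<lambda>y. u0 y * frechet_derivative \<phi> (at y) (0, 1)) \<in> borel_measurable borel" using iu by simp
    show "AE y in lborel. y \<in> ?U \<longrightarrow> (case y of (z, t) \<Rightarrow> u t z * deriv (\<lambda>s. \<phi> (z, s)) t) = u0 y * frechet_derivative \<phi> (at y) (0, 1)"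
      using u0(2)
    proof eventually_elim
      fix y assume y: "y \<in> K \<longrightarrow> u0 y = u (snd y) (fst y)"
      have "(case y of (z, t) \<Rightarrow> u t z * deriv (\<lambda>s. \<phi> (z, s)) t) = u (snd y) (fst y) * frechet_derivative \<phi> (at y) (0, 1)"
        by (cases y) (simp add: grushin_grad_slice(2)[OF dphi])
      then show "y \<in> ?U \<longrightarrow> (case y of (z, t) \<Rightarrow> u t z * deriv (\<lambda>s. \<phi> (z, s)) t) = u0 y * frechet_derivative \<phi> (at y) (0, 1)"
        using y tf(2)[of y] zK by (cases "y \<in> cball z d") auto
    qed
    show "y \<notin> ?U \<Longrightarrow> u0 y * frechet_derivative \<phi> (at y) (0, 1) = 0" for y using u0(3)[of y] K by auto
  qed
  moreover have "(LINT (z, t)|lebesgue_on ?U. Fl (z, t) \<bullet> grushin_grad \<gamma> (\<lambda>z'. \<phi> (z', t)) z) = (LINT y|lborel. ?S y)"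
  proof (rule lebesgue_on_transfer[OF _ Ub])
    show "?S \<in> borel_measurable borel" using iS by simp
    show "AE y in lborel. y \<in> ?U \<longrightarrow> (case y of (z, t) \<Rightarrow> Fl (z, t) \<bullet> grushin_grad \<gamma> (\<lambda>z'. \<phi> (z', t)) z) = ?S y"
      using H(2)
    proof eventually_elim
      fix y assume y: "y \<in> K \<longrightarrow> H y = horizontal \<gamma> (fst y) (Fl y)"
      have eq: "(case y of (z, t) \<Rightarrow> Fl (z, t) \<bullet> grushin_grad \<gamma> (\<lambda>z'. \<phi> (z', t)) z) = horizontal \<gamma> (fst y) (Fl y) \<bullet> ?g y"
        unfolding horizontal_inner by (cases y) (simp only: prod.case grushin_grad_slice(1)[OF dphi] fst_conv)
      have ip: "v \<bullet> ?g y = (\<Sum>e\<in>Basis. (v \<bullet> e) * frechet_derivative \<phi> (at y) (e, 0))" for v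
        by (simp add: inner_sum_right mult.commute)
      show "y \<in> ?U \<longrightarrow> (case y of (z, t) \<Rightarrow> Fl (z, t) \<bullet> grushin_grad \<gamma> (\<lambda>z'. \<phi> (z', t)) z) = ?S y"
      proof (cases "y \<in> cball z d")
        case True
        then show ?thesis unfolding eq ip using y zK by auto
      next
        case False
        show ?thesis unfolding eq ip by (simp add: tf(2)[OF False])
      qed
    qed
    show "?S y = 0" if "y \<notin> ?U" for y
    proof -
      have "H y = 0" using H(3)[of y] K that by blast
      then show ?thesis by (simp only: inner_zero_left mult_zero_left sum.neutral_const)
    qed
  qed
  moreover have "(LINT (z, t)|lebesgue_on ?U. g (z, t) * \<phi> (z, t)) = (LINT y|lborel. g0 y * \<phi> y)"
  proof (rule lebesgue_on_transfer[OF _ Ub])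
    show "(\<lambda>y. g0 y * \<phi> y) \<in> borel_measurable borel" using ig by simp
    show "AE y in lborel. y \<in> ?U \<longrightarrow> (case y of (z, t) \<Rightarrow> g (z, t) * \<phi> (z, t)) = g0 y * \<phi> y"
      using g0(2)
    proof eventually_elim
      fix y assume "y \<in> K \<longrightarrow> g0 y = g y"
      then show "y \<in> ?U \<longrightarrow> (case y of (z, t) \<Rightarrow> g (z, t) * \<phi> (z, t)) = g0 y * \<phi> y"
        using \<phi>(2)[of y] zK by (cases "y \<in> cball z d") (auto simp: case_prod_beta)
    qed
    show "y \<notin> ?U \<Longrightarrow> g0 y * \<phi> y = 0" for y using g0(3)[of y] K by auto
  qed
  ultimately have "(LINT y|lborel. ?S y) - (LINT y|lborel. u0 y * frechet_derivative \<phi> (at y) (0, 1)) = (LINT y|lborel. g0 y * \<phi> y)"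
    by linarith
  then show ?thesis using iS iu by (simp only: Bochner_Integration.integral_diff)
qed

text \<open>Picone's inequality with the lower-order terms. Here \<open>f = \<phi>\<^sup>p\<close> is the spatial test function with Grushin gradient \<open>v\<close>, and
  \<open>A\<close> bounds \<open>|\<nabla>\<^sub>\<gamma> \<phi>|\<close>. Young's inequality for \<open>x = \<phi> |G| / U\<close> and \<open>A\<close> lets the good term produced by differentiating \<open>U\<^sup>1\<^sup>-\<^sup>p\<close>
  absorb the flux term up to \<open>W A\<^sup>p\<close>. What is left carries \<open>U\<close> to the powers \<open>q + 1 - p\<close> and \<open>2 - p\<close>, which lie between
  \<open>0\<close> and \<open>1\<close> and are therefore at most \<open>1 + U\<close>.\<close>

lemma pointwise_energy:
  fixes G v :: "'a::real_inner"
  assumes p: "1 < p" "p < 2" and q: "p - 1 < q" "q \<le> p"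
    and U: "U > 0" and W: "W \<ge> 0" and f: "f \<ge> 0" "f \<le> Cf" and \<tau>: "\<tau> \<ge> 0" and A: "A \<ge> 0"
    and grad: "norm v \<le> p * f powr ((p - 1) / p) * A"
    and C: "\<bar>lam\<bar> * \<tau> + \<bar>d\<tau>\<bar> / (2 - p) \<le> Ct"
  shows "\<tau> * (V * f - W * A powr p) - Cf * Ct * (1 + U)
    \<le> (V * U powr (p - 1) + lam * U powr q) * U powr (1 - p) * (f * \<tau>)
      - U powr (1 - p) * (\<tau> * ((W * norm G powr (p - 2)) *\<^sub>R G \<bullet> v))
      - (f * \<tau>) * ((1 - p) * U powr (- p)) * (W * norm G powr (p - 2) * (norm G)\<^sup>2)
      + U powr (2 - p) / (2 - p) * (f * d\<tau>)"
proof -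
  define x where "x = f powr (1 / p) * norm G / U"
  have Gp: "norm G powr (p - 2) * norm G = norm G powr (p - 1)"
  proof (cases "G = 0")
    case False
    then have "norm G powr (p - 1) = norm G powr (p - 2 + 1)" by simp
    then show ?thesis using False by (simp only: powr_add) simp
  qed (use p in simp)
  have Gp2: "norm G powr (p - 2) * (norm G)\<^sup>2 = norm G powr p"
  proof (cases "G = 0")
    case False
    then have "norm G powr p = norm G powr (p - 2 + 2)" by simp
    then show ?thesis using False by (simp only: powr_add) simp
  qed (use p in simp)
  have x0: "x \<ge> 0" using U by (simp add: x_def)
  have xr: "x powr r = f powr (r / p) * norm G powr r * U powr (- r)" for r
  proof -
    have "x powr r = (f powr (1 / p) * norm G) powr r / U powr r"
      unfolding x_def by (rule powr_divide)
    then show ?thesis by (simp add: powr_mult powr_powr powr_minus_divide)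
  qed
  have xp1: "x powr (p - 1) = f powr ((p - 1) / p) * norm G powr (p - 1) * U powr (1 - p)"
    using xr[of "p - 1"] by simp
  have xp: "x powr p = f * norm G powr p * U powr (- p)" using xr[of p] f p by simp
  have inn: "(W * norm G powr (p - 2)) *\<^sub>R G \<bullet> v \<le> W * norm G powr (p - 1) * (p * f powr ((p - 1) / p) * A)"
  proof -
    have "(W * norm G powr (p - 2)) *\<^sub>R G \<bullet> v \<le> norm ((W * norm G powr (p - 2)) *\<^sub>R G) * norm v"
      by (rule norm_cauchy_schwarz)
    also have "norm ((W * norm G powr (p - 2)) *\<^sub>R G) = W * norm G powr (p - 1)"
      using W Gp by (simp add: abs_mult mult.assoc)
    also have "W * norm G powr (p - 1) * norm v \<le> W * norm G powr (p - 1) * (p * f powr ((p - 1) / p) * A)"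
      using W by (intro mult_left_mono grad) auto
    finally show ?thesis .
  qed
  have flux: "U powr (1 - p) * (\<tau> * ((W * norm G powr (p - 2)) *\<^sub>R G \<bullet> v))
      \<le> \<tau> * W * ((p - 1) * (f * norm G powr p * U powr (- p)) + A powr p)"
  proof -
    have "U powr (1 - p) * (\<tau> * ((W * norm G powr (p - 2)) *\<^sub>R G \<bullet> v))
        \<le> U powr (1 - p) * (\<tau> * (W * norm G powr (p - 1) * (p * f powr ((p - 1) / p) * A)))"
      using \<tau> by (intro mult_left_mono inn) auto
    also have "\<dots> = \<tau> * W * (p * x powr (p - 1) * A)" unfolding xp1 by (simp add: mult_ac)
    also have "\<dots> \<le> \<tau> * W * ((p - 1) * x powr p + A powr p)"
      using \<tau> W A x0 p by (intro mult_left_mono young_powr) auto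
    finally show ?thesis unfolding xp .
  qed
  have "U powr (p - 1) * U powr (1 - p) = 1" using U by (simp add: powr_add[symmetric])
  moreover have "U powr q * U powr (1 - p) = U powr (q + 1 - p)" by (simp add: powr_add[symmetric] algebra_simps)
  ultimately have react: "(V * U powr (p - 1) + lam * U powr q) * U powr (1 - p) * (f * \<tau>)
      = V * (f * \<tau>) + lam * U powr (q + 1 - p) * (f * \<tau>)"
    by (simp add: distrib_right mult.assoc)
  have ab: "- b \<le> a" if "\<bar>a\<bar> \<le> b" for a b :: real using that by linarith
  have l1: "- (\<bar>lam\<bar> * \<tau> * Cf * (1 + U)) \<le> lam * U powr (q + 1 - p) * (f * \<tau>)"
  proof -
    have "\<bar>lam * U powr (q + 1 - p) * (f * \<tau>)\<bar> = \<bar>lam\<bar> * \<tau> * (f * U powr (q + 1 - p))"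
      using f \<tau> by (simp add: abs_mult)
    also have "\<dots> \<le> \<bar>lam\<bar> * \<tau> * (Cf * (1 + U))"
      using f \<tau> U p q by (intro mult_left_mono mult_mono powr_le_one_add) auto
    finally show ?thesis unfolding mult.assoc by (rule ab)
  qed
  have l2: "- (\<bar>d\<tau>\<bar> / (2 - p) * Cf * (1 + U)) \<le> U powr (2 - p) / (2 - p) * (f * d\<tau>)"
  proof -
    have "\<bar>U powr (2 - p) / (2 - p) * (f * d\<tau>)\<bar> = \<bar>d\<tau>\<bar> / (2 - p) * (f * U powr (2 - p))"
      using f p by (simp add: abs_mult)
    also have "\<dots> \<le> \<bar>d\<tau>\<bar> / (2 - p) * (Cf * (1 + U))"
      using f U p by (intro mult_left_mono mult_mono powr_le_one_add) auto
    finally show ?thesis unfolding mult.assoc by (rule ab)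
  qed
  have "\<bar>lam\<bar> * \<tau> * Cf * (1 + U) + \<bar>d\<tau>\<bar> / (2 - p) * Cf * (1 + U) = (\<bar>lam\<bar> * \<tau> + \<bar>d\<tau>\<bar> / (2 - p)) * (Cf * (1 + U))"
    by (simp add: distrib_right mult.assoc)
  also have "\<dots> \<le> Ct * (Cf * (1 + U))" using C f U by (intro mult_right_mono) auto
  finally have l3: "\<bar>lam\<bar> * \<tau> * Cf * (1 + U) + \<bar>d\<tau>\<bar> / (2 - p) * Cf * (1 + U) \<le> Cf * Ct * (1 + U)" by (simp add: mult_ac)
  have t3: "(f * \<tau>) * ((1 - p) * U powr (- p)) * (W * norm G powr (p - 2) * (norm G)\<^sup>2)
      = - (\<tau> * W * ((p - 1) * (f * norm G powr p * U powr (- p))))"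
    unfolding mult.assoc Gp2 by (simp add: algebra_simps)
  show ?thesis unfolding react t3 using flux l1 l2 l3 by (simp add: algebra_simps)
qed

section \<open>The energy inequality for solutions\<close>

text \<open>The renormalized identity with \<open>b(u) = u\<^sup>1\<^sup>-\<^sup>p\<close> and test function \<open>\<Psi>(z) \<tau>(t)\<close>, followed by the pointwise Picone inequality. The
  support of \<open>\<Psi>\<close> stays away from \<open>x = 0\<close>, so the problem is Euclidean there, and from the origin, so \<open>u\<close> and \<open>1/u\<close> are bounded
  near it. The bounds of \<open>u\<close> do not enter the final constant: the right-hand side depends on \<open>u\<close> only through
  its \<open>L\<^sup>1\<close> norms and on \<open>\<Psi>\<close> only through its maximum \<open>Cf\<close>.\<close>

theorem solution_energy_inequality:
  fixes u :: "real \<Rightarrow> ('m::finite, 'k::finite) pt \<Rightarrow> real" and \<Psi> w V A :: "('m, 'k) pt \<Rightarrow> real"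
    and gf :: "('m, 'k) pt \<Rightarrow> ('m, 'k) pt" and \<tau> d\<tau> :: "real \<Rightarrow> real"
  assumes \<gamma>: "\<gamma> \<ge> 0" and p: "1 < p" "p < 2" and q: "p - 1 < q" "q \<le> p"
    and \<Omega>: "open \<Omega>" "bounded \<Omega>"
    and sol: "general_positive_local_solution \<gamma> p q lam w V \<Omega> {(0, 0)} u0 T u"
    and w: "w \<in> borel_measurable borel" "\<And>z. w z \<ge> 0" "continuous_on (\<Omega> \<inter> {z. fst z \<noteq> 0}) w"
    and cut: "cutoff S \<Psi> (\<lambda>z h. gf z \<bullet> h)" and S: "S \<subseteq> \<Omega> \<inter> {z. fst z \<noteq> 0}"
    and \<Psi>: "\<And>z. \<Psi> z \<ge> 0" "\<And>z. \<Psi> z \<le> Cf"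
    and A: "\<And>z. A z \<ge> 0" "\<And>z. z \<in> S \<Longrightarrow> norm (horizontal \<gamma> z (gf z)) \<le> p * \<Psi> z powr ((p - 1) / p) * A z"
    and \<Theta>: "integrable lborel (\<lambda>z. V z * \<Psi> z - w z * A z powr p)"
    and cut\<tau>: "cutoff {t1..t2} \<tau> (\<lambda>t h. d\<tau> t * h)" and t: "0 < t1" "t1 \<le> t2" "t2 < T"
    and \<tau>: "\<And>t. \<tau> t \<ge> 0" "\<And>t. \<bar>lam\<bar> * \<tau> t + \<bar>d\<tau> t\<bar> / (2 - p) \<le> Ct"
    and L1: "\<And>t. t \<in> {t1..t2} \<Longrightarrow> (LINT z|lebesgue_on \<Omega>. \<bar>u t z\<bar>) \<le> M0"
  shows "(LINT t|lborel. \<tau> t) * (LINT z|lborel. V z * \<Psi> z - w z * A z powr p)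
    \<le> Cf * Ct * ((t2 - t1) * (measure lborel \<Omega> + M0))"
proof -
  interpret \<Psi>: cutoff S \<Psi> "\<lambda>z h. gf z \<bullet> h" by (rule cut)
  interpret \<tau>: cutoff "{t1..t2}" \<tau> "\<lambda>t h. d\<tau> t * h" by (rule cut\<tau>)
  define ST where "ST = S \<times> {t1..t2}"
  define U where "U = (\<Omega> \<inter> {z. fst z \<noteq> 0}) \<times> {0<..<T}"
  have ST: "compact ST" unfolding ST_def by (intro compact_Times \<Psi>.compact) simp
  have oU: "open U"
    unfolding U_def by (intro open_Times open_Int \<Omega>(1) open_Collect_neq continuous_intros)
  have STU: "ST \<subseteq> U" using S t by (auto simp: ST_def U_def)
  obtain d where d: "d > 0" "(\<Union>y\<in>ST. cball y d) \<subseteq> U"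
    using compact_subset_open_imp_cball_epsilon_subset[OF ST oU STU] by blast
  define K where "K = (\<Union>y\<in>ST. cball y d)"
  have K: "compact K" unfolding K_def by (rule compact_minkowski_sum_cball[OF ST])
  have KU: "K \<subseteq> U" using d(2) by (simp add: K_def)
  have KO: "K \<subseteq> \<Omega> \<times> {0<..<T}" and Kx: "\<And>y. y \<in> K \<Longrightarrow> fst (fst y) \<noteq> 0"
    and KK: "K \<subseteq> (\<Omega> - {(0, 0)}) \<times> {0<..<T}" using KU by (auto simp: U_def)
  have [measurable]: "K \<in> sets borel" using K by (simp add: compact_imp_closed)
  have Kfin: "emeasure lborel K < \<infinity>" using compact_imp_bounded[OF K] by (rule emeasure_bounded_finite)
  have STK: "ST \<subseteq> K" using d(1) by (force simp: K_def)
  have ballK: "y \<in> ST \<Longrightarrow> cball y d \<subseteq> K" for y by (auto simp: K_def)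
  obtain G where weak: "weak_grushin_grad \<gamma> \<Omega> T u G" and Lp: "locally_Lp_on p G (\<Omega> \<times> {0<..<T})"
    and evol: "distributional_evolution \<gamma> \<Omega> T u
            (\<lambda>(z, t). (w z * norm (G (z, t)) powr (p - 2)) *\<^sub>R G (z, t))
            (\<lambda>(z, t). V z * u t z powr (p - 1) + lam * u t z powr q)"
    using sol unfolding general_positive_local_solution_def by blast
  have upos: "u (snd y) (fst y) > 0" if "y \<in> K" for y
    using sol KK that unfolding general_positive_local_solution_def by force
  have lb: "locally_bounded_on (\<lambda>(z, t). u t z) ((\<Omega> - {(0, 0)}) \<times> {0<..<T})"
    "locally_bounded_on (\<lambda>(z, t). 1 / u t z) ((\<Omega> - {(0, 0)}) \<times> {0<..<T})"
    using sol unfolding general_positive_local_solution_def by blast+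
  obtain M where M: "\<And>y. y \<in> K \<Longrightarrow> \<bar>case y of (z, t) \<Rightarrow> u t z\<bar> \<le> M"
    using locally_bounded_compact[OF lb(1) K KK] by blast
  obtain M' where M': "\<And>y. y \<in> K \<Longrightarrow> \<bar>case y of (z, t) \<Rightarrow> 1 / u t z\<bar> \<le> M'"
    using locally_bounded_compact[OF lb(2) K KK] by blast
  define m where "m = 1 / (\<bar>M'\<bar> + 1)"
  have m: "m > 0" by (simp add: m_def)
  have rng: "m \<le> u (snd y) (fst y)" "u (snd y) (fst y) \<le> M" if "y \<in> K" for y
  proof -
    show "u (snd y) (fst y) \<le> M" using M[OF that] by (cases y) auto
    have "1 / u (snd y) (fst y) \<le> \<bar>M'\<bar> + 1"
      using M'[OF that] abs_ge_self[of "1 / u (snd y) (fst y)"] abs_ge_self[of M'] unfolding case_prod_beta by linarith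
    then show "m \<le> u (snd y) (fst y)" using upos[OF that] by (simp add: m_def field_simps)
  qed
  have Ku: "(\<lambda>(z, t). u t z) absolutely_integrable_on K" and KG: "G absolutely_integrable_on K"
    using weak K KO unfolding weak_grushin_grad_def locally_integrable_on_def by blast+
  have Kg: "(\<lambda>(z, t). V z * u t z powr (p - 1) + lam * u t z powr q) absolutely_integrable_on K"
    using evol K KO unfolding distributional_evolution_def locally_integrable_on_def by blast
  have KGp: "(\<lambda>y. norm (G y) powr p) absolutely_integrable_on K"
    using Lp K KO unfolding locally_Lp_on_def locally_integrable_on_def by blast
  obtain v where v: "integrable lborel v" "AE y in lborel. y \<in> K \<longrightarrow> v y = (case y of (z, t) \<Rightarrow> u t z)" "\<And>y. y \<notin> K \<Longrightarrow> v y = 0"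
    using borel_representative[OF Ku] by auto
  have v2: "AE y in lborel. y \<in> K \<longrightarrow> v y = u (snd y) (fst y)" using v(2) by (simp add: case_prod_beta)
  obtain G0 where G0: "integrable lborel G0" "AE y in lborel. y \<in> K \<longrightarrow> G0 y = G y" "\<And>y. y \<notin> K \<Longrightarrow> G0 y = 0"
    using borel_representative[OF KG] by auto
  obtain g0 where g0: "integrable lborel g0"
    "AE y in lborel. y \<in> K \<longrightarrow> g0 y = (case y of (z, t) \<Rightarrow> V z * u t z powr (p - 1) + lam * u t z powr q)" "\<And>y. y \<notin> K \<Longrightarrow> g0 y = 0"
    using borel_representative[OF Kg] by auto
  obtain h where h: "integrable lborel h" "AE y in lborel. y \<in> K \<longrightarrow> h y = norm (G y) powr p" "\<And>y. y \<notin> K \<Longrightarrow> h y = 0"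
    using borel_representative[OF KGp] by auto
  have [measurable]: "v \<in> borel_measurable borel" "G0 \<in> borel_measurable borel" "g0 \<in> borel_measurable borel" "h \<in> borel_measurable borel"
    using v(1) G0(1) g0(1) h(1) by simp_all
  note w(1)[measurable]
  have Gp: "integrable lborel (\<lambda>y. norm (G0 y) powr p)"
  proof -
    have "AE y in lborel. norm (G0 y) powr p = h y"
      using G0(2) h(2)
    proof eventually_elim
      fix y assume "y \<in> K \<longrightarrow> G0 y = G y" "y \<in> K \<longrightarrow> h y = norm (G y) powr p"
      then show "norm (G0 y) powr p = h y" using G0(3)[of y] h(3)[of y] p by (cases "y \<in> K") auto
    qed
    then have "integrable lborel (\<lambda>y. norm (G0 y) powr p) \<longleftrightarrow> integrable lborel h"
      by (intro integrable_cong_AE) measurable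
    then show ?thesis using h(1) by simp
  qed
  \<comment> \<open>The Euclidean flux and gradient; \<open>H\<close> is of the order \<open>|G|\<^sup>p\<^sup>-\<^sup>1\<close> and \<open>D\<close> of the order \<open>|G|\<close>, so \<open>B\<close> below is a multiple of \<open>|G|\<^sup>p\<close>.\<close>
  define H where "H = (\<lambda>y. (w (fst y) * norm (G0 y) powr (p - 2)) *\<^sub>R horizontal \<gamma> (fst y) (G0 y))"
  define D where "D = (\<lambda>y. (fst (G0 y), (1 / rpow (norm (fst (fst y))) \<gamma>) *\<^sub>R snd (G0 y)))"
  have crp: "continuous_on UNIV (\<lambda>y::('m, 'k) pt \<times> real. rpow (norm (fst (fst y))) \<gamma>)"
    by (intro continuous_rpow_norm \<gamma> continuous_intros)
  have [measurable]: "(\<lambda>y::('m, 'k) pt \<times> real. rpow (norm (fst (fst y))) \<gamma>) \<in> borel_measurable borel"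
    by (rule borel_measurable_continuous_onI[OF crp])
  have mfst: "(\<lambda>y. fst (G0 y)) \<in> borel_measurable borel" and msnd: "(\<lambda>y. snd (G0 y)) \<in> borel_measurable borel"
    using borel_measurable_integrable[OF integrable_bounded_linear[OF bounded_linear_fst G0(1)]]
      borel_measurable_integrable[OF integrable_bounded_linear[OF bounded_linear_snd G0(1)]] by simp_all
  note mfst[measurable] msnd[measurable]
  have mw: "(\<lambda>y::('m, 'k) pt \<times> real. w (fst y)) \<in> borel_measurable borel"
    by (rule measurable_compose[OF _ w(1)]) (intro borel_measurable_continuous_onI continuous_intros)
  note mw[measurable]
  have mH: "H \<in> borel_measurable borel"
    unfolding H_def horizontal_def by (intro borel_measurable_scaleR borel_measurable_Pair) measurable
  have mD: "D \<in> borel_measurable borel"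
    unfolding D_def by (intro borel_measurable_scaleR borel_measurable_Pair) measurable
  have cfK: "compact (fst ` K)" by (rule compact_continuous_image[OF _ K]) (intro continuous_intros)
  have sfK: "fst ` K \<subseteq> \<Omega> \<inter> {z. fst z \<noteq> 0}" using KU by (auto simp: U_def)
  have "bounded (w ` (fst ` K))"
    by (rule compact_imp_bounded[OF compact_continuous_image[OF continuous_on_subset[OF w(3) sfK] cfK]])
  then obtain Cw where Cw: "\<And>y. y \<in> K \<Longrightarrow> \<bar>w (fst y)\<bar> \<le> Cw" unfolding bounded_iff by auto
  have rpos: "rpow (norm (fst (fst y))) \<gamma> > 0" if "y \<in> K" for y using Kx[OF that] by (intro rpow_pos) simp
  have crK: "continuous_on K (\<lambda>y. rpow (norm (fst (fst y))) \<gamma>)" by (rule continuous_on_subset[OF crp]) simp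
  have "bounded ((\<lambda>y. rpow (norm (fst (fst y))) \<gamma>) ` K)"
    by (rule compact_imp_bounded[OF compact_continuous_image[OF crK K]])
  then obtain Cr where Cr: "\<And>y. y \<in> K \<Longrightarrow> \<bar>rpow (norm (fst (fst y))) \<gamma>\<bar> \<le> Cr" unfolding bounded_iff by auto
  have "continuous_on K (\<lambda>y. 1 / rpow (norm (fst (fst y))) \<gamma>)"
    by (rule continuous_on_divide[OF continuous_on_const crK]) (use rpos in force)
  from compact_imp_bounded[OF compact_continuous_image[OF this K]]
  have "bounded ((\<lambda>y. 1 / rpow (norm (fst (fst y))) \<gamma>) ` K)" .
  then obtain Cs where Cs: "\<And>y. y \<in> K \<Longrightarrow> \<bar>1 / rpow (norm (fst (fst y))) \<gamma>\<bar> \<le> Cs" unfolding bounded_iff by auto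
  define CH where "CH = \<bar>Cw\<bar> * (1 + \<bar>Cr\<bar>)"
  define CD where "CD = 1 + \<bar>Cs\<bar>"
  have CC: "CH \<ge> 0" "CD \<ge> 0" by (simp_all add: CH_def CD_def)
  have H0: "H y = 0" and D0: "D y = 0" if "y \<notin> K" for y
    unfolding H_def D_def horizontal_def G0(3)[OF that] by (simp_all add: zero_prod_def)
  have Gp1: "norm x powr (p - 2) * norm x = norm x powr (p - 1)" for x :: "('m, 'k) pt"
  proof (cases "x = 0")
    case False
    then have "norm x powr (p - 1) = norm x powr (p - 2 + 1)" by simp
    then show ?thesis using False by (simp only: powr_add) simp
  qed (use p in simp)
  have nH: "norm (H y) \<le> CH * norm (G0 y) powr (p - 1)" for y
  proof (cases "y \<in> K")
    case True
    have "norm (H y) = \<bar>w (fst y)\<bar> * norm (G0 y) powr (p - 2) * norm (horizontal \<gamma> (fst y) (G0 y))"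
      by (simp add: H_def abs_mult)
    also have "\<dots> \<le> \<bar>Cw\<bar> * norm (G0 y) powr (p - 2) * ((1 + \<bar>Cr\<bar>) * norm (G0 y))"
      using Cw[OF True] Cr[OF True]
      by (intro mult_mono order_trans[OF norm_horizontal_le] mult_right_mono) auto
    also have "\<dots> = CH * (norm (G0 y) powr (p - 2) * norm (G0 y))" by (simp add: CH_def mult_ac)
    finally show ?thesis unfolding Gp1 .
  qed (use CC in \<open>simp add: H0\<close>)
  have nD: "norm (D y) \<le> CD * norm (G0 y)" for y
  proof (cases "y \<in> K")
    case True
    have "norm (D y) \<le> norm (fst (G0 y)) + \<bar>1 / rpow (norm (fst (fst y))) \<gamma>\<bar> * norm (snd (G0 y))"
      unfolding D_def by (rule order_trans[OF norm_Pair_le]) simp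
    also have "\<dots> \<le> norm (G0 y) + \<bar>Cs\<bar> * norm (G0 y)"
      using Cs[OF True]
      by (intro add_mono mult_mono) (metis norm_fst_le prod.collapse, auto, metis norm_snd_le prod.collapse)
    finally show ?thesis by (simp add: CD_def algebra_simps)
  qed (use CC in \<open>simp add: D0\<close>)
  define B where "B = (\<lambda>y. CH * CD * norm (G0 y) powr p)"
  have iB: "integrable lborel B" unfolding B_def using Gp by simp
  have dom: "norm (H y) * norm (D y') \<le> B y + B y'" for y y'
  proof -
    have "norm (H y) * norm (D y') \<le> (CH * norm (G0 y) powr (p - 1)) * (CD * norm (G0 y'))"
      using CC by (intro mult_mono nH nD) auto
    also have "\<dots> = CH * CD * (norm (G0 y) powr (p - 1) * norm (G0 y'))" by (simp add: mult_ac)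
    also have "\<dots> \<le> CH * CD * (norm (G0 y) powr p + norm (G0 y') powr p)"
      using CC p by (intro mult_left_mono powr_mixed_le) auto
    finally show ?thesis by (simp add: B_def algebra_simps)
  qed
  have iK: "integrable lborel (indicator K :: _ \<Rightarrow> real)" using Kfin by (intro integrable_real_indicator) auto
  have iH: "integrable lborel H"
  proof (rule Bochner_Integration.integrable_bound[of _ "\<lambda>y. CH * (indicator K y + norm (G0 y) powr p)"])
    show "integrable lborel (\<lambda>y. CH * (indicator K y + norm (G0 y) powr p))" using iK Gp by simp
    show "H \<in> borel_measurable lborel" using mH by simp
    have "norm (H y) \<le> CH * (indicator K y + norm (G0 y) powr p)" for y
    proof (cases "y \<in> K")
      case True
      have "norm (G0 y) powr (p - 1) * 1 \<le> norm (G0 y) powr p + 1 powr p" using p by (intro powr_mixed_le) auto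
      then have "CH * norm (G0 y) powr (p - 1) \<le> CH * (1 + norm (G0 y) powr p)" using CC by (intro mult_left_mono) auto
      then show ?thesis using nH[of y] True by simp
    qed (use CC in \<open>simp add: H0\<close>)
    then show "AE y in lborel. norm (H y) \<le> norm (CH * (indicator K y + norm (G0 y) powr p))"
      by (intro AE_I2) (simp add: order_trans[OF _ abs_ge_self])
  qed
  have iD: "integrable lborel D"
  proof (rule Bochner_Integration.integrable_bound[of _ "\<lambda>y. CD * norm (G0 y)"])
    show "integrable lborel (\<lambda>y. CD * norm (G0 y))" using G0(1) by simp
    show "D \<in> borel_measurable lborel" using mD by simp
    show "AE y in lborel. norm (D y) \<le> norm (CD * norm (G0 y))"
      using nD CC by (intro AE_I2) (simp add: abs_mult)
  qed
  have HF: "AE y in lborel. y \<in> K \<longrightarrow> H y = horizontal \<gamma> (fst y) (case y of (z, t) \<Rightarrow> (w z * norm (G (z, t)) powr (p - 2)) *\<^sub>R G (z, t))"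
    using G0(2)
  proof eventually_elim
    fix y assume y: "y \<in> K \<longrightarrow> G0 y = G y"
    show "y \<in> K \<longrightarrow> H y = horizontal \<gamma> (fst y) (case y of (z, t) \<Rightarrow> (w z * norm (G (z, t)) powr (p - 2)) *\<^sub>R G (z, t))"
      using y by (cases y) (auto simp: H_def horizontal_def)
  qed
  have range: "AE y in lborel. y \<in> (\<Union>y\<in>ST. cball y d) \<longrightarrow> m \<le> v y \<and> v y \<le> M"
    using v2 by eventually_elim (use rng in \<open>auto simp flip: K_def\<close>)
  define \<psi>' where "\<psi>' = (\<lambda>y (h::('m, 'k) pt \<times> real). \<tau> (snd y) * (gf (fst y) \<bullet> fst h) + \<Psi> (fst y) * d\<tau> (snd y) * snd h)"
  have cutST: "cutoff ST (\<lambda>y. \<Psi> (fst y) * \<tau> (snd y)) \<psi>'"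
    unfolding ST_def \<psi>'_def by (rule cutoff_product[OF cut cut\<tau>])
  have derF: "((\<lambda>x. x powr (2 - p) / (2 - p)) has_real_derivative x powr (1 - p)) (at x)"
    and derb: "((\<lambda>x. x powr (1 - p)) has_real_derivative (1 - p) * x powr (- p)) (at x)" if "x > 0" for x :: real
    using has_real_derivative_powr[OF that, of "1 - p"] DERIV_cdivide[OF has_real_derivative_powr[OF that, of "2 - p"], of "2 - p"] p
    by simp_all
  define R where "R = (\<lambda>y. g0 y * v y powr (1 - p) * (\<Psi> (fst y) * \<tau> (snd y)) - v y powr (1 - p) * (\<Sum>e\<in>Basis. (H y \<bullet> e) * \<psi>' y (e, 0))
      - (\<Psi> (fst y) * \<tau> (snd y)) * ((1 - p) * v y powr (- p)) * (H y \<bullet> D y) + v y powr (2 - p) / (2 - p) * \<psi>' y (0, 1))"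
  have iR: "integrable lborel R" and R0: "(LINT y|lborel. R y) = 0"
  proof -
    have grad: "(LINT y|lborel. v y * frechet_derivative \<phi> (at y) (e, 0)) = - (LINT y|lborel. \<phi> y * (D y \<bullet> e))"
      if "\<And>n. C_k n \<phi>" "z \<in> ST" "\<And>y. y \<notin> cball z d \<Longrightarrow> \<phi> y = 0" "e \<in> Basis" for \<phi> z e
      unfolding D_def
      using weak_gradient_euclidean[OF \<gamma> \<Omega>(1) weak KO Kx v(1) v2 v(3) G0 that(1) that(3) ballK[OF that(2)] that(4)] by blast
    have ev: "(LINT y|lborel. (\<Sum>e\<in>Basis. (H y \<bullet> e) * frechet_derivative \<phi> (at y) (e, 0)) - v y * frechet_derivative \<phi> (at y) (0, 1))
        = (LINT y|lborel. g0 y * \<phi> y)"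
      if "\<And>n. C_k n \<phi>" "z \<in> ST" "\<And>y. y \<notin> cball z d \<Longrightarrow> \<phi> y = 0" for \<phi> z
      using evolution_euclidean[OF \<Omega>(1) evol KO v(1) v2 v(3) iH HF H0 g0 that(1) that(3) ballK[OF that(2)]] by blast
    have c: "continuous_on {0<..} (\<lambda>x::real. (1 - p) * x powr (- p))" by (auto intro!: continuous_intros)
    have mm: "(\<lambda>x::real. x powr (2 - p) / (2 - p)) \<in> borel_measurable borel"
      "(\<lambda>x::real. x powr (1 - p)) \<in> borel_measurable borel"
      "(\<lambda>x::real. (1 - p) * x powr (- p)) \<in> borel_measurable borel" by measurable
    note RI = renormalized_identity[where F="\<lambda>x. x powr (2 - p) / (2 - p)" and b="\<lambda>x. x powr (1 - p)"
        and b'="\<lambda>x. (1 - p) * x powr (- p)", OF cutST d(1) v(1) g0(1) iH iD iB range m dom]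
    show "integrable lborel R"
      unfolding R_def by (rule RI(1)) (fact grad ev derF derb c mm)+
    show "(LINT y|lborel. R y) = 0"
      unfolding R_def by (rule RI(2)) (fact grad ev derF derb c mm)+
  qed
  define Err where "Err = (\<lambda>y. Cf * Ct * (indicator ST y + indicator ST y * v y))"
  have STb[measurable]: "ST \<in> sets borel" using ST by (simp add: compact_imp_closed)
  have iST: "integrable lborel (indicator ST :: _ \<Rightarrow> real)"
    using emeasure_bounded_finite[OF compact_imp_bounded[OF ST]] by (intro integrable_real_indicator) auto
  have "integrable lborel (\<lambda>y. indicator ST y *\<^sub>R v y)" by (rule integrable_mult_indicator[OF _ v(1)]) simp
  then have iSTv: "integrable lborel (\<lambda>y. indicator ST y * v y)" by simp
  have iErr: "integrable lborel Err" unfolding Err_def using iST iSTv by simp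
  have i\<tau>: "integrable lborel \<tau>"
    by (rule integrable_continuous_compact_support[OF \<tau>.cont, of "max \<bar>t1\<bar> \<bar>t2\<bar>"]) (auto intro!: \<tau>.supp)
  note split = integral_product_split[OF \<Theta> i\<tau>]
  \<comment> \<open>Off \<open>ST\<close> the left-hand side is at most \<open>0\<close>, since there \<open>\<Psi>\<close> or \<open>\<tau>\<close> vanishes and \<open>w\<close> is nonnegative.\<close>
  have pw: "AE y in lborel. \<tau> (snd y) * (V (fst y) * \<Psi> (fst y) - w (fst y) * A (fst y) powr p) - Err y \<le> R y"
    using v2 G0(2) g0(2)
  proof eventually_elim
    fix y assume y: "y \<in> K \<longrightarrow> v y = u (snd y) (fst y)" "y \<in> K \<longrightarrow> G0 y = G y"
      "y \<in> K \<longrightarrow> g0 y = (case y of (z, t) \<Rightarrow> V z * u t z powr (p - 1) + lam * u t z powr q)"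
    show "\<tau> (snd y) * (V (fst y) * \<Psi> (fst y) - w (fst y) * A (fst y) powr p) - Err y \<le> R y"
    proof (cases "y \<in> ST")
      case False
      interpret c: cutoff ST "\<lambda>y. \<Psi> (fst y) * \<tau> (snd y)" \<psi>' by (rule cutST)
      have "R y = 0" unfolding R_def c.supp[OF False] c.deriv_supp[OF False] by simp
      moreover have "Err y = 0" using False by (simp add: Err_def)
      moreover have "\<tau> (snd y) * (V (fst y) * \<Psi> (fst y) - w (fst y) * A (fst y) powr p) \<le> 0"
      proof (cases "snd y \<in> {t1..t2}")
        case True
        then have "fst y \<notin> S" using False by (cases y) (auto simp: ST_def)
        then have "\<Psi> (fst y) = 0" by (rule \<Psi>.supp)
        then show ?thesis using \<tau>(1)[of "snd y"] w(2)[of "fst y"] by (simp add: mult_nonneg_nonneg)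
      qed (simp add: \<tau>.supp)
      ultimately show ?thesis by simp
    next
      case True
      have yK: "y \<in> K" using True STK by blast
      have yS: "fst y \<in> S" using True by (cases y) (auto simp: ST_def)
      have vy: "v y = u (snd y) (fst y)" "v y > 0" using y yK upos by auto
      have gy: "g0 y = V (fst y) * v y powr (p - 1) + lam * v y powr q"
        using y yK by (simp add: case_prod_beta)
      have rp: "rpow (norm (fst (fst y))) \<gamma> > 0" by (rule rpos[OF yK])
      have HD: "H y \<bullet> D y = w (fst y) * norm (G0 y) powr (p - 2) * (norm (G0 y))\<^sup>2"
      proof -
        have "horizontal \<gamma> (fst y) (G0 y) \<bullet> D y = G0 y \<bullet> G0 y"
          using rp by (simp add: horizontal_def D_def inner_prod_def)
        then show ?thesis by (simp add: H_def dot_square_norm)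
      qed
      have Hs: "(\<Sum>e\<in>Basis. (H y \<bullet> e) * \<psi>' y (e, 0)) = \<tau> (snd y) * ((w (fst y) * norm (G0 y) powr (p - 2)) *\<^sub>R G0 y \<bullet> horizontal \<gamma> (fst y) (gf (fst y)))"
      proof -
        have "(\<Sum>e\<in>Basis. (H y \<bullet> e) * \<psi>' y (e, 0)) = \<tau> (snd y) * (\<Sum>e\<in>Basis. (H y \<bullet> e) * (gf (fst y) \<bullet> e))"
          by (simp add: \<psi>'_def sum_distrib_left mult_ac)
        also have "(\<Sum>e\<in>Basis. (H y \<bullet> e) * (gf (fst y) \<bullet> e)) = H y \<bullet> gf (fst y)" by (rule euclidean_inner[symmetric])
        also have "H y \<bullet> gf (fst y) = (w (fst y) * norm (G0 y) powr (p - 2)) *\<^sub>R G0 y \<bullet> horizontal \<gamma> (fst y) (gf (fst y))"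
          by (simp add: H_def horizontal_inner)
        finally show ?thesis .
      qed
      have "\<tau> (snd y) * (V (fst y) * \<Psi> (fst y) - w (fst y) * A (fst y) powr p) - Cf * Ct * (1 + v y)
        \<le> (V (fst y) * v y powr (p - 1) + lam * v y powr q) * v y powr (1 - p) * (\<Psi> (fst y) * \<tau> (snd y))
          - v y powr (1 - p) * (\<tau> (snd y) * ((w (fst y) * norm (G0 y) powr (p - 2)) *\<^sub>R G0 y \<bullet> horizontal \<gamma> (fst y) (gf (fst y))))
          - (\<Psi> (fst y) * \<tau> (snd y)) * ((1 - p) * v y powr (- p)) * (w (fst y) * norm (G0 y) powr (p - 2) * (norm (G0 y))\<^sup>2)
          + v y powr (2 - p) / (2 - p) * (\<Psi> (fst y) * d\<tau> (snd y))"
        by (rule pointwise_energy[OF p q vy(2) w(2) \<Psi> \<tau>(1) A(1) A(2)[OF yS] \<tau>(2)])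
      also have "\<dots> = R y" unfolding R_def gy HD Hs by (simp add: \<psi>'_def)
      finally show ?thesis using True by (simp add: Err_def)
    qed
  qed
  have "(LINT y|lborel. \<tau> (snd y) * (V (fst y) * \<Psi> (fst y) - w (fst y) * A (fst y) powr p) - Err y) \<le> (LINT y|lborel. R y)"
    by (rule integral_mono_AE[OF _ iR pw]) (use split(1) iErr in simp)
  then have "(LINT t|lborel. \<tau> t) * (LINT z|lborel. V z * \<Psi> z - w z * A z powr p) \<le> (LINT y|lborel. Err y)"
    using split iErr unfolding R0 by simp
  also have "(LINT y|lborel. Err y) = Cf * Ct * (measure lborel ST + (LINT y|lborel. indicator ST y * v y))"
    unfolding Err_def using iST iSTv by simp
  also have "\<dots> \<le> Cf * Ct * ((t2 - t1) * measure lborel \<Omega> + (t2 - t1) * M0)"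
  proof (intro mult_left_mono add_mono)
    have Sb: "S \<in> sets borel" "\<Omega> \<in> sets borel" using \<Psi>.compact \<Omega>(1) by (auto simp: compact_imp_closed)
    have "emeasure lborel \<Omega> < \<infinity>" using \<Omega>(2) by (rule emeasure_bounded_finite)
    then have "measure lborel S \<le> measure lborel \<Omega>"
      using S Sb by (intro measure_mono_fmeasurable) (auto simp: fmeasurable_def)
    moreover have "measure lborel ST = measure lborel S * (t2 - t1)"
    proof -
      have "emeasure (lborel \<Otimes>\<^sub>M lborel) (S \<times> {t1..t2}) = emeasure lborel S * emeasure lborel {t1..t2}"
        using Sb by (intro lborel.emeasure_pair_measure_Times) auto
      then show ?thesis using t by (simp add: lborel_prod measure_def ST_def enn2real_mult)
    qed
    ultimately show "measure lborel ST \<le> (t2 - t1) * measure lborel \<Omega>"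
      using t by (simp add: mult.commute mult_left_mono)
    have uint: "integrable (lebesgue_on \<Omega>) (u t)" if "t \<in> {t1..t2}" for t
      using sol that t unfolding general_positive_local_solution_def continuous_into_L1_def by auto
    show "(LINT y|lborel. indicator ST y * v y) \<le> (t2 - t1) * M0"
      unfolding ST_def
    proof (rule space_time_L1_bound[OF v(1) _ _ Sb(1) _ Sb(2) t(2) uint L1])
      show "AE y in lborel. y \<in> S \<times> {t1..t2} \<longrightarrow> v y = u (snd y) (fst y)"
        using v2 by eventually_elim (use STK in \<open>auto simp: ST_def\<close>)
      show "y \<in> S \<times> {t1..t2} \<Longrightarrow> u (snd y) (fst y) \<ge> 0" for y
        using upos[of y] STK by (auto simp: ST_def)
    qed (use S in auto)
    have "Cf \<ge> 0" using \<Psi>[of undefined] by linarith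
    moreover have "Ct \<ge> 0"
    proof -
      have "0 \<le> \<bar>lam\<bar> * \<tau> 0 + \<bar>d\<tau> 0\<bar> / (2 - p)" using \<tau>(1)[of 0] p by (intro add_nonneg_nonneg) auto
      then show ?thesis using \<tau>(2)[of 0] by linarith
    qed
    ultimately show "0 \<le> Cf * Ct" by simp
  qed
  finally show ?thesis by (simp add: distrib_left)
qed

section \<open>Test functions concentrated at the boundary\<close>

lemma pos_part_powr_deriv:
  assumes "p > 1"
  shows "((\<lambda>r. max 0 r powr p) has_real_derivative p * max 0 r powr (p - 1)) (at r)"
proof (cases r "0::real" rule: linorder_cases)
  case greater
  have "((\<lambda>r. r powr p) has_real_derivative p * max 0 r powr (p - 1)) (at r)"
    using has_real_derivative_powr[OF greater, of p] greater by simp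
  then show ?thesis
    by (rule has_field_derivative_transform_within_open[of _ _ _ "{0<..}"]) (use greater in auto)
next
  case less
  have "((\<lambda>r::real. 0::real) has_real_derivative p * max 0 r powr (p - 1)) (at r)" using less by simp
  then show ?thesis
    by (rule has_field_derivative_transform_within_open[of _ _ _ "{..<0}"]) (use less in auto)
next
  case equal
  have "((\<lambda>h. max 0 h powr p / h) \<longlongrightarrow> 0) (at 0)"
  proof (rule Lim_null_comparison[where g="\<lambda>h. \<bar>h\<bar> powr (p - 1)"])
    show "\<forall>\<^sub>F h in at 0. norm (max 0 h powr p / h) \<le> \<bar>h\<bar> powr (p - 1)"
    proof (rule always_eventually, rule allI)
      fix h :: real
      show "norm (max 0 h powr p / h) \<le> \<bar>h\<bar> powr (p - 1)"
      proof (cases "h > 0")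
        case True
        then show ?thesis by (simp add: powr_diff)
      next
        case False
        then have "max 0 h = 0" by simp
        then show ?thesis by simp
      qed
    qed
    have "continuous_on UNIV (\<lambda>h::real. \<bar>h\<bar> powr (p - 1))"
      using assms by (intro continuous_on_powr' continuous_intros) auto
    then have "isCont (\<lambda>h::real. \<bar>h\<bar> powr (p - 1)) 0" by (simp add: continuous_on_eq_continuous_at)
    then show "((\<lambda>h::real. \<bar>h\<bar> powr (p - 1)) \<longlongrightarrow> 0) (at 0)" by (simp add: isCont_def)
  qed
  then show ?thesis using equal by (simp add: has_field_derivative_iff)
qed

lemma continuous_pos_part_powr:
  fixes f :: "'a::topological_space \<Rightarrow> real"
  assumes "continuous_on S f" "q > 0"
  shows "continuous_on S (\<lambda>x. max 0 (f x) powr q)"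
  by (intro continuous_on_powr' continuous_on_max continuous_on_const assms(1)) (use assms in auto)

lemma time_cutoff_exists:
  assumes "t1 < t2"
  obtains \<tau> d\<tau> where "cutoff {t1..t2} \<tau> (\<lambda>t h. d\<tau> t * h)" "\<And>t::real. \<tau> t \<ge> 0" "(LINT t|lborel. \<tau> t) > 0"
proof -
  define q where "q = (\<lambda>t. (t - t1) * (t2 - t))"
  define \<tau> where "\<tau> = (\<lambda>t. max 0 (q t) powr 2)"
  define d\<tau> where "d\<tau> = (\<lambda>t. 2 * max 0 (q t) powr (2 - 1) * (t1 + t2 - 2 * t))"
  have q: "q t \<le> 0" if "t \<notin> {t1..t2}" for t
    using that assms unfolding q_def by (intro mult_le_0_iff[THEN iffD2]) auto
  have c: "cutoff {t1..t2} \<tau> (\<lambda>t h. d\<tau> t * h)"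
  proof
    show "(\<tau> has_derivative (\<lambda>h. d\<tau> t * h)) (at t)" for t
    proof -
      have "(q has_real_derivative (t1 + t2 - 2 * t)) (at t)"
        unfolding q_def by (auto intro!: derivative_eq_intros)
      from DERIV_chain2[OF pos_part_powr_deriv[of 2] this]
      show ?thesis unfolding \<tau>_def d\<tau>_def has_field_derivative_def by simp
    qed
    show "continuous_on UNIV (\<lambda>z. d\<tau> z * b)" for b
      unfolding d\<tau>_def q_def by (intro continuous_intros continuous_pos_part_powr) auto
    show "t \<notin> {t1..t2} \<Longrightarrow> \<tau> t = 0" for t using q[of t] by (simp add: \<tau>_def)
  qed simp
  interpret c: cutoff "{t1..t2}" \<tau> "\<lambda>t h. d\<tau> t * h" by (rule c)
  have i: "integrable lborel \<tau>"
    by (rule integrable_continuous_compact_support[OF c.cont, of "max \<bar>t1\<bar> \<bar>t2\<bar>"]) (auto intro!: c.supp)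
  have nn: "\<tau> t \<ge> 0" for t by (simp add: \<tau>_def)
  have "(LINT t|lborel. \<tau> t) \<noteq> 0"
  proof
    assume "(LINT t|lborel. \<tau> t) = 0"
    then have "AE t in lborel. \<tau> t = 0" using integral_nonneg_eq_0_iff_AE[OF i] nn by auto
    then have "AE t in lborel. t \<notin> {t1<..<t2}"
    proof eventually_elim
      fix t assume "\<tau> t = 0"
      then show "t \<notin> {t1<..<t2}" by (auto simp: \<tau>_def q_def max_def mult_le_0_iff split: if_splits)
    qed
    then have "emeasure lborel {t. t1 < t \<and> t < t2} = 0" by (subst (asm) AE_iff_measurable[OF _ refl]) auto
    moreover have "{t. t1 < t \<and> t < t2} = {t1<..<t2}" by auto
    ultimately have "emeasure lborel {t1<..<t2} = 0" by (simp only:)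
    then show False using assms by simp
  qed
  moreover have "(LINT t|lborel. \<tau> t) \<ge> 0" using nn by simp
  ultimately show ?thesis using that[OF c nn] by linarith
qed

text \<open>A bump in the variable \<open>- ln l\<close> on the interval from \<open>0\<close> to \<open>N\<close>, scaled so that its height is of order one and its slope at most
  \<open>1/N\<close>: cutting off over \<open>N\<close> powers of \<open>e\<close> costs little.\<close>

definition profile :: "real \<Rightarrow> real \<Rightarrow> real" where
  "profile N l = max 0 (- ln l * (N + ln l) / N\<^sup>2)"

lemma profile_bounds:
  assumes "N > 0" shows "0 \<le> profile N l" "profile N l \<le> 1"
proof -
  show "0 \<le> profile N l" by (simp add: profile_def)
  have "- ln l * (N + ln l) \<le> N\<^sup>2"
  proof -
    have "(ln l + N / 2) * (ln l + N / 2) = N * N / 4 - (- ln l * (N + ln l))" by (simp add: field_simps)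
    then show ?thesis
      using zero_le_square[of "ln l + N / 2"] zero_le_square[of N] unfolding power2_eq_square by linarith
  qed
  then have "- ln l * (N + ln l) / N\<^sup>2 \<le> N\<^sup>2 / N\<^sup>2" by (rule divide_right_mono) simp
  also have "\<dots> = 1" using assms by simp
  finally show "profile N l \<le> 1" unfolding profile_def by (rule max.boundedI[rotated]) simp
qed

lemma profile_nonzeroD:
  assumes "N > 0" "l > 0" "profile N l \<noteq> 0"
  shows "exp (- N) < l" "l < 1"
proof -
  have "- ln l * (N + ln l) > 0"
  proof -
    have "0 < - ln l * (N + ln l) / N\<^sup>2"
      using assms(3) unfolding profile_def by (meson max.absorb1 not_le)
    from mult_pos_pos[OF this, of "N\<^sup>2"] assms(1) show ?thesis by simp
  qed
  then have "- ln l > 0 \<and> N + ln l > 0 \<or> - ln l < 0 \<and> N + ln l < 0" by (simp only: zero_less_mult_iff)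
  then have l: "ln l < 0" "- N < ln l" using assms(1) by auto
  show "l < 1" using l(1) assms(2) by simp
  have "exp (- N) < exp (ln l)" using l(2) by simp
  then show "exp (- N) < l" using assms(2) by simp
qed

lemma radial_factor_deriv:
  assumes p: "p > 1" and N: "N > 0" and l: "l > 0"
  shows "((\<lambda>l. l powr (s * p) * profile N l powr p) has_real_derivative
     p * (l powr (s * p - 1) * profile N l powr (p - 1)) * (s * profile N l - (N + 2 * ln l) / N\<^sup>2)) (at l)"
proof -
  define \<kappa> where "\<kappa> = (\<lambda>l. - ln l * (N + ln l) / N\<^sup>2)"
  have k: "profile N l = max 0 (\<kappa> l)" for l by (simp add: profile_def \<kappa>_def)
  have "(\<kappa> has_real_derivative (- (N + 2 * ln l) / (N\<^sup>2 * l))) (at l)"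
    unfolding \<kappa>_def using l N by (auto intro!: derivative_eq_intros simp: field_simps)
  from DERIV_mult[OF has_real_derivative_powr[OF l, of "s * p"] DERIV_chain2[OF pos_part_powr_deriv[OF p] this]]
  have "((\<lambda>l. l powr (s * p) * max 0 (\<kappa> l) powr p) has_real_derivative
     s * p * l powr (s * p - 1) * max 0 (\<kappa> l) powr p + p * max 0 (\<kappa> l) powr (p - 1) * (- (N + 2 * ln l) / (N\<^sup>2 * l)) * l powr (s * p)) (at l)"
    by (simp add: add.commute)
  moreover have "max 0 (\<kappa> l) powr p = max 0 (\<kappa> l) powr (p - 1) * max 0 (\<kappa> l)"
    by (cases "max 0 (\<kappa> l) = 0") (use p in \<open>auto simp: powr_diff\<close>)
  moreover have "l powr (s * p) = l powr (s * p - 1) * l" using l by (simp add: powr_diff)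
  ultimately show ?thesis
    unfolding k
  proof (elim DERIV_cong)
    fix a assume 1: "max 0 (\<kappa> l) powr p = max 0 (\<kappa> l) powr (p - 1) * max 0 (\<kappa> l)" and 2: "l powr (s * p) = l powr (s * p - 1) * l"
    show "s * p * l powr (s * p - 1) * max 0 (\<kappa> l) powr p + p * max 0 (\<kappa> l) powr (p - 1) * (- (N + 2 * ln l) / (N\<^sup>2 * l)) * l powr (s * p) =
      p * (l powr (s * p - 1) * max 0 (\<kappa> l) powr (p - 1)) * (s * max 0 (\<kappa> l) - (N + 2 * ln l) / N\<^sup>2)"
      unfolding 1 2 using l N by (simp add: field_simps)
  qed
qed

text \<open>The test function is \<open>\<phi>\<^sup>p\<close> with \<open>\<phi> = L\<^sup>s profile(L) \<sigma>(x)\<close>. The power \<open>L\<^sup>s\<close> is the virtual extremal of the Hardy inequality at the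
  boundary, \<open>profile\<close> cuts it off between \<open>L = exp (- N)\<close> and \<open>L = 1\<close>, and \<open>\<sigma>\<close> cuts off the degenerate set \<open>x = 0\<close>. The
  parameter \<open>ty\<close> only fixes the dimensions.\<close>

locale boundary_test =
  fixes \<gamma> R p s a N :: real and ty :: "('m::finite, 'k::finite) pt itself"
  assumes \<gamma>: "\<gamma> \<ge> 0" and R: "R > 0" and p: "1 < p" and s: "s > 0" and a: "a > 0" and N: "N \<ge> 1"
begin

text \<open>The set on which \<open>L\<close> is positive and smooth.\<close>

definition off_axis :: "('m, 'k) pt set" where "off_axis = grushin_ball \<gamma> R \<inter> {z. fst z \<noteq> 0}"
definition supp_set :: "('m, 'k) pt set" where
  "supp_set = {z. R * exp (- 1) \<le> grushin_rho \<gamma> z \<and> grushin_rho \<gamma> z \<le> R * exp (- exp (- N)) \<and> a \<le> norm (fst z)}"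
definition L :: "('m, 'k) pt \<Rightarrow> real" where "L z = ln (R / grushin_rho \<gamma> z)"
definition \<sigma> :: "('m, 'k) pt \<Rightarrow> real" where "\<sigma> z = max 0 ((norm (fst z))\<^sup>2 - a\<^sup>2)"
text \<open>The length of the Grushin gradient of \<open>L\<close>.\<close>

definition P :: "('m, 'k) pt \<Rightarrow> real" where "P z = (norm (fst z) / grushin_rho \<gamma> z) powr \<gamma> / grushin_rho \<gamma> z"
definition radial :: "real \<Rightarrow> real" where "radial l = l powr (s * p) * profile N l powr p"
definition radial_deriv :: "real \<Rightarrow> real" where
  "radial_deriv l = p * (l powr (s * p - 1) * profile N l powr (p - 1)) * (s * profile N l - (N + 2 * ln l) / N\<^sup>2)"
definition \<Psi> :: "('m, 'k) pt \<Rightarrow> real" where "\<Psi> z = (if z \<in> off_axis then radial (L z) * \<sigma> z powr p else 0)"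
definition grad_Psi :: "('m, 'k) pt \<Rightarrow> ('m, 'k) pt" where
  "grad_Psi z = (if z \<in> off_axis then (radial_deriv (L z) * \<sigma> z powr p * (- 1 / grushin_rho \<gamma> z)) *\<^sub>R rho_grad \<gamma> z
     + (radial (L z) * (p * \<sigma> z powr (p - 1) * 2)) *\<^sub>R (fst z, 0) else 0)"
text \<open>A bound for \<open>|\<nabla>\<^sub>\<gamma> \<phi>|\<close>: the first summand comes from differentiating \<open>L\<^sup>s\<close>, the others from the two cutoffs.\<close>

definition A :: "('m, 'k) pt \<Rightarrow> real" where
  "A z = s * (\<sigma> z * P z * profile N (L z) * L z powr (s - 1))
     + (\<sigma> z * P z * L z powr (s - 1) / N + 2 * R * (L z powr s * profile N (L z)))"

lemma N0: "N > 0" using N by simp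

lemma off_axis_iff: "z \<in> off_axis \<longleftrightarrow> fst z \<noteq> 0 \<and> 0 < grushin_rho \<gamma> z \<and> grushin_rho \<gamma> z < R"
  using rho_pos[of z \<gamma>] by (auto simp: off_axis_def grushin_ball_def)

lemma open_off_axis: "open off_axis"
  unfolding off_axis_def by (intro open_Int open_grushin_ball \<gamma> open_Collect_neq continuous_intros)

lemma L_pos: "z \<in> off_axis \<Longrightarrow> L z > 0" by (simp add: L_def off_axis_iff)

lemma L_neq0: "z \<in> off_axis \<Longrightarrow> L z \<noteq> 0" using L_pos[of z] by simp

lemma supp_set_subset: "supp_set \<subseteq> off_axis"
proof
  fix z assume z: "z \<in> supp_set"
  have "R * exp (- exp (- N)) < R" using R by simp
  moreover have "0 < R * exp (- 1)" using R by simp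
  ultimately show "z \<in> off_axis" using z a by (auto simp: supp_set_def off_axis_iff)
qed

lemma supp_set_iff: "z \<in> off_axis \<Longrightarrow> z \<in> supp_set \<longleftrightarrow> exp (- N) \<le> L z \<and> L z \<le> 1 \<and> a \<le> norm (fst z)"
proof -
  assume z: "z \<in> off_axis"
  have r: "grushin_rho \<gamma> z = R * exp (- L z)" using z R by (simp add: L_def off_axis_iff exp_minus)
  show ?thesis unfolding supp_set_def mem_Collect_eq r using R by auto
qed

lemma compact_supp_set: "compact supp_set"
proof -
  have "closed supp_set"
    unfolding supp_set_def by (intro closed_Collect_conj closed_Collect_le continuous_intros continuous_rho[OF \<gamma>])
  moreover have "bounded supp_set"
    by (rule bounded_subset[OF bounded_rho_le[OF \<gamma>, of "R * exp (- exp (- N))"]]) (auto simp: supp_set_def)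
  ultimately show ?thesis by (simp add: compact_eq_bounded_closed)
qed

lemma off_supp_set: "profile N (L z) = 0 \<or> \<sigma> z = 0" if "z \<in> off_axis" "z \<notin> supp_set"
proof (rule ccontr)
  assume "\<not> ?thesis"
  then have 1: "profile N (L z) \<noteq> 0" "\<sigma> z \<noteq> 0" by auto
  from profile_nonzeroD[OF N0 L_pos[OF that(1)] 1(1)] have "exp (- N) \<le> L z" "L z \<le> 1" by auto
  moreover have "a \<le> norm (fst z)"
  proof (rule power2_le_imp_le)
    show "a\<^sup>2 \<le> (norm (fst z))\<^sup>2" using 1(2) by (auto simp: \<sigma>_def max_def split: if_splits)
  qed simp
  ultimately show False using supp_set_iff[OF that(1)] that(2) by blast
qed

lemma grad_Psi_off_supp_set: "grad_Psi z = 0" if "z \<notin> supp_set"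
proof (cases "z \<in> off_axis")
  case True
  from off_supp_set[OF True that] show ?thesis
    by (auto simp: grad_Psi_def radial_def radial_deriv_def zero_prod_def)
qed (simp add: grad_Psi_def)

lemma L_deriv: "z \<in> off_axis \<Longrightarrow> (L has_derivative (\<lambda>h. (- 1 / grushin_rho \<gamma> z) * (rho_grad \<gamma> z \<bullet> h))) (at z)"
proof -
  assume z: "z \<in> off_axis"
  have rp: "grushin_rho \<gamma> z > 0" and x: "fst z \<noteq> 0" using z by (auto simp: off_axis_iff)
  have "((\<lambda>t. ln (R / t)) has_real_derivative (- 1 / grushin_rho \<gamma> z)) (at (grushin_rho \<gamma> z))"
    using rp R by (auto intro!: derivative_eq_intros simp: field_simps)
  from has_derivative_compose[OF rho_has_derivative[OF \<gamma> x] this[unfolded has_field_derivative_def]]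
  show ?thesis unfolding L_def .
qed

lemma \<Psi>_deriv: "(\<Psi> has_derivative (\<lambda>h. grad_Psi z \<bullet> h)) (at z)"
proof (cases "z \<in> off_axis")
  case True
  have 1: "((\<lambda>z. radial (L z)) has_derivative (\<lambda>h. radial_deriv (L z) * ((- 1 / grushin_rho \<gamma> z) * (rho_grad \<gamma> z \<bullet> h)))) (at z)"
    using has_derivative_compose[OF L_deriv[OF True] radial_factor_deriv[OF p N0 L_pos[OF True], of s, unfolded has_field_derivative_def]]
    by (simp add: radial_def[abs_def] radial_deriv_def)
  have "((\<lambda>z::('m, 'k) pt. (norm (fst z))\<^sup>2 - a\<^sup>2) has_derivative (\<lambda>h. 2 * (fst z \<bullet> fst h))) (at z)"
    unfolding power2_norm_eq_inner by (auto intro!: derivative_eq_intros simp: inner_commute)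
  from has_derivative_compose[OF this pos_part_powr_deriv[OF p, unfolded has_field_derivative_def]]
  have 2: "((\<lambda>z. \<sigma> z powr p) has_derivative (\<lambda>h. p * \<sigma> z powr (p - 1) * (2 * (fst z \<bullet> fst h)))) (at z)"
    by (simp add: \<sigma>_def[abs_def])
  have "((\<lambda>z. radial (L z) * \<sigma> z powr p) has_derivative (\<lambda>h. grad_Psi z \<bullet> h)) (at z)"
    using has_derivative_mult[OF 1 2]
    by (rule has_derivative_eq_rhs)
       (use True in \<open>simp add: fun_eq_iff grad_Psi_def inner_add_left inner_Pair_0 algebra_simps\<close>)
  then show ?thesis
    by (rule has_derivative_transform_within_open[OF _ open_off_axis True]) (simp add: \<Psi>_def)
next
  case False
  have o: "open (- supp_set)" using compact_supp_set by (simp add: compact_imp_closed open_Compl)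
  have zS: "z \<in> - supp_set" using False supp_set_subset by blast
  have "((\<lambda>z. 0) has_derivative (\<lambda>h. grad_Psi z \<bullet> h)) (at z)" using False by (simp add: grad_Psi_def)
  then show ?thesis
  proof (rule has_derivative_transform_within_open[OF _ o zS])
    fix y assume "y \<in> - supp_set"
    then show "0 = \<Psi> y" using off_supp_set[of y] by (auto simp: \<Psi>_def radial_def)
  qed
qed

lemma continuous_L: "continuous_on off_axis L"
  unfolding L_def[abs_def] by (intro continuous_intros continuous_rho[OF \<gamma>]) (use R in \<open>auto simp: off_axis_iff\<close>)

lemma continuous_profile: "continuous_on off_axis (\<lambda>z. profile N (L z))"
  unfolding profile_def by (intro continuous_intros continuous_L) (use N0 in \<open>auto simp: L_neq0\<close>)

lemma continuous_\<sigma>: "continuous_on X \<sigma>"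
  unfolding \<sigma>_def[abs_def] by (intro continuous_intros)

lemma continuous_profile_powr: "q > 0 \<Longrightarrow> continuous_on off_axis (\<lambda>z. profile N (L z) powr q)"
  by (intro continuous_on_powr' continuous_profile continuous_on_const) (simp add: profile_bounds[OF N0])

lemma continuous_\<sigma>_powr: "q > 0 \<Longrightarrow> continuous_on X (\<lambda>z. \<sigma> z powr q)"
  by (intro continuous_on_powr' continuous_\<sigma> continuous_on_const) (simp add: \<sigma>_def)

lemma continuous_grad_Psi: "continuous_on UNIV grad_Psi"
proof -
  have cr: "continuous_on off_axis (grushin_rho \<gamma>)" by (rule continuous_rho[OF \<gamma>])
  have cg: "continuous_on off_axis (\<lambda>z. grushin_gauge \<gamma> z)"
    unfolding grushin_gauge_def by (intro continuous_intros) (auto simp: off_axis_iff)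
  have gp: "grushin_gauge \<gamma> z \<noteq> 0" if "z \<in> off_axis" for z using gauge_pos[of z \<gamma>] that by (simp add: off_axis_iff)
  have crg: "continuous_on off_axis (rho_grad \<gamma>)"
    unfolding rho_grad_def[abs_def] by (intro continuous_intros cr cg) (use gp in \<open>auto simp: off_axis_iff\<close>)
  have L0: "z \<in> off_axis \<Longrightarrow> L z \<noteq> 0" for z using L_pos[of z] by simp
  have lp: "continuous_on off_axis (\<lambda>z. L z powr q)" for q
    by (intro continuous_on_powr continuous_L continuous_on_const ballI L0)
  have p0: "p > 0" "p - 1 > 0" using p by auto
  have rn: "\<forall>z\<in>off_axis. grushin_rho \<gamma> z \<noteq> 0" by (auto simp: off_axis_iff)
  have Nn: "\<forall>z\<in>off_axis. N\<^sup>2 \<noteq> 0" using N0 by simp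
  have lnL: "continuous_on off_axis (\<lambda>z. ln (L z))"
    by (rule continuous_on_ln[OF continuous_L]) (use L0 in blast)
  have cd: "continuous_on off_axis (\<lambda>z. radial_deriv (L z))"
    unfolding radial_deriv_def
    by (intro continuous_on_mult continuous_on_diff continuous_on_divide continuous_on_add continuous_on_const
        lp continuous_profile continuous_profile_powr lnL p0 Nn)
  have cf: "continuous_on off_axis (\<lambda>z. radial (L z))"
    unfolding radial_def by (intro continuous_on_mult lp continuous_profile_powr p0)
  have "continuous_on off_axis (\<lambda>z. (radial_deriv (L z) * \<sigma> z powr p * (- 1 / grushin_rho \<gamma> z)) *\<^sub>R rho_grad \<gamma> z
     + (radial (L z) * (p * \<sigma> z powr (p - 1) * 2)) *\<^sub>R (fst z, 0))"
    by (intro continuous_on_add continuous_on_scaleR continuous_on_mult cd cf continuous_\<sigma>_powr p0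
        continuous_on_divide continuous_on_const cr rn crg continuous_on_Pair continuous_on_fst continuous_on_id)
  then have c1: "continuous_on off_axis grad_Psi" by (rule continuous_on_eq) (simp add: grad_Psi_def)
  have c2: "continuous_on (- supp_set) grad_Psi"
    by (rule continuous_on_eq[OF continuous_on_const[of _ 0]]) (simp add: grad_Psi_off_supp_set)
  have "open (- supp_set)" using compact_supp_set by (simp add: compact_imp_closed open_Compl)
  from continuous_on_open_Un[OF open_off_axis this c1 c2] have "continuous_on (off_axis \<union> - supp_set) grad_Psi" .
  moreover have "off_axis \<union> - supp_set = UNIV" using supp_set_subset by blast
  ultimately show ?thesis by simp
qed

lemma cutoff_\<Psi>: "cutoff supp_set \<Psi> (\<lambda>z h. grad_Psi z \<bullet> h)"
proof
  show "compact supp_set" by (rule compact_supp_set)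
  show "(\<Psi> has_derivative (\<lambda>h. grad_Psi z \<bullet> h)) (at z)" for z by (rule \<Psi>_deriv)
  show "continuous_on UNIV (\<lambda>z. grad_Psi z \<bullet> b)" for b by (intro continuous_intros continuous_grad_Psi)
  show "z \<notin> supp_set \<Longrightarrow> \<Psi> z = 0" for z using off_supp_set[of z] by (auto simp: \<Psi>_def radial_def)
qed

lemma \<Psi>_eq: "z \<in> off_axis \<Longrightarrow> \<Psi> z = (L z powr s * profile N (L z) * \<sigma> z) powr p"
  using profile_bounds(1)[OF N0, of "L z"] by (simp add: \<Psi>_def radial_def \<sigma>_def powr_mult powr_powr)

lemma x_le: "z \<in> off_axis \<Longrightarrow> norm (fst z) \<le> grushin_rho \<gamma> z \<and> norm (fst z) < R"
  using norm_fst_le_rho[OF \<gamma>, of z] by (auto simp: off_axis_iff)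

lemma \<sigma>_le: "z \<in> off_axis \<Longrightarrow> 0 \<le> \<sigma> z \<and> \<sigma> z \<le> R\<^sup>2"
proof -
  assume "z \<in> off_axis"
  then have "(norm (fst z))\<^sup>2 \<le> R\<^sup>2" using x_le[of z] by (intro power_mono) auto
  then have "(norm (fst z))\<^sup>2 - a\<^sup>2 \<le> R\<^sup>2" using zero_le_power2[of a] by linarith
  then show ?thesis by (simp add: \<sigma>_def)
qed

lemma \<Psi>_bounds: "0 \<le> \<Psi> z" "\<Psi> z \<le> (R\<^sup>2) powr p"
proof -
  show "0 \<le> \<Psi> z" by (simp add: \<Psi>_def radial_def)
  show "\<Psi> z \<le> (R\<^sup>2) powr p"
  proof (cases "z \<in> supp_set")
    case True
    then have z: "z \<in> off_axis" using supp_set_subset by blast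
    have "L z \<le> 1" using supp_set_iff[OF z] True by blast
    then have "L z powr s \<le> 1" using L_pos[OF z] s powr_mono2[of s "L z" 1] by simp
    then have "L z powr s * profile N (L z) * \<sigma> z \<le> 1 * 1 * R\<^sup>2"
      using profile_bounds[OF N0, of "L z"] \<sigma>_le[OF z] by (intro mult_mono) auto
    then show ?thesis unfolding \<Psi>_eq[OF z]
      using p profile_bounds[OF N0, of "L z"] \<sigma>_le[OF z] by (intro powr_mono2) auto
  next
    case False
    then show ?thesis using cutoff.supp[OF cutoff_\<Psi> False] by simp
  qed
qed

lemma P_nonneg: "P z \<ge> 0" using rho_nonneg[of \<gamma> z] by (simp add: P_def)

lemma A_nonneg: "A z \<ge> 0"
  unfolding A_def using s N0 R P_nonneg[of z] profile_bounds(1)[OF N0, of "L z"]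
  by (intro add_nonneg_nonneg mult_nonneg_nonneg divide_nonneg_nonneg) (auto simp: \<sigma>_def)

text \<open>This is \<open>|\<nabla>\<^sub>\<gamma> \<phi>\<^sup>p| = p \<phi>\<^sup>p\<^sup>-\<^sup>1 |\<nabla>\<^sub>\<gamma> \<phi>|\<close>, written with \<open>\<Psi> = \<phi>\<^sup>p\<close> alone.\<close>

lemma norm_horizontal_grad_Psi:
  assumes zS: "z \<in> supp_set"
  shows "norm (horizontal \<gamma> z (grad_Psi z)) \<le> p * \<Psi> z powr ((p - 1) / p) * A z"
proof -
  have z: "z \<in> off_axis" using zS supp_set_subset by blast
  define l where "l = L z"
  define k where "k = profile N l"
  have l: "l > 0" "l \<le> 1" "exp (- N) \<le> l" using L_pos[OF z] supp_set_iff[OF z] zS by (auto simp: l_def)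
  have k: "0 \<le> k" using profile_bounds(1)[OF N0] by (simp add: k_def)
  have \<sigma>0: "0 \<le> \<sigma> z" using \<sigma>_le[OF z] by simp
  have rho: "grushin_rho \<gamma> z > 0" and x0: "fst z \<noteq> 0" using z by (auto simp: off_axis_iff)
  have lin: "horizontal \<gamma> z (c1 *\<^sub>R v1 + c2 *\<^sub>R v2) = c1 *\<^sub>R horizontal \<gamma> z v1 + c2 *\<^sub>R horizontal \<gamma> z v2" for c1 c2 v1 v2
    by (simp add: horizontal_def scaleR_add_right mult.commute)
  have nP: "norm (horizontal \<gamma> z (rho_grad \<gamma> z)) / grushin_rho \<gamma> z = P z"
    using norm_horizontal_rho_grad[OF \<gamma> x0] by (simp add: P_def)
  have nx: "norm (horizontal \<gamma> z (fst z, 0)) \<le> R"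
    using x_le[OF z] by (simp add: horizontal_def norm_Pair)
  have ln: "\<bar>(N + 2 * ln l) / N\<^sup>2\<bar> \<le> 1 / N"
  proof -
    have "- N \<le> ln l" using l by (simp add: ln_ge_iff)
    moreover have "ln l \<le> 0" using l by simp
    ultimately have "\<bar>N + 2 * ln l\<bar> \<le> N" by linarith
    then have "\<bar>N + 2 * ln l\<bar> / N\<^sup>2 \<le> N / N\<^sup>2" by (intro divide_right_mono) auto
    then show ?thesis using N0 by (simp add: power2_eq_square)
  qed
  have \<sigma>p: "\<sigma> z powr p = \<sigma> z powr (p - 1) * \<sigma> z"
    by (cases "\<sigma> z = 0") (use p \<sigma>0 in \<open>auto simp: powr_diff\<close>)
  have kp: "k powr p = k powr (p - 1) * k"
    by (cases "k = 0") (use p k in \<open>auto simp: powr_diff\<close>)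
  define E where "E = (l powr s) powr (p - 1) * k powr (p - 1) * \<sigma> z powr (p - 1)"
  have E: "\<Psi> z powr ((p - 1) / p) = E"
    unfolding \<Psi>_eq[OF z] E_def using p k \<sigma>0
    by (simp add: powr_powr powr_mult l_def k_def)
  have E0: "E \<ge> 0" by (simp add: E_def)
  have lp: "l powr (s * p - 1) = (l powr s) powr (p - 1) * l powr (s - 1)"
    using l by (simp add: powr_powr powr_add[symmetric] algebra_simps)
  have lp2: "l powr (s * p) = (l powr s) powr (p - 1) * l powr s"
    using l by (simp add: powr_powr powr_add[symmetric] algebra_simps)
  have b1: "\<bar>radial_deriv l\<bar> * \<sigma> z powr p * P z \<le> p * E * (s * (\<sigma> z * P z * k * l powr (s - 1)) + \<sigma> z * P z * l powr (s - 1) / N)"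
  proof -
    have "\<bar>s * k - (N + 2 * ln l) / N\<^sup>2\<bar> \<le> s * k + 1 / N"
      using ln s k abs_triangle_ineq4[of "s * k" "(N + 2 * ln l) / N\<^sup>2"] by simp
    then have "\<bar>radial_deriv l\<bar> \<le> p * (l powr (s * p - 1) * k powr (p - 1)) * (s * k + 1 / N)"
      unfolding radial_deriv_def k_def[symmetric] abs_mult using p by (intro mult_mono) auto
    then have "\<bar>radial_deriv l\<bar> * (\<sigma> z powr p * P z) \<le> p * (l powr (s * p - 1) * k powr (p - 1)) * (s * k + 1 / N) * (\<sigma> z powr p * P z)"
      using P_nonneg[of z] by (intro mult_right_mono) auto
    also have "\<dots> = p * E * (s * (\<sigma> z * P z * k * l powr (s - 1)) + \<sigma> z * P z * l powr (s - 1) / N)"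
      unfolding lp \<sigma>p E_def by (simp add: algebra_simps)
    finally show ?thesis by (simp add: mult.assoc)
  qed
  have b2: "radial l * (p * \<sigma> z powr (p - 1) * 2) * R = p * E * (2 * R * (l powr s * k))"
    unfolding radial_def k_def[symmetric] lp2 kp E_def by (simp add: algebra_simps)
  have radial0: "radial l \<ge> 0" by (simp add: radial_def)
  have "norm (horizontal \<gamma> z (grad_Psi z)) \<le> norm ((radial_deriv l * \<sigma> z powr p * (- 1 / grushin_rho \<gamma> z)) *\<^sub>R horizontal \<gamma> z (rho_grad \<gamma> z))
      + norm ((radial l * (p * \<sigma> z powr (p - 1) * 2)) *\<^sub>R horizontal \<gamma> z (fst z, 0))"
    using z unfolding grad_Psi_def l_def by (simp only: if_True lin norm_triangle_ineq)
  also have "\<dots> = \<bar>radial_deriv l\<bar> * \<sigma> z powr p * P z + radial l * (p * \<sigma> z powr (p - 1) * 2) * norm (horizontal \<gamma> z (fst z, 0))"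
    using rho p radial0 unfolding nP[symmetric] by (simp add: abs_mult)
  also have "\<dots> \<le> p * E * (s * (\<sigma> z * P z * k * l powr (s - 1)) + \<sigma> z * P z * l powr (s - 1) / N) + radial l * (p * \<sigma> z powr (p - 1) * 2) * R"
    using b1 nx radial0 p by (intro add_mono mult_left_mono) auto
  also have "\<dots> = p * E * A z" unfolding b2 A_def l_def[symmetric] k_def[symmetric] by (simp add: algebra_simps)
  finally show ?thesis unfolding E .
qed

end

section \<open>Divergence of the energy and nonexistence\<close>

text \<open>Convexity of the \<open>p\<close>-th power, as the sum of two instances of Young's inequality with weights \<open>\<theta>\<close> and \<open>1 - \<theta>\<close>. For \<open>\<theta>\<close> near \<open>1\<close> the
  first summand is hardly enlarged.\<close>

lemma powr_add_split:
  fixes a b \<theta> p :: real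
  assumes "a \<ge> 0" "b \<ge> 0" "0 < \<theta>" "\<theta> < 1" "p > 1"
  shows "(a + b) powr p \<le> \<theta> powr (1 - p) * a powr p + (1 - \<theta>) powr (1 - p) * b powr p"
proof -
  have half: "p * (a + b) powr (p - 1) * x \<le> t * ((p - 1) * (a + b) powr p) + t powr (1 - p) * x powr p"
    if "x \<ge> 0" "t > 0" for x t
  proof -
    have "p * (a + b) powr (p - 1) * (x / t) \<le> (p - 1) * (a + b) powr p + (x / t) powr p"
      using assms that by (intro young_powr) auto
    from mult_left_mono[OF this, of t] that
    have "p * (a + b) powr (p - 1) * x \<le> t * ((p - 1) * (a + b) powr p) + t * (x / t) powr p"
      by (simp add: field_simps)
    also have "t * (x / t) powr p = t powr (1 - p) * x powr p"
    proof -
      have "(x / t) powr p = x powr p / t powr p" by (rule powr_divide)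
      then show ?thesis using that by (simp add: powr_diff)
    qed
    finally show ?thesis .
  qed
  have "p * (a + b) powr (p - 1) * (a + b) = p * (a + b) powr p"
    by (cases "a + b = 0") (use assms in \<open>auto simp: powr_diff\<close>)
  then have "p * (a + b) powr p = p * (a + b) powr (p - 1) * a + p * (a + b) powr (p - 1) * b"
    by (simp add: distrib_left)
  also have "\<dots> \<le> (\<theta> * ((p - 1) * (a + b) powr p) + \<theta> powr (1 - p) * a powr p)
      + ((1 - \<theta>) * ((p - 1) * (a + b) powr p) + (1 - \<theta>) powr (1 - p) * b powr p)"
    using assms by (intro add_mono half) auto
  also have "\<dots> = (p - 1) * (a + b) powr p + (\<theta> powr (1 - p) * a powr p + (1 - \<theta>) powr (1 - p) * b powr p)"
    by (simp add: algebra_simps)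
  finally show ?thesis by (simp add: algebra_simps)
qed

context boundary_test
begin

lemma weight_eq: "rpow (norm (fst z)) (\<gamma> * p) / grushin_rho \<gamma> z powr (\<gamma> * p + p) = P z powr p" if "z \<in> off_axis"
proof -
  have x: "norm (fst z) > 0" and r: "grushin_rho \<gamma> z > 0" using that by (auto simp: off_axis_iff)
  have "P z powr p = ((norm (fst z) / grushin_rho \<gamma> z) powr \<gamma>) powr p / grushin_rho \<gamma> z powr p"
    unfolding P_def by (rule powr_divide)
  also have "((norm (fst z) / grushin_rho \<gamma> z) powr \<gamma>) powr p = norm (fst z) powr (\<gamma> * p) / grushin_rho \<gamma> z powr (\<gamma> * p)"
    unfolding powr_powr by (rule powr_divide)
  finally show ?thesis using x r by (simp add: rpow_eq powr_add)
qed

lemma P_le: "z \<in> supp_set \<Longrightarrow> P z \<le> exp 1 / R"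
proof -
  assume zS: "z \<in> supp_set"
  then have z: "z \<in> off_axis" using supp_set_subset by blast
  have r: "grushin_rho \<gamma> z > 0" "R * exp (- 1) \<le> grushin_rho \<gamma> z" using z zS by (auto simp: off_axis_iff supp_set_def)
  have "(norm (fst z) / grushin_rho \<gamma> z) powr \<gamma> \<le> 1 powr \<gamma>"
    using x_le[OF z] r \<gamma> by (intro powr_mono2) auto
  then have "P z \<le> 1 / grushin_rho \<gamma> z" unfolding P_def using r by (intro divide_right_mono) auto
  also have "\<dots> \<le> 1 / (R * exp (- 1))" using r R by (intro divide_left_mono) auto
  finally show ?thesis by (simp add: exp_minus field_simps)
qed

text \<open>With \<open>\<alpha> = -1 - s p\<close> both \<open>V \<phi>\<^sup>p\<close> and the leading part of \<open>w |\<nabla>\<^sub>\<gamma> \<phi>|\<^sup>p\<close> are multiples of \<open>(\<sigma> P profile)\<^sup>p / L\<close>, with the factors \<open>c\<close> and \<open>s\<^sup>p\<close>. The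
  part from \<open>profile\<close> is smaller by the factor \<open>1/N\<close>, and the part from \<open>\<sigma>\<close> is bounded, since it carries \<open>L\<^sup>p\<^sup>-\<^sup>1\<close>
  instead of \<open>1/L\<close>.\<close>

lemma pointwise_lower_bound:
  assumes zS: "z \<in> supp_set" and \<alpha>: "\<alpha> = - 1 - s * p" and \<theta>: "0 < \<theta>" "\<theta> < 1"
  shows "(c - \<theta> powr (1 - p) * s powr p) * (\<sigma> z * P z * profile N (L z)) powr p / L z
      - (1 - \<theta>) powr (1 - p) * (1/2) powr (1 - p) * ((R * exp 1) powr p + (2 * R) powr p) * (1 / (N * L z) + 1)
    \<le> c * L z powr \<alpha> * (rpow (norm (fst z)) (\<gamma> * p) / grushin_rho \<gamma> z powr (\<gamma> * p + p)) * \<Psi> z - L z powr (\<alpha> + p) * A z powr p"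
proof -
  have z: "z \<in> off_axis" using zS supp_set_subset by blast
  define l where "l = L z"
  define k where "k = profile N l"
  define q where "q = \<sigma> z * P z"
  have l: "l > 0" "l \<le> 1" using L_pos[OF z] supp_set_iff[OF z] zS by (auto simp: l_def)
  have k: "0 \<le> k" "k \<le> 1" using profile_bounds[OF N0] by (simp_all add: k_def)
  have \<sigma>0: "0 \<le> \<sigma> z" "\<sigma> z \<le> R\<^sup>2" using \<sigma>_le[OF z] by auto
  have q0: "q \<ge> 0" unfolding q_def using \<sigma>0 P_nonneg[of z] by simp
  have "q \<le> R\<^sup>2 * (exp 1 / R)" unfolding q_def using \<sigma>0 P_le[OF zS] P_nonneg[of z] by (intro mult_mono) auto
  then have q1: "q \<le> R * exp 1" using R by (simp add: power2_eq_square)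
  have l1: "l powr a1 * l powr a2 = l powr (a1 + a2)" for a1 a2 by (simp add: powr_add)
  have lm: "l powr (- 1) = 1 / l" using l by (simp add: powr_minus_divide)
  have VP: "c * l powr \<alpha> * P z powr p * \<Psi> z = c * (q * k) powr p / l"
  proof -
    have "\<Psi> z = l powr (s * p) * (k powr p * \<sigma> z powr p)"
      unfolding \<Psi>_eq[OF z] l_def[symmetric] k_def[symmetric] using k \<sigma>0 by (simp add: powr_mult powr_powr)
    then have "c * l powr \<alpha> * P z powr p * \<Psi> z = c * (l powr \<alpha> * l powr (s * p)) * (P z powr p * k powr p * \<sigma> z powr p)"
      by (simp add: mult_ac)
    also have "l powr \<alpha> * l powr (s * p) = 1 / l" unfolding l1 using lm \<alpha> by simp
    also have "P z powr p * k powr p * \<sigma> z powr p = (q * k) powr p"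
      using k \<sigma>0 P_nonneg[of z] by (simp add: q_def powr_mult)
    finally show ?thesis by simp
  qed
  define X where "X = s * (q * k * l powr (s - 1))"
  define Y1 where "Y1 = q * l powr (s - 1) / N"
  define Y2 where "Y2 = 2 * R * (l powr s * k)"
  have pos: "X \<ge> 0" "Y1 \<ge> 0" "Y2 \<ge> 0" using s q0 k N0 R by (auto simp: X_def Y1_def Y2_def)
  have A: "A z = X + (Y1 + Y2)" by (simp add: A_def X_def Y1_def Y2_def q_def k_def l_def)
  have e1: "\<alpha> + p + (s - 1) * p = - 1" and e2: "\<alpha> + p + s * p = p - 1" using \<alpha> by (auto simp: algebra_simps)
  have wX: "l powr (\<alpha> + p) * X powr p = s powr p * (q * k) powr p / l"
  proof -
    have "X powr p = s powr p * ((q * k) powr p * l powr ((s - 1) * p))"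
      unfolding X_def using s q0 k by (simp add: powr_mult powr_powr)
    then have "l powr (\<alpha> + p) * X powr p = s powr p * (q * k) powr p * (l powr (\<alpha> + p) * l powr ((s - 1) * p))" by (simp only: mult_ac)
    also have "l powr (\<alpha> + p) * l powr ((s - 1) * p) = 1 / l" unfolding l1 e1 by (rule lm)
    finally show ?thesis by simp
  qed
  have wY1: "l powr (\<alpha> + p) * Y1 powr p \<le> (R * exp 1) powr p * (1 / (N * l))"
  proof -
    have "Y1 powr p = q powr p * l powr ((s - 1) * p) / N powr p"
      unfolding Y1_def powr_divide using q0 by (simp add: powr_mult powr_powr)
    then have "l powr (\<alpha> + p) * Y1 powr p = q powr p * (l powr (\<alpha> + p) * l powr ((s - 1) * p)) * (1 / N powr p)" by simp
    also have "l powr (\<alpha> + p) * l powr ((s - 1) * p) = 1 / l" unfolding l1 e1 by (rule lm)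
    also have "q powr p * (1 / l) * (1 / N powr p) \<le> (R * exp 1) powr p * (1 / l) * (1 / N)"
    proof (intro mult_mono)
      show "q powr p \<le> (R * exp 1) powr p" using q0 q1 p by (intro powr_mono2) auto
      have "N powr 1 \<le> N powr p" using N p by (intro powr_mono) auto
      then show "1 / N powr p \<le> 1 / N" using N0 by (intro divide_left_mono) auto
    qed (use l N0 in auto)
    finally show ?thesis by (simp add: mult.commute)
  qed
  have wY2: "l powr (\<alpha> + p) * Y2 powr p \<le> (2 * R) powr p * 1"
  proof -
    have "Y2 powr p = (2 * R) powr p * (l powr (s * p) * k powr p)"
      unfolding Y2_def using R k by (simp add: powr_mult powr_powr)
    then have "l powr (\<alpha> + p) * Y2 powr p = (2 * R) powr p * ((l powr (\<alpha> + p) * l powr (s * p)) * k powr p)" by (simp add: mult_ac)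
    also have "l powr (\<alpha> + p) * l powr (s * p) = l powr (p - 1)" unfolding l1 e2 ..
    also have "(2 * R) powr p * (l powr (p - 1) * k powr p) \<le> (2 * R) powr p * (1 * 1)"
    proof (intro mult_left_mono mult_mono)
      show "l powr (p - 1) \<le> 1" using l p powr_mono2[of "p - 1" l 1] by simp
      show "k powr p \<le> 1" using k p powr_mono2[of p k 1] by simp
    qed auto
    finally show ?thesis by simp
  qed
  define c1 where "c1 = (1 - \<theta>) powr (1 - p)"
  define c2 where "c2 = (1/2 :: real) powr (1 - p)"
  have c12: "c1 \<ge> 0" "c2 \<ge> 0" by (simp_all add: c1_def c2_def)
  have "(Y1 + Y2) powr p \<le> c2 * Y1 powr p + c2 * Y2 powr p"
    using powr_add_split[OF pos(2,3), of "1/2" p] p by (simp add: c2_def)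
  then have "A z powr p \<le> \<theta> powr (1 - p) * X powr p + c1 * (c2 * Y1 powr p + c2 * Y2 powr p)"
    using powr_add_split[OF pos(1) add_nonneg_nonneg[OF pos(2,3)] \<theta> p] mult_left_mono[of "(Y1 + Y2) powr p" _ c1] c12
    unfolding A c1_def[symmetric] by fastforce
  then have "l powr (\<alpha> + p) * A z powr p \<le> l powr (\<alpha> + p) * (\<theta> powr (1 - p) * X powr p + c1 * (c2 * Y1 powr p + c2 * Y2 powr p))"
    by (rule mult_left_mono) simp
  also have "\<dots> = \<theta> powr (1 - p) * (l powr (\<alpha> + p) * X powr p) + c1 * c2 * (l powr (\<alpha> + p) * Y1 powr p + l powr (\<alpha> + p) * Y2 powr p)"
    by (simp add: algebra_simps)
  also have "\<dots> \<le> \<theta> powr (1 - p) * (s powr p * (q * k) powr p / l) + c1 * c2 * ((R * exp 1) powr p * (1 / (N * l)) + (2 * R) powr p * 1)"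
    using wY1 wY2 c12 unfolding wX by (intro add_left_mono mult_left_mono add_mono) auto
  also have "\<dots> \<le> \<theta> powr (1 - p) * (s powr p * (q * k) powr p / l)
      + c1 * c2 * (((R * exp 1) powr p + (2 * R) powr p) * (1 / (N * l) + 1))"
  proof -
    have "0 \<le> (R * exp 1) powr p" "0 \<le> (2 * R) powr p * (1 / (N * l))" using l N0 by auto
    then have "(R * exp 1) powr p * (1 / (N * l)) + (2 * R) powr p * 1 \<le> ((R * exp 1) powr p + (2 * R) powr p) * (1 / (N * l) + 1)"
      unfolding distrib_left distrib_right by linarith
    then show ?thesis using c12 by (intro add_left_mono mult_left_mono) auto
  qed
  finally have wA: "l powr (\<alpha> + p) * A z powr p \<le> \<theta> powr (1 - p) * (s powr p * (q * k) powr p / l)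
      + c1 * c2 * (((R * exp 1) powr p + (2 * R) powr p) * (1 / (N * l) + 1))" .
  have split: "(c - \<theta> powr (1 - p) * s powr p) * (q * k) powr p / l
      = c * (q * k) powr p / l - \<theta> powr (1 - p) * (s powr p * (q * k) powr p / l)"
    by (simp add: left_diff_distrib diff_divide_distrib)
  show ?thesis
    unfolding weight_eq[OF z] l_def[symmetric] VP k_def[symmetric] q_def[symmetric] split c1_def[symmetric] c2_def[symmetric]
    using wA unfolding mult.assoc by linarith
qed

lemma integrable_energy:
  "integrable lborel (\<lambda>z. (c * L z powr \<alpha> * (rpow (norm (fst z)) (\<gamma> * p) / grushin_rho \<gamma> z powr (\<gamma> * p + p))) * \<Psi> z
     - L z powr \<beta> * (indicator supp_set z * A z) powr p)"
proof -
  have cr: "continuous_on off_axis (grushin_rho \<gamma>)" by (rule continuous_rho[OF \<gamma>])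
  have rn: "\<forall>z\<in>off_axis. grushin_rho \<gamma> z \<noteq> 0" by (auto simp: off_axis_iff)
  have rpn: "\<forall>z\<in>off_axis. grushin_rho \<gamma> z powr (\<gamma> * p + p) \<noteq> 0" by (auto simp: off_axis_iff)
  have lp: "continuous_on off_axis (\<lambda>z. L z powr q)" for q
    by (rule continuous_on_powr[OF continuous_L continuous_on_const]) (use L_neq0 in blast)
  have crp: "continuous_on off_axis (\<lambda>z. grushin_rho \<gamma> z powr q)" for q
    by (rule continuous_on_powr[OF cr continuous_on_const rn])
  have cx: "continuous_on off_axis (\<lambda>z. rpow (norm (fst z)) (\<gamma> * p))"
    by (rule continuous_rpow_norm) (use \<gamma> p in \<open>auto intro!: continuous_intros\<close>)
  have c\<Psi>: "continuous_on off_axis \<Psi>" by (rule continuous_on_subset[OF cutoff.cont[OF cutoff_\<Psi>]]) simp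
  have cxn: "continuous_on off_axis (\<lambda>z. norm (fst z))" by (intro continuous_intros)
  have cq: "continuous_on off_axis (\<lambda>z. norm (fst z) / grushin_rho \<gamma> z)" by (rule continuous_on_divide[OF cxn cr rn])
  have cP: "continuous_on off_axis P"
    unfolding P_def[abs_def]
    by (rule continuous_on_divide[OF continuous_on_powr[OF cq continuous_on_const] cr rn]) (auto simp: off_axis_iff)
  have Nn: "\<forall>z\<in>off_axis. N \<noteq> 0" using N0 by simp
  have cA: "continuous_on off_axis A"
    unfolding A_def[abs_def]
    by (intro continuous_on_add continuous_on_mult continuous_on_divide continuous_on_const continuous_\<sigma> cP
        continuous_profile lp Nn)
  have cAp: "continuous_on off_axis (\<lambda>z. A z powr p)"
    by (rule continuous_on_powr'[OF cA continuous_on_const]) (use A_nonneg p in auto)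
  let ?f = "\<lambda>z. (c * L z powr \<alpha> * (rpow (norm (fst z)) (\<gamma> * p) / grushin_rho \<gamma> z powr (\<gamma> * p + p))) * \<Psi> z - L z powr \<beta> * A z powr p"
  have "continuous_on off_axis ?f"
    by (intro continuous_on_diff continuous_on_mult continuous_on_divide continuous_on_const lp cx crp rpn c\<Psi> cAp)
  then have "integrable lborel (\<lambda>z. indicator supp_set z *\<^sub>R ?f z)"
    by (intro borel_integrable_compact[OF compact_supp_set]) (rule continuous_on_subset[OF _ supp_set_subset])
  moreover have "indicator supp_set z *\<^sub>R ?f z = (c * L z powr \<alpha> * (rpow (norm (fst z)) (\<gamma> * p) / grushin_rho \<gamma> z powr (\<gamma> * p + p))) * \<Psi> z
     - L z powr \<beta> * (indicator supp_set z * A z) powr p" for z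
    using cutoff.supp[OF cutoff_\<Psi>, of z] p by (cases "z \<in> supp_set") auto
  ultimately show ?thesis by simp
qed

text \<open>Integrate the pointwise bound shell by shell. In the \<open>2 M\<close> shells in the middle of the range of \<open>profile\<close>, and in a cone around
  \<open>y = 0\<close>, the factors \<open>\<sigma>\<close>, \<open>P\<close> and \<open>profile\<close> are bounded below, so each shell contributes a fixed positive amount. The error
  \<open>1/(N L)\<close> is integrated over about \<open>N\<close> shells and stays bounded.\<close>

lemma energy_lower_bound:
  assumes M: "M \<ge> 1" "N = 4 * real M" and a': "a = R * exp (- 1) / 4"
    and \<alpha>: "\<alpha> = - 1 - s * p" and \<theta>: "0 < \<theta>" "\<theta> < 1" and \<kappa>: "\<kappa> = c - \<theta> powr (1 - p) * s powr p" "\<kappa> \<ge> 0"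
    and Q: "Q = real CARD('m) + (1 + \<gamma>) * real CARD('k)"
    and C6: "C6 = (1 - \<theta>) powr (1 - p) * (1/2) powr (1 - p) * ((R * exp 1) powr p + (2 * R) powr p)"
    and c7: "c7 = (3 * a\<^sup>2 * ((1/2) powr \<gamma> / R) * (3/16)) powr p"
    and V\<Gamma>: "V\<Gamma> = R powr Q * measure lborel ({z::('m, 'k) pt. norm (fst z) > grushin_rho \<gamma> z / 2} \<inter> {z. grushin_rho \<gamma> z < 1})"
    and V1: "V1 = R powr Q * measure lborel ((UNIV :: ('m, 'k) pt set) \<inter> {z. grushin_rho \<gamma> z < 1})"
  shows "\<kappa> * c7 * (V\<Gamma> * Q * exp (- Q) * (1 - exp (- 1))) * (2 * real M)
      - C6 * (2 * exp 1 * (V1 * Q) + measure lborel (grushin_ball \<gamma> R :: ('m, 'k) pt set))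
    \<le> (LINT z|lborel. (c * L z powr \<alpha> * (rpow (norm (fst z)) (\<gamma> * p) / grushin_rho \<gamma> z powr (\<gamma> * p + p))) * \<Psi> z
     - L z powr (\<alpha> + p) * (indicator supp_set z * A z) powr p)" (is "_ \<le> (LINT z|lborel. ?\<Theta> z)")
proof -
  let ?\<Gamma> = "{z::('m, 'k) pt. norm (fst z) > grushin_rho \<gamma> z / 2}"
  let ?\<Omega> = "grushin_ball \<gamma> R :: ('m, 'k) pt set"
  have [measurable]: "(\<lambda>z::('m,'k) pt. grushin_rho \<gamma> z) \<in> borel_measurable borel"
    using continuous_rho[OF \<gamma>] by (rule borel_measurable_continuous_onI)
  have [measurable]: "(\<lambda>z::('m,'k) pt. norm (fst z)) \<in> borel_measurable borel"
    by (intro borel_measurable_continuous_onI continuous_intros)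
  have \<Gamma>b: "?\<Gamma> \<in> sets borel" by measurable
  have \<Gamma>inv: "(r *\<^sub>R fst z, r powr (1 + \<gamma>) *\<^sub>R snd z) \<in> ?\<Gamma> \<longleftrightarrow> z \<in> ?\<Gamma>" if "r > 0" for r and z :: "('m, 'k) pt"
    using that by (simp add: rho_dilation[OF \<gamma> that] field_simps)
  have Uinv: "(r *\<^sub>R fst z, r powr (1 + \<gamma>) *\<^sub>R snd z) \<in> UNIV \<longleftrightarrow> z \<in> UNIV" if "r > 0" for r and z :: "('m, 'k) pt" by simp
  note sm = shell_measure[OF \<gamma> R \<Gamma>b \<Gamma>inv Q V\<Gamma>]
  have UB: "(UNIV :: ('m, 'k) pt set) \<in> sets borel" by simp
  note su = shell_measure[OF \<gamma> R UB Uinv Q V1]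
  have C60: "C6 \<ge> 0" unfolding C6 by (intro mult_nonneg_nonneg add_nonneg_nonneg) auto
  have Qp: "Q > 0" unfolding Q using \<gamma> by (simp add: add_pos_nonneg)
  have \<Omega>fin: "emeasure lborel ?\<Omega> < \<infinity>"
    by (rule emeasure_bounded_finite, rule bounded_subset[OF bounded_rho_le[OF \<gamma>, of R]]) (auto simp: grushin_ball_def)
  have \<Omega>b: "?\<Omega> \<in> sets borel" by (rule borel_open[OF open_grushin_ball[OF \<gamma>]])
  define h1 where "h1 = (\<lambda>z. \<Sum>j\<in>{M..<3*M}. exp (real j) * indicator (?\<Gamma> \<inter> shell \<gamma> R j) z)"
  define h2 where "h2 = (\<lambda>z::('m, 'k) pt. \<Sum>j\<le>4*M. (exp (real (Suc j)) / N) * indicator (UNIV \<inter> shell \<gamma> R j) z)"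
  define h where "h = (\<lambda>z. \<kappa> * c7 * h1 z - C6 * (h2 z + indicator ?\<Omega> z))"
  have i1: "integrable lborel h1"
    unfolding h1_def by (intro Bochner_Integration.integrable_sum integrable_mult_right integrable_real_indicator) (use sm(3,4) in auto)
  have i2: "integrable lborel h2"
    unfolding h2_def by (intro Bochner_Integration.integrable_sum integrable_mult_right integrable_real_indicator) (use su(3,4) in auto)
  have i3: "integrable lborel (indicator ?\<Omega> :: _ \<Rightarrow> real)"
    by (rule integrable_real_indicator) (use \<Omega>b \<Omega>fin in auto)
  have ih: "integrable lborel h" unfolding h_def using i1 i2 i3 by simp
  have I1: "(LINT z|lborel. h1 z) \<ge> (V\<Gamma> * Q * exp (- Q) * (1 - exp (- 1))) * (2 * real M)"
  proof -
    have "(LINT z|lborel. h1 z) = (\<Sum>j\<in>{M..<3*M}. exp (real j) * measure lborel (?\<Gamma> \<inter> shell \<gamma> R j))"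
      unfolding h1_def
      by (subst Bochner_Integration.integral_sum)
         (use sm(3,4) in \<open>auto intro!: integrable_mult_right integrable_real_indicator\<close>)
    also have "\<dots> \<ge> (\<Sum>j\<in>{M..<3*M}. V\<Gamma> * Q * exp (- Q) * (1 - exp (- 1)))"
    proof (rule sum_mono)
      fix j
      have "V\<Gamma> * Q * exp (- Q) * (1 - exp (- 1)) = exp (real j) * (V\<Gamma> * Q * exp (- Q) * (1 - exp (- 1)) * exp (- real j))"
        by (simp add: exp_minus field_simps)
      also have "\<dots> \<le> exp (real j) * measure lborel (?\<Gamma> \<inter> shell \<gamma> R j)" by (intro mult_left_mono sm(2)) simp_all
      finally show "V\<Gamma> * Q * exp (- Q) * (1 - exp (- 1)) \<le> exp (real j) * measure lborel (?\<Gamma> \<inter> shell \<gamma> R j)" .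
    qed
    finally show ?thesis by (simp add: mult_ac)
  qed
  have I2: "(LINT z|lborel. h2 z) \<le> 2 * exp 1 * (V1 * Q)"
  proof -
    have V1Q: "V1 * Q \<ge> 0" unfolding V1 using Qp by simp
    have "(LINT z|lborel. h2 z) = (\<Sum>j\<le>4*M. (exp (real (Suc j)) / N) * measure lborel (UNIV \<inter> shell \<gamma> R j :: ('m, 'k) pt set))"
      unfolding h2_def
      by (subst Bochner_Integration.integral_sum)
         (use su(3,4) in \<open>auto intro!: integrable_mult_right integrable_real_indicator\<close>)
    also have "\<dots> \<le> (\<Sum>j\<le>4*M. exp 1 / N * (V1 * Q))"
    proof (rule sum_mono)
      fix j
      have "(exp (real (Suc j)) / N) * measure lborel (UNIV \<inter> shell \<gamma> R j :: ('m, 'k) pt set) \<le> (exp (real (Suc j)) / N) * (V1 * Q * exp (- real j))"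
        using N0 by (intro mult_left_mono su(1)) auto
      also have "\<dots> = exp 1 / N * (V1 * Q)" by (simp add: exp_minus exp_add field_simps)
      finally show "(exp (real (Suc j)) / N) * measure lborel (UNIV \<inter> shell \<gamma> R j :: ('m, 'k) pt set) \<le> exp 1 / N * (V1 * Q)" .
    qed
    also have "\<dots> = (N + 1) / N * (exp 1 * (V1 * Q))" using M(2) by (simp add: field_simps)
    also have "\<dots> \<le> 2 * (exp 1 * (V1 * Q))" using N V1Q by (intro mult_right_mono) (auto simp: divide_le_eq)
    finally show ?thesis by simp
  qed
  have c70: "c7 \<ge> 0" by (simp add: c7)
  have "\<kappa> * c7 * (V\<Gamma> * Q * exp (- Q) * (1 - exp (- 1))) * (2 * real M) - C6 * (2 * exp 1 * (V1 * Q) + measure lborel ?\<Omega>)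
      \<le> \<kappa> * c7 * (LINT z|lborel. h1 z) - C6 * ((LINT z|lborel. h2 z) + measure lborel ?\<Omega>)"
  proof (rule diff_mono)
    show "\<kappa> * c7 * (V\<Gamma> * Q * exp (- Q) * (1 - exp (- 1))) * (2 * real M) \<le> \<kappa> * c7 * (LINT z|lborel. h1 z)"
      using mult_left_mono[OF I1, of "\<kappa> * c7"] \<kappa>(2) c70 by (simp add: mult.assoc)
    show "C6 * ((LINT z|lborel. h2 z) + measure lborel ?\<Omega>) \<le> C6 * (2 * exp 1 * (V1 * Q) + measure lborel ?\<Omega>)"
      using I2 C60 by (intro mult_left_mono add_mono) auto
  qed
  also have "\<dots> = (LINT z|lborel. h z)" unfolding h_def using i1 i2 i3 by simp
  also have "\<dots> \<le> (LINT z|lborel. ?\<Theta> z)"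
  proof (rule integral_mono[OF ih integrable_energy])
    fix z :: "('m, 'k) pt"
    have h2nn: "h2 z \<ge> 0" unfolding h2_def using N0 by (intro sum_nonneg) auto
    have shell: "z \<in> shell \<gamma> R j \<longleftrightarrow> real j \<le> - ln (L z) \<and> - ln (L z) < real (Suc j)" if z: "z \<in> off_axis" for j
    proof -
      have l: "L z > 0" by (rule L_pos[OF z])
      have "z \<in> shell \<gamma> R j \<longleftrightarrow> exp (- real (Suc j)) < L z \<and> L z \<le> exp (- real j)"
        unfolding shell_iff[OF R] L_def[symmetric] using z by (simp add: off_axis_iff)
      also have "exp (- real (Suc j)) < L z \<longleftrightarrow> - real (Suc j) < ln (L z)" using l exp_less_cancel_iff[of _ "ln (L z)"] by simp
      also have "L z \<le> exp (- real j) \<longleftrightarrow> ln (L z) \<le> - real j" using l exp_le_cancel_iff[of "ln (L z)"] by simp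
      finally show ?thesis by auto
    qed
    show "h z \<le> ?\<Theta> z"
    proof (cases "z \<in> supp_set")
      case False
      have "h1 z = 0"
        unfolding h1_def
      proof (rule sum.neutral, rule ballI)
        fix j assume j: "j \<in> {M..<3*M}"
        have "z \<notin> ?\<Gamma> \<inter> shell \<gamma> R j"
        proof
          assume zz: "z \<in> ?\<Gamma> \<inter> shell \<gamma> R j"
          have r: "0 < grushin_rho \<gamma> z" "grushin_rho \<gamma> z < R * exp (- exp (- real (Suc j)))" "R * exp (- exp (- real j)) \<le> grushin_rho \<gamma> z"
            using zz shell_iff[OF R, of z \<gamma> j] by (auto simp: shell_def)
          have "R * exp (- 1) \<le> R * exp (- exp (- real j))" using R by simp
          then have r1: "R * exp (- 1) \<le> grushin_rho \<gamma> z" using r(3) by linarith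
          have "real (Suc j) \<le> N" using j M by simp
          then have "R * exp (- exp (- real (Suc j))) \<le> R * exp (- exp (- N))" using R by simp
          then have r2: "grushin_rho \<gamma> z \<le> R * exp (- exp (- N))" using r(2) by linarith
          have "a \<le> R * exp (- 1) / 2" unfolding a' using R by simp
          also have "\<dots> \<le> grushin_rho \<gamma> z / 2" using r1 by simp
          also have "\<dots> \<le> norm (fst z)" using zz by simp
          finally have "z \<in> supp_set" using r1 r2 by (simp add: supp_set_def)
          then show False using False by contradiction
        qed
        then show "exp (real j) * indicator (?\<Gamma> \<inter> shell \<gamma> R j) z = 0" by simp
      qed
      then have "h z \<le> 0" unfolding h_def using C60 h2nn by (simp add: mult_nonneg_nonneg)
      moreover have "?\<Theta> z = 0" using False cutoff.supp[OF cutoff_\<Psi> False] p by simp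
      ultimately show ?thesis by simp
    next
      case True
      then have z: "z \<in> off_axis" using supp_set_subset by blast
      define l where "l = L z"
      have l: "l > 0" "l \<le> 1" "exp (- N) \<le> l" using L_pos[OF z] supp_set_iff[OF z] True by (auto simp: l_def)
      define t where "t = - ln l"
      have t: "0 \<le> t" "t \<le> N"
      proof -
        show "0 \<le> t" using l by (simp add: t_def)
        have "- N \<le> ln l" using l by (simp add: ln_ge_iff)
        then show "t \<le> N" by (simp add: t_def)
      qed
      have lt: "l = exp (- t)" using l by (simp add: t_def)
      define j0 where "j0 = nat \<lfloor>t\<rfloor>"
      have j0: "real j0 \<le> t" "t < real (Suc j0)" 
      proof -
        have "real j0 = of_int \<lfloor>t\<rfloor>" using t(1) by (simp add: j0_def)
        then show "real j0 \<le> t" "t < real (Suc j0)"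
          using floor_correct[of t] by linarith+
      qed
      have mem: "z \<in> shell \<gamma> R j \<longleftrightarrow> j = j0" for j
        unfolding shell[OF z] l_def[symmetric] t_def[symmetric] using j0 by auto
      have "real j0 \<le> real (4 * M)" using j0(1) t(2) M(2) by simp
      then have j0M: "j0 \<le> 4 * M" by simp
      have h2: "h2 z \<ge> 1 / (N * l)"
      proof -
        have "h2 z = (\<Sum>j\<le>4*M. if j = j0 then exp (real (Suc j)) / N else 0)"
          unfolding h2_def by (rule sum.cong) (auto simp: mem indicator_def)
        also have "\<dots> = exp (real (Suc j0)) / N" using j0M by simp
        also have "\<dots> \<ge> exp t / N" using j0(2) N0 by (intro divide_right_mono) auto
        finally show ?thesis unfolding lt by (simp add: exp_minus field_simps)
      qed
      have z\<Omega>: "indicator ?\<Omega> z = (1::real)" using z by (simp add: off_axis_def)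
      have h1: "c7 * h1 z \<le> (\<sigma> z * P z * profile N l) powr p / l"
      proof (cases "z \<in> ?\<Gamma> \<and> j0 \<in> {M..<3*M}")
        case False
        have "h1 z = 0"
          unfolding h1_def by (rule sum.neutral) (use False in \<open>auto simp: mem indicator_def\<close>)
        then show ?thesis using l by simp
      next
        case zG: True
        have "h1 z = (\<Sum>j\<in>{M..<3*M}. if j = j0 then exp (real j) else 0)"
          unfolding h1_def by (rule sum.cong) (use zG in \<open>auto simp: mem indicator_def\<close>)
        also have "\<dots> = exp (real j0)" using zG by simp
        also have "\<dots> \<le> exp t" using j0(1) by simp
        also have "exp t = 1 / l" unfolding lt by (simp add: exp_minus field_simps)
        finally have h1l: "h1 z \<le> 1 / l" .
        have r: "0 < grushin_rho \<gamma> z" "grushin_rho \<gamma> z < R" "R * exp (- 1) \<le> grushin_rho \<gamma> z"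
          using z True by (auto simp: off_axis_iff supp_set_def)
        have x2: "2 * a \<le> norm (fst z)" using zG r(3) unfolding a' by simp
        have s3: "3 * a\<^sup>2 \<le> \<sigma> z"
        proof -
          have "(2 * a)\<^sup>2 \<le> (norm (fst z))\<^sup>2" using x2 a by (intro power_mono) auto
          then show ?thesis unfolding \<sigma>_def by (simp add: power_mult_distrib)
        qed
        have P3: "(1/2) powr \<gamma> / R \<le> P z"
        proof -
          have "1/2 \<le> norm (fst z) / grushin_rho \<gamma> z" using zG r(1) by (simp add: field_simps)
          then have "(1/2) powr \<gamma> \<le> (norm (fst z) / grushin_rho \<gamma> z) powr \<gamma>" using \<gamma> by (intro powr_mono2) auto
          then show ?thesis unfolding P_def by (rule frac_le[rotated]) (use r in auto)
        qed
        have k3: "3/16 \<le> profile N l"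
        proof -
          have "real M \<le> t" "t \<le> 3 * real M"
          proof -
            have "real M \<le> real j0" using zG by simp
            then show "real M \<le> t" using j0(1) by linarith
            have "real (Suc j0) \<le> real (3 * M)" using zG by (intro of_nat_mono) simp
            then show "t \<le> 3 * real M" using j0(2) by simp
          qed
          then have "0 \<le> (t - real M) * (3 * real M - t)" by (intro mult_nonneg_nonneg) auto
          then have "3 / 16 * N\<^sup>2 \<le> t * (N - t)" unfolding M(2) by (simp add: power2_eq_square algebra_simps)
          then have "3 / 16 \<le> t * (N - t) / N\<^sup>2" using N0 by (simp add: pos_le_divide_eq)
          also have "t * (N - t) / N\<^sup>2 = - ln l * (N + ln l) / N\<^sup>2" by (simp add: t_def)
          finally show ?thesis unfolding profile_def by linarith
        qed
        have "c7 \<le> (\<sigma> z * P z * profile N l) powr p"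
          unfolding c7
        proof (rule powr_mono2)
          show "3 * a\<^sup>2 * ((1/2) powr \<gamma> / R) * (3/16) \<le> \<sigma> z * P z * profile N l"
            using s3 P3 k3 R P_nonneg[of z] \<sigma>_le[OF z] by (intro mult_mono) auto
        qed (use p R in auto)
        moreover have "h1 z \<ge> 0" unfolding h1_def by (intro sum_nonneg) auto
        ultimately have "c7 * h1 z \<le> (\<sigma> z * P z * profile N l) powr p * (1 / l)"
          using h1l by (intro mult_mono) auto
        then show ?thesis by simp
      qed
      have "h z = \<kappa> * (c7 * h1 z) - C6 * (h2 z + 1)" unfolding h_def z\<Omega> by simp
      also have "\<dots> \<le> \<kappa> * ((\<sigma> z * P z * profile N l) powr p / l) - C6 * (1 / (N * l) + 1)"
        using h1 h2 \<kappa>(2) C60 by (intro diff_mono mult_left_mono add_mono) auto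
      also have "\<dots> \<le> ?\<Theta> z"
        using pointwise_lower_bound[OF True \<alpha> \<theta>, of c] True
        unfolding l_def[symmetric] \<kappa>(1)[symmetric] C6[symmetric] by simp
      finally show ?thesis .
    qed
  qed
  finally show ?thesis .
qed

end

lemma L1_norm_bounded:
  fixes u :: "real \<Rightarrow> 'a::euclidean_space \<Rightarrow> real"
  assumes c: "continuous_into_L1 I \<Omega> u" and sub: "{t1..t2} \<subseteq> I"
  obtains M0 where "\<And>t. t \<in> {t1..t2} \<Longrightarrow> (LINT z|lebesgue_on \<Omega>. \<bar>u t z\<bar>) \<le> M0"
proof -
  define n where "n = (\<lambda>t. LINT z|lebesgue_on \<Omega>. \<bar>u t z\<bar>)"
  have "continuous_on {t1..t2} n"
    unfolding continuous_on_def
  proof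
    fix t assume t: "t \<in> {t1..t2}"
    have i: "integrable (lebesgue_on \<Omega>) (u r)" if "r \<in> {t1..t2}" for r
      using c sub that unfolding continuous_into_L1_def by blast
    have "((\<lambda>r. LINT z|lebesgue_on \<Omega>. \<bar>u r z - u t z\<bar>) \<longlongrightarrow> 0) (at t within I)"
      using c sub t unfolding continuous_into_L1_def by blast
    then have l: "((\<lambda>r. LINT z|lebesgue_on \<Omega>. \<bar>u r z - u t z\<bar>) \<longlongrightarrow> 0) (at t within {t1..t2})"
      by (rule tendsto_within_subset) (rule sub)
    have "((\<lambda>r. n r - n t) \<longlongrightarrow> 0) (at t within {t1..t2})"
    proof (rule Lim_null_comparison[OF _ l])
      show "\<forall>\<^sub>F r in at t within {t1..t2}. norm (n r - n t) \<le> (LINT z|lebesgue_on \<Omega>. \<bar>u r z - u t z\<bar>)"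
        unfolding eventually_at_filter
      proof (rule always_eventually, intro allI impI)
        fix r assume "r \<in> {t1..t2}"
        have "n r - n t = (LINT z|lebesgue_on \<Omega>. \<bar>u r z\<bar> - \<bar>u t z\<bar>)"
          unfolding n_def using i[OF \<open>r \<in> _\<close>] i[OF t] by simp
        also have "\<bar>\<dots>\<bar> \<le> (LINT z|lebesgue_on \<Omega>. \<bar>u r z - u t z\<bar>)"
          by (rule integral_abs_bound_integral) (use i[OF \<open>r \<in> _\<close>] i[OF t] in auto)
        finally show "norm (n r - n t) \<le> (LINT z|lebesgue_on \<Omega>. \<bar>u r z - u t z\<bar>)" by simp
      qed
    qed
    then show "(n \<longlongrightarrow> n t) (at t within {t1..t2})" by (rule LIM_zero_cancel)
  qed
  then have "bounded (n ` {t1..t2})" by (intro compact_imp_bounded compact_continuous_image) auto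
  then obtain M0 where "\<And>t. t \<in> {t1..t2} \<Longrightarrow> \<bar>n t\<bar> \<le> M0"
    unfolding bounded_iff real_norm_def by blast
  then have "\<And>t. t \<in> {t1..t2} \<Longrightarrow> n t \<le> M0" by (meson abs_ge_self order_trans)
  then show ?thesis using that unfolding n_def by blast
qed

theorem corollary3p23:
  fixes u0 :: "('m::finite, 'k::finite) pt \<Rightarrow> real"
    and \<gamma> Q R lam \<alpha> p q c :: real
  assumes "\<gamma> \<ge> 0"
    and "Q = real CARD('m) + (1 + \<gamma>) * real CARD('k)"
    and "R > 0"
    and "\<alpha> < -1"
    and "Q \<ge> p"
    and "p - 1 < q" "q \<le> p - 1 + p / Q"
    and "2 * Q / (Q + 1) \<le> p" "p < 2"
    and "c > (\<bar>\<alpha> + 1\<bar> / p) powr p"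
    and "\<And>z. z \<in> grushin_ball \<gamma> R \<Longrightarrow> u0 z \<ge> 0"
  shows "\<not> (\<exists>T u. general_positive_local_solution \<gamma> p q lam
            (\<lambda>z. ln (R / grushin_rho \<gamma> z) powr (\<alpha> + p))
            (\<lambda>z. c * ln (R / grushin_rho \<gamma> z) powr \<alpha> *
                 (rpow (norm (fst z)) (\<gamma> * p) / grushin_rho \<gamma> z powr (\<gamma> * p + p)))
            (grushin_ball \<gamma> R) {(0, 0)} u0 T u)"
proof
  note \<gamma> = assms(1) and Q = assms(2) and R = assms(3)
  define w :: "('m, 'k) pt \<Rightarrow> real" where "w = (\<lambda>z. ln (R / grushin_rho \<gamma> z) powr (\<alpha> + p))"
  define V :: "('m, 'k) pt \<Rightarrow> real" where "V = (\<lambda>z. c * ln (R / grushin_rho \<gamma> z) powr \<alpha> *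
                 (rpow (norm (fst z)) (\<gamma> * p) / grushin_rho \<gamma> z powr (\<gamma> * p + p)))"
  define \<Omega> :: "('m, 'k) pt set" where "\<Omega> = grushin_ball \<gamma> R"
  assume "\<exists>T u. general_positive_local_solution \<gamma> p q lam
            (\<lambda>z. ln (R / grushin_rho \<gamma> z) powr (\<alpha> + p))
            (\<lambda>z. c * ln (R / grushin_rho \<gamma> z) powr \<alpha> *
                 (rpow (norm (fst z)) (\<gamma> * p) / grushin_rho \<gamma> z powr (\<gamma> * p + p)))
            (grushin_ball \<gamma> R) {(0, 0)} u0 T u"
  then obtain T u where sol: "general_positive_local_solution \<gamma> p q lam w V \<Omega> {(0, 0)} u0 T u"
    unfolding w_def V_def \<Omega>_def by blast
  have card: "real CARD('m) \<ge> 1" "real CARD('k) \<ge> 1" by (simp_all add: Suc_leI)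
  have Q2: "Q \<ge> 2"
  proof -
    have "1 * 1 \<le> (1 + \<gamma>) * real CARD('k)" using \<gamma> card by (intro mult_mono) auto
    then show ?thesis unfolding Q using card by linarith
  qed
  have p1: "p > 1"
  proof -
    have "1 < 2 * Q / (Q + 1)" using Q2 by (simp add: less_divide_eq)
    then show ?thesis using assms(8) by linarith
  qed
  have p2: "p < 2" by (rule assms(9))
  have q: "p - 1 < q" "q \<le> p"
  proof -
    have "p / Q \<le> 1" using assms(5) Q2 by simp
    then show "q \<le> p" using assms(7) by linarith
  qed (rule assms(6))
  define s where "s = \<bar>\<alpha> + 1\<bar> / p"
  have s: "s > 0" "\<alpha> = - 1 - s * p" using assms(4) p1 by (auto simp: s_def)
  \<comment> \<open>Take \<open>\<theta>\<close> so close to \<open>1\<close> that enlarging \<open>s\<^sup>p\<close> by its power yields the midpoint \<open>c'\<close> of \<open>s\<^sup>p\<close> and \<open>c\<close>.\<close>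
  define c' where "c' = (s powr p + c) / 2"
  have sp: "s powr p > 0" using s by simp
  have c': "s powr p < c'" "c' < c" using assms(10) by (auto simp: c'_def s_def)
  define \<theta> where "\<theta> = (s powr p / c') powr (1 / (p - 1))"
  have \<theta>: "0 < \<theta>" "\<theta> < 1" "\<theta> powr (1 - p) * s powr p = c'"
  proof -
    have "c' > 0" using sp c' by linarith
    then have r: "0 < s powr p / c'" "s powr p / c' < 1" using sp c' by (simp_all only: zero_less_divide_iff divide_less_eq_1_pos simp_thms)
    show "0 < \<theta>" unfolding \<theta>_def powr_gt_zero using r(1) by (rule less_imp_neq[THEN not_sym])
    show "\<theta> < 1" unfolding \<theta>_def using r p1 powr_less_mono2[of "1 / (p - 1)" "s powr p / c'" 1] by simp
    have "\<theta> powr (1 - p) = (s powr p / c') powr (- 1)"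
    proof -
      have "1 / (p - 1) * (1 - p) = - 1" using p1 by (simp add: field_simps)
      then show ?thesis unfolding \<theta>_def powr_powr by (simp only:)
    qed
    also have "\<dots> = c' / s powr p" using r s(1) \<open>c' > 0\<close> by (simp add: powr_minus_divide)
    finally show "\<theta> powr (1 - p) * s powr p = c'" using sp by simp
  qed
  define \<kappa> where "\<kappa> = c - \<theta> powr (1 - p) * s powr p"
  have \<kappa>: "\<kappa> > 0" using c' by (simp add: \<kappa>_def \<theta>(3))
  have T: "T > 0" and uL1: "continuous_into_L1 {0..<T} \<Omega> u"
    using sol unfolding general_positive_local_solution_def by blast+
  define t1 where "t1 = T / 3"
  define t2 where "t2 = 2 * T / 3"
  have t: "0 < t1" "t1 < t2" "t2 < T" using T by (auto simp: t1_def t2_def)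
  obtain \<tau> d\<tau> where cut\<tau>: "cutoff {t1..t2} \<tau> (\<lambda>t h. d\<tau> t * h)" and \<tau>0: "\<And>t. \<tau> t \<ge> 0" and I\<tau>: "(LINT t|lborel. \<tau> t) > 0"
    using time_cutoff_exists[OF t(2)] by metis
  obtain B1 where B1: "\<And>t. \<bar>\<tau> t\<bar> \<le> B1" using cutoff.bounded[OF cut\<tau>] by blast
  obtain B2 where B2: "\<And>t. \<bar>d\<tau> t * 1\<bar> \<le> B2" using cutoff.deriv_bounded[OF cut\<tau>, of 1] by auto
  define Ct where "Ct = \<bar>lam\<bar> * B1 + B2 / (2 - p)"
  have Ct: "\<bar>lam\<bar> * \<tau> t + \<bar>d\<tau> t\<bar> / (2 - p) \<le> Ct" for t
    unfolding Ct_def using B1[of t] B2[of t] p2 by (intro add_mono mult_left_mono divide_right_mono) auto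
  obtain M0 where M0: "\<And>t. t \<in> {t1..t2} \<Longrightarrow> (LINT z|lebesgue_on \<Omega>. \<bar>u t z\<bar>) \<le> M0"
    by (rule L1_norm_bounded[OF uL1, of t1 t2]) (use t in auto)
  have \<Omega>: "open \<Omega>" "bounded \<Omega>"
  proof -
    show "open \<Omega>" unfolding \<Omega>_def by (rule open_grushin_ball[OF \<gamma>])
    show "bounded \<Omega>"
      unfolding \<Omega>_def by (rule bounded_subset[OF bounded_rho_le[OF \<gamma>, of R]]) (auto simp: grushin_ball_def)
  qed
  have w: "w \<in> borel_measurable borel" "\<And>z. w z \<ge> 0" "continuous_on (\<Omega> \<inter> {z. fst z \<noteq> 0}) w"
  proof -
    have rm: "(\<lambda>z::('m,'k) pt. grushin_rho \<gamma> z) \<in> borel_measurable borel"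
      using continuous_rho[OF \<gamma>] by (rule borel_measurable_continuous_onI)
    show "w \<in> borel_measurable borel" unfolding w_def using rm by measurable
    show "w z \<ge> 0" for z by (simp add: w_def)
    have r: "0 < grushin_rho \<gamma> z \<and> grushin_rho \<gamma> z < R" if "z \<in> \<Omega> \<inter> {z. fst z \<noteq> 0}" for z
      using that rho_pos[of z \<gamma>] by (auto simp: \<Omega>_def grushin_ball_def)
    have cl: "continuous_on (\<Omega> \<inter> {z. fst z \<noteq> 0}) (\<lambda>z. ln (R / grushin_rho \<gamma> z))"
      by (intro continuous_on_ln continuous_on_divide continuous_on_const continuous_rho[OF \<gamma>] ballI)
         (use r R in \<open>fastforce+\<close>)
    show "continuous_on (\<Omega> \<inter> {z. fst z \<noteq> 0}) w"
      unfolding w_def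
    proof (rule continuous_on_powr[OF cl continuous_on_const], rule ballI)
      fix z :: "('m, 'k) pt" assume "z \<in> \<Omega> \<inter> {z. fst z \<noteq> 0}"
      from r[OF this] show "ln (R / grushin_rho \<gamma> z) \<noteq> 0" using R by simp
    qed
  qed
  \<comment> \<open>None of the following constants depends on the cutoff length \<open>N = 4 M\<close>.\<close>
  define a where "a = R * exp (- 1) / 4"
  have a: "a > 0" using R by (simp add: a_def)
  define C6 where "C6 = (1 - \<theta>) powr (1 - p) * (1/2) powr (1 - p) * ((R * exp 1) powr p + (2 * R) powr p)"
  define c7 where "c7 = (3 * a\<^sup>2 * ((1/2) powr \<gamma> / R) * (3/16)) powr p"
  define V\<Gamma> where "V\<Gamma> = R powr Q * measure lborel ({z::('m, 'k) pt. norm (fst z) > grushin_rho \<gamma> z / 2} \<inter> {z. grushin_rho \<gamma> z < 1})"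
  define V1 where "V1 = R powr Q * measure lborel ((UNIV :: ('m, 'k) pt set) \<inter> {z. grushin_rho \<gamma> z < 1})"
  define G where "G = \<kappa> * c7 * (V\<Gamma> * Q * exp (- Q) * (1 - exp (- 1)))"
  define E where "E = C6 * (2 * exp 1 * (V1 * Q) + measure lborel \<Omega>)"
  define Z where "Z = (R\<^sup>2) powr p * Ct * ((t2 - t1) * (measure lborel \<Omega> + M0))"
  have G: "G > 0"
  proof -
    have "V\<Gamma> > 0" unfolding V\<Gamma>_def using R cone_measure_pos[OF \<gamma>] by (intro mult_pos_pos) auto
    moreover have "c7 > 0" unfolding c7_def using a R by simp
    ultimately show ?thesis unfolding G_def using \<kappa> Q2 by (intro mult_pos_pos) auto
  qed
  have key: "(LINT t|lborel. \<tau> t) * (G * (2 * real M) - E) \<le> Z" if M: "M \<ge> 1" for M :: nat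
  proof -
    interpret b: boundary_test \<gamma> R p s a "4 * real M" "TYPE(('m, 'k) pt)"
      by unfold_locales (use \<gamma> R p1 s a M in auto)
    have LL: "b.L z = ln (R / grushin_rho \<gamma> z)" for z by (simp add: b.L_def)
    have VV: "V z * b.\<Psi> z - w z * (indicator b.supp_set z * b.A z) powr p
        = (c * b.L z powr \<alpha> * (rpow (norm (fst z)) (\<gamma> * p) / grushin_rho \<gamma> z powr (\<gamma> * p + p))) * b.\<Psi> z
          - b.L z powr (\<alpha> + p) * (indicator b.supp_set z * b.A z) powr p" for z
      by (simp add: V_def w_def LL)
    have ub: "(LINT t|lborel. \<tau> t) * (LINT z|lborel. V z * b.\<Psi> z - w z * (indicator b.supp_set z * b.A z) powr p) \<le> Z"
      unfolding Z_def
    proof (rule solution_energy_inequality[OF \<gamma> p1 p2 q \<Omega> sol w b.cutoff_\<Psi> _ b.\<Psi>_bounds _ _ _ cut\<tau> t(1) less_imp_le[OF t(2)] t(3) \<tau>0 Ct M0])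
      show "b.supp_set \<subseteq> \<Omega> \<inter> {z. fst z \<noteq> 0}" using b.supp_set_subset by (simp add: b.off_axis_def \<Omega>_def)
      show "0 \<le> indicator b.supp_set z * b.A z" for z using b.A_nonneg by simp
      show "norm (horizontal \<gamma> z (b.grad_Psi z)) \<le> p * b.\<Psi> z powr ((p - 1) / p) * (indicator b.supp_set z * b.A z)" if "z \<in> b.supp_set" for z
        using b.norm_horizontal_grad_Psi[OF that] that by simp
      show "integrable lborel (\<lambda>z. V z * b.\<Psi> z - w z * (indicator b.supp_set z * b.A z) powr p)"
        unfolding VV by (rule b.integrable_energy)
    qed
    have "G * (2 * real M) - E \<le> (LINT z|lborel. V z * b.\<Psi> z - w z * (indicator b.supp_set z * b.A z) powr p)"
      unfolding VV G_def E_def \<Omega>_def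
      by (rule b.energy_lower_bound[OF M refl a_def s(2) \<theta>(1,2) \<kappa>_def less_imp_le[OF \<kappa>] Q C6_def c7_def V\<Gamma>_def V1_def])
    from mult_left_mono[OF this, of "LINT t|lborel. \<tau> t"] I\<tau> ub show ?thesis by linarith
  qed
  obtain M :: nat where M: "(Z / (LINT t|lborel. \<tau> t) + E) / (2 * G) < real M" using reals_Archimedean2 by blast
  have "Z / (LINT t|lborel. \<tau> t) + E < G * (2 * real (max 1 M))"
  proof -
    have "Z / (LINT t|lborel. \<tau> t) + E < real M * (2 * G)" using M G by (simp add: pos_divide_less_eq)
    also have "\<dots> \<le> real (max 1 M) * (2 * G)" using G by (intro mult_right_mono) auto
    finally show ?thesis by (simp add: mult_ac)
  qed
  then have "Z / (LINT t|lborel. \<tau> t) < G * (2 * real (max 1 M)) - E" by linarith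
  then have "Z < (LINT t|lborel. \<tau> t) * (G * (2 * real (max 1 M)) - E)"
    using I\<tau> by (simp add: pos_divide_less_eq mult.commute)
  then show False using key[of "max 1 M"] by simp
qed

end
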